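(* Let $\mathbf{k}$ be an algebraically closed field. Let $\mathscr{M}$ be the set of extending maximal $\mathbf{k}$-subalgebras of $\mathbf{k}[t,y]$ that contain $\mathbf{k}[t]$. Let $\mathscr{N}$ be the set of extending maximal $\mathbf{k}$-subalgebras $A$ of $\mathbf{k}[t,y,y^{-1}]$ that contain $\mathbf{k}[t,y^{-1}]$ and such that the natural homomorphism $$A \longrightarrow \mathbf{k}[t,y,y^{-1}]/(t-\lambda)$$ is surjective, where $\lambda$ is the unique element of $\mathbf{k}$ such that the crucial maximal ideal of $A$ contains $t-\lambda$. Then: (1) the map $\Theta\colon \mathscr{N} \to \mathscr{M}$, $\Theta(A) = A \cap \mathbf{k}[t,y]$, is a (well-defined) bijection; (2) the map $\Phi(A') = A' \cap \mathbf{k}[t,y]$ is a (well-defined) bijection from the set of extending maximal $\mathbf{k}$-subalgebras $A'$ of $\mathbf{k}[t,t^{-1},y]$ that contain $\mathbf{k}[t,t^{-1}]$ onto the set of those $B \in \mathscr{M}$ such that the crucial maximal ideal of $B$ does not contain $t$.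
   Context: All rings are commutative with unity. A proper subring $A \subsetneq R$ is a maximal subring if there is no ring strictly between $A$ and $R$; a maximal $\mathbf{k}$-subalgebra is a maximal subring that is a $\mathbf{k}$-subalgebra. A maximal subring $A \subsetneq R$ is called extending if the induced morphism $\varphi\colon \operatorname{Spec}(R) \to \operatorname{Spec}(A)$ is not surjective. By a theorem of Ferrand and Olivier, for every maximal subring $A \subsetneq R$ there is a unique maximal ideal $\mathfrak{m}$ of $A$ such that $\varphi$ induces an isomorphism $\operatorname{Spec}(R)\setminus \varphi^{-1}(\mathfrak{m}) \to \operatorname{Spec}(A)\setminus\{\mathfrak{m}\}$; this $\mathfrak{m}$ is called the crucial maximal ideal of $A$. For every extending maximal $\mathbf{k}$-subalgebra $A$ of $\mathbf{k}[t,y,y^{-1}]$ containing $\mathbf{k}[t,y^{-1}]$, the residue field of the crucial maximal ideal is $\mathbf{k}$, so that there is a unique $\lambda \in \mathbf{k}$ with $t-\lambda$ in the crucial maximal ideal. *)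

theory Defs
  imports
    "HOL-Analysis.Abstract_Topology"
    "HOL-Computational_Algebra.Polynomial_Factorial"
    "HOL-Algebra.Algebraic_Closure_Type"
    "HOL-Algebra.Generated_Rings"
begin

section \<open>Prime spectra as ringed spaces\<close>

definition spectrum :: "('a, 'b) ring_scheme \<Rightarrow> 'a set set" where
  "spectrum R = {P. primeideal P R}"

definition zariski :: "('a, 'b) ring_scheme \<Rightarrow> 'a set topology" where
  "zariski R = topology (\<lambda>U. \<exists>S \<subseteq> carrier R. U = {P \<in> spectrum R. \<not> S \<subseteq> P})"

lemma spectrumD:
  assumes "P \<in> spectrum R"
  shows "P \<subseteq> carrier R" "P \<noteq> carrier R"
    "\<And>a b. \<lbrakk>a \<in> carrier R; b \<in> carrier R; a \<otimes>\<^bsub>R\<^esub> b \<in> P\<rbrakk> \<Longrightarrow> a \<in> P \<or> b \<in> P"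
    "\<And>a b. \<lbrakk>a \<in> carrier R; b \<in> P\<rbrakk> \<Longrightarrow> a \<otimes>\<^bsub>R\<^esub> b \<in> P"
    "\<And>a b. \<lbrakk>a \<in> P; b \<in> carrier R\<rbrakk> \<Longrightarrow> a \<otimes>\<^bsub>R\<^esub> b \<in> P"
    "cring R"
proof -
  interpret primeideal P R
    using assms by (simp add: spectrum_def)
  show "P \<subseteq> carrier R" using a_subset .
  show "P \<noteq> carrier R" using I_notcarr by blast
  show "\<And>a b. \<lbrakk>a \<in> carrier R; b \<in> carrier R; a \<otimes>\<^bsub>R\<^esub> b \<in> P\<rbrakk> \<Longrightarrow> a \<in> P \<or> b \<in> P"
    using I_prime by blast
  show "\<And>a b. \<lbrakk>a \<in> carrier R; b \<in> P\<rbrakk> \<Longrightarrow> a \<otimes>\<^bsub>R\<^esub> b \<in> P"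
    using I_l_closed by blast
  show "\<And>a b. \<lbrakk>a \<in> P; b \<in> carrier R\<rbrakk> \<Longrightarrow> a \<otimes>\<^bsub>R\<^esub> b \<in> P"
    using I_r_closed by blast
  show "cring R" using is_cring .
qed

lemma istopology_zariski:
  "istopology (\<lambda>U. \<exists>S \<subseteq> carrier R. U = {P \<in> spectrum R. \<not> S \<subseteq> P})"
  unfolding istopology_def
proof (intro conjI allI impI)
  fix U V
  assume "\<exists>S \<subseteq> carrier R. U = {P \<in> spectrum R. \<not> S \<subseteq> P}"
    and "\<exists>S \<subseteq> carrier R. V = {P \<in> spectrum R. \<not> S \<subseteq> P}"
  then obtain S T where S: "S \<subseteq> carrier R" "U = {P \<in> spectrum R. \<not> S \<subseteq> P}"
    and T: "T \<subseteq> carrier R" "V = {P \<in> spectrum R. \<not> T \<subseteq> P}"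
    by blast
  let ?ST = "{a \<otimes>\<^bsub>R\<^esub> b | a b. a \<in> S \<and> b \<in> T}"
  have *: "\<not> ?ST \<subseteq> P \<longleftrightarrow> \<not> S \<subseteq> P \<and> \<not> T \<subseteq> P" if P: "P \<in> spectrum R" for P
  proof
    assume "\<not> ?ST \<subseteq> P"
    then obtain a b where ab: "a \<in> S" "b \<in> T" "a \<otimes>\<^bsub>R\<^esub> b \<notin> P" by blast
    then have "a \<notin> P" "b \<notin> P"
      using spectrumD(4,5)[OF P] S(1) T(1) by blast+
    then show "\<not> S \<subseteq> P \<and> \<not> T \<subseteq> P" using ab by blast
  next
    assume "\<not> S \<subseteq> P \<and> \<not> T \<subseteq> P"
    then obtain a b where ab: "a \<in> S" "b \<in> T" "a \<notin> P" "b \<notin> P" by blast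
    then have "a \<otimes>\<^bsub>R\<^esub> b \<notin> P"
      using spectrumD(3)[OF P] S(1) T(1) by blast
    then show "\<not> ?ST \<subseteq> P" using ab by blast
  qed
  show "\<exists>S \<subseteq> carrier R. U \<inter> V = {P \<in> spectrum R. \<not> S \<subseteq> P}"
  proof (cases "spectrum R = {}")
    case True
    then show ?thesis using S by blast
  next
    case False
    then obtain P where "P \<in> spectrum R" by blast
    then interpret cring R by (rule spectrumD)
    have "?ST \<subseteq> carrier R" using S(1) T(1) by blast
    moreover have "U \<inter> V = {P \<in> spectrum R. \<not> ?ST \<subseteq> P}"
      using * unfolding S(2) T(2) by blast
    ultimately show ?thesis by blast
  qed
next
  fix \<K>
  assume "\<forall>K\<in>\<K>. \<exists>S \<subseteq> carrier R. K = {P \<in> spectrum R. \<not> S \<subseteq> P}"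
  then obtain F where F: "\<And>K. K \<in> \<K> \<Longrightarrow> F K \<subseteq> carrier R"
      "\<And>K. K \<in> \<K> \<Longrightarrow> K = {P \<in> spectrum R. \<not> F K \<subseteq> P}"
    by metis
  have "P \<in> \<Union>\<K> \<longleftrightarrow> P \<in> spectrum R \<and> \<not> (\<Union>K\<in>\<K>. F K) \<subseteq> P" for P
    using F(2) by (auto 4 4)
  then have "\<Union>\<K> = {P \<in> spectrum R. \<not> (\<Union>K\<in>\<K>. F K) \<subseteq> P}"
    by blast
  then show "\<exists>S \<subseteq> carrier R. \<Union>\<K> = {P \<in> spectrum R. \<not> S \<subseteq> P}"
    using F(1) by (intro exI[of _ "\<Union>K\<in>\<K>. F K"]) blast
qed

lemma openin_zariski:
  "openin (zariski R) U \<longleftrightarrow> (\<exists>S \<subseteq> carrier R. U = {P \<in> spectrum R. \<not> S \<subseteq> P})"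
  by (simp add: zariski_def topology_inverse'[OF istopology_zariski])

lemma topspace_zariski: "topspace (zariski R) = spectrum R"
proof -
  have "openin (zariski R) (spectrum R)"
    unfolding openin_zariski
    by (intro exI[of _ "carrier R"]) (use spectrumD(1,2) in blast)
  moreover have "U \<subseteq> spectrum R" if "openin (zariski R) U" for U
    using that unfolding openin_zariski by blast
  ultimately show ?thesis
    unfolding topspace_def by blast
qed

text \<open>
  The fraction \<open>a/f\<close> in the localization \<open>R\<^sub>P\<close>, as an equivalence class of pairs.
\<close>

definition loc_frac :: "('a, 'b) ring_scheme \<Rightarrow> 'a set \<Rightarrow> 'a \<Rightarrow> 'a \<Rightarrow> ('a \<times> 'a) set" where
  "loc_frac R P a f = {(b, g). b \<in> carrier R \<and> g \<in> carrier R - P \<and>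
     (\<exists>h \<in> carrier R - P. h \<otimes>\<^bsub>R\<^esub> (a \<otimes>\<^bsub>R\<^esub> g) = h \<otimes>\<^bsub>R\<^esub> (b \<otimes>\<^bsub>R\<^esub> f))}"

text \<open>
  The structure sheaf: functions with value in \<open>R\<^sub>P\<close> at each \<open>P\<close> that are locally given by
  a single fraction; they are \<^const>\<open>undefined\<close> outside the open set.
\<close>

definition sections :: "('a, 'b) ring_scheme \<Rightarrow> 'a set set \<Rightarrow> ('a set \<Rightarrow> ('a \<times> 'a) set) set" where
  "sections R U = {s \<in> extensional U. \<forall>P\<in>U. \<exists>V a f.
     openin (zariski R) V \<and> P \<in> V \<and> V \<subseteq> U \<and> a \<in> carrier R \<and> f \<in> carrier R \<and>
     (\<forall>Q\<in>V. f \<notin> Q \<and> s Q = loc_frac R Q a f)}"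

section \<open>The morphism of spectra induced by a subring\<close>

definition spec_map :: "'a set \<Rightarrow> 'a set \<Rightarrow> 'a set" where
  "spec_map A Q = Q \<inter> A"

definition spec_preimage :: "'a set \<Rightarrow> ('a, 'b) ring_scheme \<Rightarrow> 'a set set \<Rightarrow> 'a set set" where
  "spec_preimage A R V = {Q \<in> spectrum R. spec_map A Q \<in> V}"

text \<open>
  For a fraction \<open>c\<close> of the localization of a subring \<open>A\<close> at \<open>Q \<inter> A\<close>, this is its image in
  \<open>R\<^sub>Q\<close>: all members of the class \<open>c\<close> give the same class in \<open>R\<^sub>Q\<close>
  (see \<open>loc_map_loc_frac\<close>).
\<close>

definition loc_map :: "('a, 'b) ring_scheme \<Rightarrow> 'a set \<Rightarrow> ('a \<times> 'a) set \<Rightarrow> ('a \<times> 'a) set" where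
  "loc_map R Q c = (\<Union>(b, g)\<in>c. loc_frac R Q b g)"

definition pullback ::
  "'a set \<Rightarrow> ('a, 'b) ring_scheme \<Rightarrow> 'a set set \<Rightarrow> ('a set \<Rightarrow> ('a \<times> 'a) set) \<Rightarrow> 'a set \<Rightarrow> ('a \<times> 'a) set"
  where "pullback A R V s = (\<lambda>Q \<in> spec_preimage A R V. loc_map R Q (s (spec_map A Q)))"

lemma loc_frac_cong:
  assumes "Q \<in> spectrum R" "(b, g) \<in> loc_frac R Q a f"
    and "a \<in> carrier R" "f \<in> carrier R - Q"
  shows "loc_frac R Q b g \<subseteq> loc_frac R Q a f"
proof
  interpret cring R using assms(1) by (rule spectrumD)
  have mult: "u \<otimes>\<^bsub>R\<^esub> v \<in> carrier R - Q" if "u \<in> carrier R - Q" "v \<in> carrier R - Q" for u v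
    using spectrumD(3)[OF assms(1)] that by blast
  obtain h where bg: "b \<in> carrier R" "g \<in> carrier R - Q"
    and h: "h \<in> carrier R - Q" "h \<otimes>\<^bsub>R\<^esub> (a \<otimes>\<^bsub>R\<^esub> g) = h \<otimes>\<^bsub>R\<^esub> (b \<otimes>\<^bsub>R\<^esub> f)"
    using assms(2) unfolding loc_frac_def by blast
  fix x assume "x \<in> loc_frac R Q b g"
  then obtain c k l where x: "x = (c, k)" "c \<in> carrier R" "k \<in> carrier R - Q"
    and l: "l \<in> carrier R - Q" "l \<otimes>\<^bsub>R\<^esub> (b \<otimes>\<^bsub>R\<^esub> k) = l \<otimes>\<^bsub>R\<^esub> (c \<otimes>\<^bsub>R\<^esub> g)"
    unfolding loc_frac_def by blast
  have C: "a \<in> carrier R" "f \<in> carrier R" "b \<in> carrier R" "g \<in> carrier R" "h \<in> carrier R"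
    "c \<in> carrier R" "k \<in> carrier R" "l \<in> carrier R"
    using assms bg h x l by auto
  have "(h \<otimes>\<^bsub>R\<^esub> l \<otimes>\<^bsub>R\<^esub> g) \<otimes>\<^bsub>R\<^esub> (a \<otimes>\<^bsub>R\<^esub> k) = (l \<otimes>\<^bsub>R\<^esub> k) \<otimes>\<^bsub>R\<^esub> (h \<otimes>\<^bsub>R\<^esub> (a \<otimes>\<^bsub>R\<^esub> g))"
    using C by (simp add: m_ac)
  also have "\<dots> = (h \<otimes>\<^bsub>R\<^esub> f) \<otimes>\<^bsub>R\<^esub> (l \<otimes>\<^bsub>R\<^esub> (b \<otimes>\<^bsub>R\<^esub> k))"
    unfolding h(2) using C by (simp add: m_ac)
  also have "\<dots> = (h \<otimes>\<^bsub>R\<^esub> l \<otimes>\<^bsub>R\<^esub> g) \<otimes>\<^bsub>R\<^esub> (c \<otimes>\<^bsub>R\<^esub> f)"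
    unfolding l(2) using C by (simp add: m_ac)
  finally show "x \<in> loc_frac R Q a f"
    unfolding loc_frac_def using x mult[OF mult[OF h(1) l(1)] bg(2)] by blast
qed

lemma loc_map_loc_frac:
  assumes "subring A R" "Q \<in> spectrum R" "a \<in> A" "f \<in> A - Q"
  shows "loc_map R Q (loc_frac (R\<lparr>carrier := A\<rparr>) (spec_map A Q) a f) = loc_frac R Q a f"
proof -
  interpret cring R using assms(2) by (rule spectrumD)
  have A: "A \<subseteq> carrier R" using subringE(1)[OF assms(1)] .
  have af: "a \<in> carrier R" "f \<in> carrier R - Q" using A assms by auto
  have one: "\<one>\<^bsub>R\<^esub> \<in> A" using subringE(3)[OF assms(1)] .
  have "\<one>\<^bsub>R\<^esub> \<notin> Q"
    using spectrumD(1,2,4)[OF assms(2)] by (metis r_one subsetI subset_antisym)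
  then have "(a, f) \<in> loc_frac (R\<lparr>carrier := A\<rparr>) (spec_map A Q) a f"
    using assms one unfolding loc_frac_def spec_map_def by auto
  moreover have "(b, g) \<in> loc_frac R Q a f"
    if "(b, g) \<in> loc_frac (R\<lparr>carrier := A\<rparr>) (spec_map A Q) a f" for b g
    using that A unfolding loc_frac_def spec_map_def by auto
  ultimately show ?thesis
    unfolding loc_map_def using loc_frac_cong[OF assms(2) _ af] by blast
qed

text \<open>
  The morphism \<open>Spec R \<rightarrow> Spec A\<close> restricts to an isomorphism of schemes
  \<open>Spec R - \<phi>\<^sup>-\<^sup>1(m) \<rightarrow> Spec A - {m}\<close>: it is a homeomorphism there, and pulling back sections
  is bijective on every open subset.
\<close>

definition iso_away_from :: "'a set \<Rightarrow> 'a set \<Rightarrow> ('a, 'b) ring_scheme \<Rightarrow> bool" where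
  "iso_away_from m A R \<longleftrightarrow>
     homeomorphic_map
       (subtopology (zariski R) (spectrum R - spec_preimage A R {m}))
       (subtopology (zariski (R\<lparr>carrier := A\<rparr>)) (spectrum (R\<lparr>carrier := A\<rparr>) - {m}))
       (spec_map A) \<and>
     (\<forall>V. openin (zariski (R\<lparr>carrier := A\<rparr>)) V \<and> m \<notin> V \<longrightarrow>
        bij_betw (pullback A R V)
          (sections (R\<lparr>carrier := A\<rparr>) V) (sections R (spec_preimage A R V)))"

section \<open>Maximal subrings\<close>

definition maximal_subring :: "'a set \<Rightarrow> ('a, 'b) ring_scheme \<Rightarrow> bool" where
  "maximal_subring A R \<longleftrightarrow> subring A R \<and> A \<noteq> carrier R \<and>
     (\<forall>B. subring B R \<and> A \<subseteq> B \<longrightarrow> B = A \<or> B = carrier R)"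

definition extending :: "'a set \<Rightarrow> ('a, 'b) ring_scheme \<Rightarrow> bool" where
  "extending A R \<longleftrightarrow> spec_map A ` spectrum R \<noteq> spectrum (R\<lparr>carrier := A\<rparr>)"

definition crucial_ideal :: "'a set \<Rightarrow> ('a, 'b) ring_scheme \<Rightarrow> 'a set" where
  "crucial_ideal A R = (THE m. maximalideal m (R\<lparr>carrier := A\<rparr>) \<and> iso_away_from m A R)"

section \<open>Subalgebras of the rational function field in two variables\<close>

text \<open>All algebras are realized inside \<open>k(t, y)\<close>, the fraction field of \<open>k[t][y]\<close>.\<close>

abbreviation ratfun :: "'k::field poly poly fract ring" where
  "ratfun \<equiv> ring_of_type_algebra"

definition const :: "'k::field \<Rightarrow> 'k poly poly fract" where
  "const c = to_fract [:[:c:]:]"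

definition var_t :: "'k::field poly poly fract" where
  "var_t = to_fract [:[:0, 1:]:]"

definition var_y :: "'k::field poly poly fract" where
  "var_y = to_fract [:0, 1:]"

text \<open>\<open>kalg {x\<^sub>1, \<dots>, x\<^sub>n}\<close> is the \<open>k\<close>-algebra \<open>k[x\<^sub>1, \<dots>, x\<^sub>n]\<close>.\<close>

definition kalg :: "'k::field poly poly fract set \<Rightarrow> 'k poly poly fract ring" where
  "kalg S = ratfun\<lparr>carrier := generate_ring ratfun (range const \<union> S)\<rparr>"

definition ext_max_subalgebras ::
  "'k::field poly poly fract ring \<Rightarrow> 'k poly poly fract set set" where
  "ext_max_subalgebras R =
     {A. maximal_subring A R \<and> subalgebra (range const) A R \<and> extending A R}"

definition \<M> :: "'k::field poly poly fract set set" where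
  "\<M> = {B \<in> ext_max_subalgebras (kalg {var_t, var_y}). carrier (kalg {var_t}) \<subseteq> B}"

abbreviation laurent_y :: "'k::field poly poly fract ring" where
  "laurent_y \<equiv> kalg {var_t, var_y, inverse var_y}"

definition crucial_value :: "'k::field poly poly fract set \<Rightarrow> 'k" where
  "crucial_value A = (THE c. var_t - const c \<in> crucial_ideal A laurent_y)"

definition \<N> :: "'k::field poly poly fract set set" where
  "\<N> = {A \<in> ext_max_subalgebras laurent_y.
     carrier (kalg {var_t, inverse var_y}) \<subseteq> A \<and>
     (let I = PIdl\<^bsub>laurent_y\<^esub> (var_t - const (crucial_value A))
      in (\<lambda>a. I +>\<^bsub>laurent_y\<^esub> a) ` A = carrier (laurent_y Quot I))}"

end

theory Submission
  imports Defs
begin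

text \<open>
  Let \<open>A\<close> be an extending maximal subring of a subring \<open>R\<close> of a field and \<open>p\<close> a prime of \<open>A\<close> that
  is not in the image of \<open>Spec R\<close>. Chevalley's theorem gives a valuation ring \<open>V\<close> dominating the
  localization of \<open>A\<close> at \<open>p\<close>, and maximality forces \<open>A = V \<inter> R\<close>. Since the subring \<open>A + pR\<close> is
  all of \<open>R\<close>, every \<open>x \<in> R - A\<close> satisfies a polynomial equation with unit linear coefficient, and
  therefore \<open>a x = b\<close> with \<open>a \<in> p\<close>, \<open>b \<in> A - p\<close>. Consequently elements of \<open>p\<close> act locally
  nilpotently and elements of \<open>A - p\<close> bijectively on \<open>R/A\<close>, so \<open>p\<close> is maximal and is the crucial
  ideal.

  For \<open>P = k[t,y]\<close> inside \<open>R\<close>, the ring \<open>B = A \<inter> P\<close> is again extending and maximal as soon as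
  \<open>B\<close> maps onto \<open>A/p\<close> and \<open>A\<close> lies in the localization of \<open>B\<close> at \<open>p \<inter> B\<close>. Over \<open>k[t,y,1/y]\<close>
  the surjectivity condition makes \<open>y\<close> an element of \<open>B + (t - \<lambda>)P\<close>, which yields \<open>1/y = a/b\<close>
  with \<open>a \<in> p \<inter> B\<close>, \<open>b \<in> B - p\<close>; over \<open>k[t,1/t,y]\<close> one simply has \<open>t \<in> B - p\<close>. Conversely
  \<open>A = V \<inter> R\<close> recovers \<open>A\<close> from \<open>B = V \<inter> P\<close>. If \<open>(t - \<lambda>)R\<close> were contained in \<open>A\<close>, then reduction
  modulo \<open>t - \<lambda>\<close> would show that \<open>p \<inter> B\<close> is contained in \<open>(t - \<lambda>)P\<close>, hence
  \<open>(p \<inter> B)P\<close> in \<open>B\<close>, contrary to \<open>B\<close> being extending.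
\<close>

section \<open>Subrings and ideals of a field as sets\<close>

text \<open>All rings of the theorem lie in the field \<open>k(t, y)\<close>, so a ring is handled
  as a subset closed under the type class operations; \<open>set_ring\<close> later links this view
  with the records of HOL-Algebra.\<close>

definition subring_set :: "'a::comm_ring_1 set \<Rightarrow> bool" where
  "subring_set S \<longleftrightarrow> 1 \<in> S \<and> (\<forall>a\<in>S. \<forall>b\<in>S. a - b \<in> S \<and> a * b \<in> S)"

definition ideal_set :: "'a::comm_ring_1 set \<Rightarrow> 'a set \<Rightarrow> bool" where
  "ideal_set I S \<longleftrightarrow> I \<subseteq> S \<and> 0 \<in> I \<and> (\<forall>a\<in>I. \<forall>b\<in>I. a + b \<in> I) \<and> (\<forall>a\<in>S. \<forall>b\<in>I. a * b \<in> I)"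

definition prime_set :: "'a::comm_ring_1 set \<Rightarrow> 'a set \<Rightarrow> bool" where
  "prime_set p S \<longleftrightarrow> ideal_set p S \<and> 1 \<notin> p \<and> (\<forall>a\<in>S. \<forall>b\<in>S. a * b \<in> p \<longrightarrow> a \<in> p \<or> b \<in> p)"

lemma subring_setD:
  assumes "subring_set S"
  shows "0 \<in> S" "1 \<in> S"
    "\<And>a b. a \<in> S \<Longrightarrow> b \<in> S \<Longrightarrow> a + b \<in> S"
    "\<And>a b. a \<in> S \<Longrightarrow> b \<in> S \<Longrightarrow> a - b \<in> S"
    "\<And>a b. a \<in> S \<Longrightarrow> b \<in> S \<Longrightarrow> a * b \<in> S"
    "\<And>a. a \<in> S \<Longrightarrow> - a \<in> S"
    "\<And>a n. a \<in> S \<Longrightarrow> a ^ n \<in> S"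
proof -
  show 1: "1 \<in> S" and d: "\<And>a b. a \<in> S \<Longrightarrow> b \<in> S \<Longrightarrow> a - b \<in> S"
    and m: "\<And>a b. a \<in> S \<Longrightarrow> b \<in> S \<Longrightarrow> a * b \<in> S"
    using assms unfolding subring_set_def by auto
  show 0: "0 \<in> S" using d[OF 1 1] by simp
  show n: "\<And>a. a \<in> S \<Longrightarrow> - a \<in> S" using d[OF 0] by fastforce
  show "\<And>a b. a \<in> S \<Longrightarrow> b \<in> S \<Longrightarrow> a + b \<in> S" using d n by (metis diff_minus_eq_add)
  show "a ^ n \<in> S" if "a \<in> S" for a n
    by (induction n) (use 1 m that in auto)
qed

lemma ideal_setD:
  assumes "ideal_set I S"
  shows "I \<subseteq> S" "0 \<in> I"
    "\<And>a b. a \<in> I \<Longrightarrow> b \<in> I \<Longrightarrow> a + b \<in> I"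
    "\<And>a b. a \<in> S \<Longrightarrow> b \<in> I \<Longrightarrow> a * b \<in> I"
    "\<And>a b. a \<in> I \<Longrightarrow> b \<in> S \<Longrightarrow> a * b \<in> I"
proof -
  show "I \<subseteq> S" "0 \<in> I" "\<And>a b. a \<in> I \<Longrightarrow> b \<in> I \<Longrightarrow> a + b \<in> I"
    and *: "\<And>a b. a \<in> S \<Longrightarrow> b \<in> I \<Longrightarrow> a * b \<in> I"
    using assms unfolding ideal_set_def by simp_all
  show "a * b \<in> I" if "a \<in> I" "b \<in> S" for a b using *[OF that(2,1)] by (simp add: mult.commute)
qed

lemma ideal_set_minus:
  assumes "subring_set S" "ideal_set I S"
  shows "a \<in> I \<Longrightarrow> - a \<in> I" "a \<in> I \<Longrightarrow> b \<in> I \<Longrightarrow> a - b \<in> I"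
proof -
  show *: "- a \<in> I" if "a \<in> I" for a
    using ideal_setD(4)[OF assms(2), of "-1" a] subring_setD(2,6)[OF assms(1)] that by auto
  show "a \<in> I \<Longrightarrow> b \<in> I \<Longrightarrow> a - b \<in> I"
    using *[of b] ideal_setD(3)[OF assms(2), of a "- b"] by simp
qed

lemma ideal_set_self: "subring_set S \<Longrightarrow> ideal_set S S"
  unfolding ideal_set_def using subring_setD(1,3,5) by blast

lemma ideal_set_sum:
  assumes "ideal_set I S" "\<And>x. x \<in> D \<Longrightarrow> f x \<in> I"
  shows "sum f D \<in> I"
  using assms(2)
proof (induction D rule: infinite_finite_induct)
  case (insert x D)
  then show ?case by (simp add: ideal_setD(3)[OF assms(1)])
qed (use ideal_setD(2)[OF assms(1)] in simp_all)

lemma prime_setD: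
  assumes "prime_set p S"
  shows "ideal_set p S" "1 \<notin> p" "\<And>a b. a \<in> S \<Longrightarrow> b \<in> S \<Longrightarrow> a * b \<in> p \<Longrightarrow> a \<in> p \<or> b \<in> p"
  using assms unfolding prime_set_def by auto

lemma prime_set_power:
  assumes "subring_set S" "prime_set p S" "a \<in> S" "a ^ n \<in> p"
  shows "a \<in> p"
  using assms(4)
proof (induction n)
  case 0
  then show ?case using prime_setD(2)[OF assms(2)] by simp
next
  case (Suc n)
  then show ?case
    using prime_setD(3)[OF assms(2,3), of "a ^ n"] subring_setD(7)[OF assms(1,3)] by auto
qed

lemma ideal_set_one: "ideal_set I S \<Longrightarrow> 1 \<in> I \<Longrightarrow> I = S"
  unfolding ideal_set_def by force

lemma subring_set_Int: "subring_set S \<Longrightarrow> subring_set T \<Longrightarrow> subring_set (S \<inter> T)"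
  unfolding subring_set_def by auto

lemma prime_set_Int:
  assumes "prime_set p S" "T \<subseteq> S" "subring_set T"
  shows "prime_set (p \<inter> T) T"
  using assms(1,2) subring_setD(1,3,5)[OF assms(3)] unfolding prime_set_def ideal_set_def
  by (simp add: subset_iff)

text \<open>With \<open>I = A\<close> this is the ring \<open>A[x]\<close>; otherwise it is \<open>A + I A[x] x\<close>.\<close>

definition adjoin :: "'a::comm_ring_1 set \<Rightarrow> 'a set \<Rightarrow> 'a \<Rightarrow> 'a set" where
  "adjoin A I x = {poly (pCons a q) x |a q. a \<in> A \<and> range (coeff q) \<subseteq> I}"

lemma range_coeff_pCons: "range (coeff (pCons a q)) \<subseteq> I \<longleftrightarrow> a \<in> I \<and> range (coeff q) \<subseteq> I"
proof -
  have "(\<forall>n. coeff (pCons a q) n \<in> I) \<longleftrightarrow> a \<in> I \<and> (\<forall>n. coeff q n \<in> I)"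
    by (metis coeff_pCons_0 coeff_pCons_Suc not0_implies_Suc)
  then show ?thesis by (simp add: image_subset_iff)
qed

lemma coeffs_in_mult:
  fixes q r :: "'a::comm_ring_1 poly"
  assumes I: "ideal_set I A" and q: "range (coeff q) \<subseteq> A" and r: "range (coeff r) \<subseteq> I"
  shows "range (coeff (q * r)) \<subseteq> I"
  using q r by (auto simp: coeff_mult intro!: ideal_set_sum[OF I] ideal_setD(4)[OF I])

lemma coeffs_in_arith:
  fixes q r :: "'a::comm_ring_1 poly"
  assumes A: "subring_set A" and I: "ideal_set I A" and q: "range (coeff q) \<subseteq> I" and r: "range (coeff r) \<subseteq> I"
  shows "range (coeff (q + r)) \<subseteq> I" "range (coeff (q - r)) \<subseteq> I"
    "a \<in> A \<Longrightarrow> range (coeff (smult a q)) \<subseteq> I"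
  using q r ideal_set_minus(2)[OF A I] ideal_setD(3,4)[OF I] by (auto simp: image_subset_iff)

lemma subring_adjoin:
  fixes x :: "'a::comm_ring_1"
  assumes A: "subring_set A" and I: "ideal_set I A"
  shows "subring_set (adjoin A I x)"
  unfolding subring_set_def
proof (intro conjI ballI)
  have "range (coeff (0::'a poly)) \<subseteq> I" using ideal_setD(2)[OF I] by auto
  then have "poly (pCons 1 0) x \<in> adjoin A I x"
    unfolding adjoin_def using subring_setD(2)[OF A] by blast
  then show "1 \<in> adjoin A I x" by simp
  fix u v assume "u \<in> adjoin A I x" "v \<in> adjoin A I x"
  then obtain a q b r where u: "u = poly (pCons a q) x" "a \<in> A" "range (coeff q) \<subseteq> I"
    and v: "v = poly (pCons b r) x" "b \<in> A" "range (coeff r) \<subseteq> I"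
    unfolding adjoin_def by blast
  have "u - v = poly (pCons (a - b) (q - r)) x" using u v by (simp add: algebra_simps)
  moreover have "range (coeff (q - r)) \<subseteq> I"
    using u v ideal_set_minus(2)[OF A I] by auto
  ultimately show "u - v \<in> adjoin A I x"
    unfolding adjoin_def using subring_setD(4)[OF A u(2) v(2)] by blast
  \<comment> \<open>The cross term \<open>x q r\<close> is written as
    \<open>pCons b q * r - smult b r\<close>; this way every summand is a product of something over
    \<open>A\<close> with something over \<open>I\<close>, so its coefficients stay in
    \<open>I\<close>.\<close>
  have "u * v = poly (pCons (a * b) (smult a r + pCons b q * r + smult b q - smult b r)) x"
    using u v by (simp add: algebra_simps)
  moreover have "range (coeff (smult a r + pCons b q * r + smult b q - smult b r)) \<subseteq> I"
  proof -
    have "range (coeff (pCons b q)) \<subseteq> A"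
      using v(2) subset_trans[OF u(3) ideal_setD(1)[OF I]] by (simp add: range_coeff_pCons)
    then have "range (coeff (pCons b q * r)) \<subseteq> I" using coeffs_in_mult[OF I] v(3) by blast
    then show ?thesis
      using u v coeffs_in_arith[OF A I] by metis
  qed
  ultimately show "u * v \<in> adjoin A I x"
    unfolding adjoin_def using subring_setD(5)[OF A u(2) v(2)] by blast
qed

lemma adjoin_base: "ideal_set I A \<Longrightarrow> A \<subseteq> adjoin A I x"
proof
  fix a assume "ideal_set I A" "a \<in> A"
  then have "a = poly (pCons a 0) x \<and> a \<in> A \<and> range (coeff 0) \<subseteq> I"
    using ideal_setD(2) by auto
  then show "a \<in> adjoin A I x" unfolding adjoin_def by blast
qed

lemma adjoin_gen:
  assumes "0 \<in> A" "0 \<in> I" "i \<in> I"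
  shows "i * x ^ Suc n \<in> adjoin A I x"
proof -
  have "i * x ^ Suc n = poly (pCons 0 (monom i n)) x"
    by (simp add: poly_monom algebra_simps)
  moreover have "range (coeff (monom i n)) \<subseteq> I"
    using assms by auto
  ultimately show ?thesis unfolding adjoin_def using assms(1) by blast
qed

lemma poly_in_subring:
  assumes "subring_set R" "x \<in> R" "range (coeff q) \<subseteq> R"
  shows "poly q x \<in> R"
  using assms(3)
proof (induction q)
  case (pCons a q)
  have "a \<in> R" "range (coeff q) \<subseteq> R" using pCons.prems by (simp_all add: range_coeff_pCons)
  then show ?case using pCons.IH assms(2) subring_setD[OF assms(1)] by simp
qed (simp add: subring_setD(1)[OF assms(1)])

lemma adjoin_le:
  assumes "subring_set R" "A \<subseteq> R" "ideal_set I A" "x \<in> R"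
  shows "adjoin A I x \<subseteq> R"
proof
  fix u assume "u \<in> adjoin A I x"
  then obtain a q where u: "u = poly (pCons a q) x" "a \<in> A" "range (coeff q) \<subseteq> I"
    unfolding adjoin_def by blast
  then have "poly q x \<in> R"
    using assms ideal_setD(1)[OF assms(3)] by (intro poly_in_subring) auto
  then show "u \<in> R" using u assms(2,4) subring_setD[OF assms(1)] by auto
qed

section \<open>Valuation rings and Chevalley's extension theorem\<close>

definition valuation_ring :: "'a::field set \<Rightarrow> bool" where
  "valuation_ring V \<longleftrightarrow> subring_set V \<and> (\<forall>x. x \<in> V \<or> inverse x \<in> V)"

text \<open>The maximal ideal of the valuation ring: its nonunits. As \<open>inverse 0 = 0\<close>
  lies in \<open>V\<close>, zero has to be listed separately.\<close>

definition val_ideal :: "'a::field set \<Rightarrow> 'a set" where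
  "val_ideal V = {x. x = 0 \<or> inverse x \<notin> V}"

text \<open>Closure under sums is the point: of two nonzero elements one divides the other in
  \<open>V\<close>, so their sum is a multiple of one of them.\<close>

lemma val_ideal_prime:
  assumes V: "valuation_ring V"
  shows "prime_set (val_ideal V) V"
proof -
  have S: "subring_set V" and tot: "\<And>x. x \<in> V \<or> inverse x \<in> V"
    using V unfolding valuation_ring_def by auto
  note S' = subring_setD[OF S]
  have sub: "val_ideal V \<subseteq> V" using tot S'(1) unfolding val_ideal_def by auto
  have mult: "a * b \<in> val_ideal V" if "a \<in> V" "b \<in> val_ideal V" for a b
  proof (rule ccontr)
    assume "a * b \<notin> val_ideal V"
    then have "inverse (a * b) \<in> V" "a \<noteq> 0" "b \<noteq> 0" unfolding val_ideal_def by auto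
    then have "a * inverse (a * b) \<in> V" "a * inverse (a * b) = inverse b"
      using S'(5) that(1) by (blast, simp)
    then have "inverse b \<in> V" by metis
    then show False using that(2) \<open>b \<noteq> 0\<close> unfolding val_ideal_def by blast
  qed
  have add1: "a + b \<in> val_ideal V" if "b \<in> val_ideal V" "b \<noteq> 0" "a / b \<in> V" for a b
  proof -
    have "(a / b + 1) * b \<in> val_ideal V" using that mult S' by blast
    moreover have "(a / b + 1) * b = a + b" using that(2) by (simp add: distrib_right)
    ultimately show ?thesis by simp
  qed
  have add: "a + b \<in> val_ideal V" if "a \<in> val_ideal V" "b \<in> val_ideal V" for a b
  proof (cases "a = 0 \<or> b = 0")
    case False
    have "a / b \<in> V \<or> b / a \<in> V" using tot[of "a / b"] by (simp add: field_simps)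
    then show ?thesis using add1[of b a] add1[of a b] that False by (auto simp: add.commute)
  qed (use that in auto)
  have "a \<in> val_ideal V \<or> b \<in> val_ideal V" if "a * b \<in> val_ideal V" for a b
    using that S'(5)[of "inverse a" "inverse b"] unfolding val_ideal_def by auto
  then show ?thesis
    unfolding prime_set_def ideal_set_def using sub mult add S'
    by (auto simp: val_ideal_def)
qed

text \<open>The descent behind Chevalley's theorem. Because \<open>1 - j\<close> is a unit for
  \<open>j\<close> in \<open>J\<close>, the shorter of the two relations expresses the top power in
  the longer one through lower powers with coefficients in \<open>J\<close>. Substitution shortens
  the longer relation, and the induction on \<open>n + m\<close> ends with \<open>1\<close> in
  \<open>J\<close>.\<close>

lemma unit_combination_absurd:
  fixes x :: "'a::field"
  assumes "subring_set S" "ideal_set J S" "1 \<notin> J" "\<And>j. j \<in> J \<Longrightarrow> inverse (1 - j) \<in> S"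
    and "\<And>i. f i \<in> J" "\<And>i. g i \<in> J"
    and "(\<Sum>i\<le>n. f i * x ^ i) = 1" "(\<Sum>i\<le>m. g i * inverse x ^ i) = 1"
  shows False
  using assms(5-8)
proof (induction "n + m" arbitrary: n m f g x rule: less_induct)
  case less
  note S = subring_setD[OF assms(1)] and J = ideal_setD[OF assms(2)]
  \<comment> \<open>Stated for an arbitrary element, so that the case \<open>n < m\<close> follows
    by exchanging \<open>x\<close> and \<open>inverse x\<close>.\<close>
  have red: False
    if nm: "m \<le> n" "n + m = k" and f: "\<And>i. f i \<in> J" and g: "\<And>i. g i \<in> J"
      and sf: "(\<Sum>i\<le>n. f i * x ^ i) = 1" and sg: "(\<Sum>i\<le>m. g i * inverse x ^ i) = 1"
      and IH: "\<And>n' f'. n' + m < k \<Longrightarrow> (\<And>i. f' i \<in> J) \<Longrightarrow>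
        (\<Sum>i\<le>n'. f' i * x ^ i) = 1 \<Longrightarrow> False"
    for n m k f g and x :: 'a
  proof -
    have n0: "n \<noteq> 0"
    proof
      assume "n = 0"
      then have "f 0 = 1" using sf by simp
      then show False using f[of 0] assms(3) by simp
    qed
    then obtain n' where n': "n = Suc n'" by (cases n) auto
    have x0: "x \<noteq> 0"
    proof
      \<comment> \<open>Here \<open>inverse 0 = 0\<close> and \<open>0 ^ 0 = 1\<close> reduce the
        second relation to \<open>g 0 = 1\<close>.\<close>
      assume "x = 0"
      then have "g 0 = 1" using sg by (simp add: power_0_left if_distrib cong: if_cong)
      then show False using g[of 0] assms(3) by simp
    qed
    \<comment> \<open>Padding by zeros gives both sums the upper bound \<open>n\<close>;
      multiplication by \<open>x ^ n\<close> and reversal of the index then yield powers of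
      \<open>x\<close> below \<open>n\<close>.\<close>
    define g' where "g' i = (if i \<le> m then g i else 0)" for i
    have g'J: "g' i \<in> J" for i using g J(2) by (simp add: g'_def)
    have "(\<Sum>i\<le>n. g' i * inverse x ^ i) = (\<Sum>i\<le>m. g i * inverse x ^ i)"
      using nm(1) by (intro sum.mono_neutral_cong_right) (auto simp: g'_def)
    then have s: "g' 0 + (\<Sum>i\<le>n'. g' (Suc i) * inverse x ^ Suc i) = 1"
      using sg unfolding n' by (simp add: sum.atMost_Suc_shift del: sum.atMost_Suc)
    define u where "u = inverse (1 - g' 0)"
    have u: "u \<in> S" "u * (1 - g' 0) = 1"
    proof -
      have "g' 0 \<noteq> 1" using assms(3) g'J[of 0] by metis
      then show "u \<in> S" "u * (1 - g' 0) = 1" using assms(4)[OF g'J[of 0]] by (simp_all add: u_def)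
    qed
    have "(\<Sum>i\<le>n'. g' (Suc i) * inverse x ^ Suc i) = 1 - g' 0"
      using s by (metis add_diff_cancel_left')
    then have "x ^ n = u * (\<Sum>i\<le>n'. g' (Suc i) * inverse x ^ Suc i) * x ^ n"
      using u(2) by simp
    also have "\<dots> = u * (\<Sum>i\<le>n'. g' (Suc i) * (inverse x ^ Suc i * x ^ n))"
      by (simp only: sum_distrib_right mult.assoc)
    also have "\<dots> = u * (\<Sum>i\<le>n'. g' (Suc i) * x ^ (n' - i))"
    proof -
      have "inverse x ^ Suc i * x ^ n = x ^ (n' - i)" if "i \<le> n'" for i
      proof -
        have "x ^ n = x ^ Suc i * x ^ (n' - i)" unfolding power_add[symmetric] using that n' by simp
        then show ?thesis using x0 by (simp add: field_simps)
      qed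
      then show ?thesis by simp
    qed
    also have "\<dots> = u * (\<Sum>i\<le>n'. g' (Suc (n' - i)) * x ^ i)"
      by (rule arg_cong[where f = "(*) u"], rule sum.reindex_bij_witness[where i = "\<lambda>i. n' - i" and j = "\<lambda>i. n' - i"]) auto
    finally have xn: "x ^ n = u * (\<Sum>i\<le>n'. g' (Suc (n' - i)) * x ^ i)" .
    define f' where "f' i = f i + f n * u * g' (Suc (n' - i))" for i
    have "(\<Sum>i\<le>n'. f' i * x ^ i) = (\<Sum>i\<le>n'. f i * x ^ i) + f n * x ^ n"
      unfolding xn f'_def by (simp add: sum.distrib sum_distrib_left algebra_simps)
    also have "\<dots> = 1" using sf unfolding n' by simp
    finally have "(\<Sum>i\<le>n'. f' i * x ^ i) = 1" .
    moreover have "f' i \<in> J" for i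
      unfolding f'_def using f g'J u J by (meson subset_iff)
    ultimately show False using IH[of n' f'] nm n' by auto
  qed
  show False
  proof (cases "m \<le> n")
    case True
    show ?thesis
      by (rule red[OF True refl less.prems]) (use less.hyps[of _ m] less.prems in blast)
  next
    case False
    have "(\<Sum>i\<le>n. f i * inverse (inverse x) ^ i) = 1" using less.prems by simp
    note r = red[where x = "inverse x" and n = m and m = n and f = g and g = f, OF _ refl less.prems(2,1,4) this]
    show ?thesis
    proof (rule r)
      show "n \<le> m" using False by simp
      fix n' f' assume *: "n' + n < m + n" "\<And>i. f' i \<in> J" "(\<Sum>i\<le>n'. f' i * inverse x ^ i) = 1"
      show False using less.hyps[of n n' f f' x] * less.prems by auto
    qed
  qed
qed

text \<open>A maximal pair \<open>(V, J)\<close> above \<open>(S, I)\<close> does it. If neither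
  \<open>x\<close> nor \<open>inverse x\<close> were in \<open>V\<close>, adjoining either of them
  would make the ideal improper, so \<open>1\<close> would be a polynomial over \<open>J\<close>
  both in \<open>x\<close> and in \<open>inverse x\<close>, which
  \<open>unit_combination_absurd\<close> excludes.\<close>

theorem chevalley_extension:
  fixes S :: "'a::field set"
  assumes S: "subring_set S" and I: "ideal_set I S" "1 \<notin> I"
  obtains V where "valuation_ring V" "S \<subseteq> V" "I \<subseteq> val_ideal V"
proof -
  \<comment> \<open>Pairs of a ring and an ideal are coded as one set, so that Zorn's lemma applies to inclusion.\<close>
  define rg where "rg Z = {x. (x, True) \<in> Z}" for Z :: "('a \<times> bool) set"
  define idl where "idl Z = {x. (x, False) \<in> Z}" for Z :: "('a \<times> bool) set"
  define F where "F = {Z. subring_set (rg Z) \<and> ideal_set (idl Z) (rg Z) \<and> S \<subseteq> rg Z \<and> I \<subseteq> idl Z \<and> 1 \<notin> idl Z}"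
  define pr where "pr A B = A \<times> {True} \<union> B \<times> {False}" for A B :: "'a set"
  have pr: "rg (pr A B) = A" "idl (pr A B) = B" for A B
    by (auto simp: rg_def idl_def pr_def)
  have "pr S I \<in> F" unfolding F_def using assms by (simp add: pr)
  then have "F \<noteq> {}" by blast
  moreover have "\<Union>C \<in> F" if C: "C \<noteq> {}" "subset.chain F C" for C
  proof -
    have CF: "C \<subseteq> F" using C(2) by (simp add: subset_chain_def)
    have U: "rg (\<Union>C) = \<Union>(rg ` C)" "idl (\<Union>C) = \<Union>(idl ` C)" by (auto simp: rg_def idl_def)
    have two: "\<exists>Z\<in>C. D \<subseteq> Z \<and> Y \<subseteq> Z" if "D \<in> C" "Y \<in> C" for D Y
    proof -
      have "D \<subseteq> Y \<or> Y \<subseteq> D" using C(2) that by (simp add: subset_chain_def)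
      then show ?thesis using that by blast
    qed
    have mono: "D \<subseteq> Y \<Longrightarrow> rg D \<subseteq> rg Y \<and> idl D \<subseteq> idl Y" for D Y by (auto simp: rg_def idl_def)
    have Z: "subring_set (rg Z)" "ideal_set (idl Z) (rg Z)" "S \<subseteq> rg Z" "I \<subseteq> idl Z" "1 \<notin> idl Z" if "Z \<in> C" for Z
      using that CF unfolding F_def by auto
    have 1: "subring_set (rg (\<Union>C))"
      unfolding subring_set_def
    proof (intro conjI ballI)
      show "1 \<in> rg (\<Union>C)" using C(1) subring_setD(2)[OF Z(1)] unfolding U by force
      fix a b assume "a \<in> rg (\<Union>C)" "b \<in> rg (\<Union>C)"
      then obtain D Y where "D \<in> C" "Y \<in> C" "a \<in> rg D" "b \<in> rg Y" unfolding U by blast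
      then obtain W where W: "W \<in> C" "a \<in> rg W" "b \<in> rg W" using two mono by (metis subsetD)
      then show "a - b \<in> rg (\<Union>C)" "a * b \<in> rg (\<Union>C)"
        using subring_setD(4,5)[OF Z(1)[OF W(1)]] unfolding U by blast+
    qed
    have 2: "ideal_set (idl (\<Union>C)) (rg (\<Union>C))"
      unfolding ideal_set_def
    proof (intro conjI ballI)
      show "idl (\<Union>C) \<subseteq> rg (\<Union>C)" using ideal_setD(1)[OF Z(2)] unfolding U by blast
      show "0 \<in> idl (\<Union>C)" using C(1) ideal_setD(2)[OF Z(2)] unfolding U by blast
    next
      fix a b assume "a \<in> idl (\<Union>C)" "b \<in> idl (\<Union>C)"
      then obtain D Y where "D \<in> C" "Y \<in> C" "a \<in> idl D" "b \<in> idl Y" unfolding U by blast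
      then obtain W where W: "W \<in> C" "a \<in> idl W" "b \<in> idl W" using two mono by (metis subsetD)
      then show "a + b \<in> idl (\<Union>C)"
        using ideal_setD(3)[OF Z(2)[OF W(1)]] unfolding U by blast
    next
      fix a b assume "a \<in> rg (\<Union>C)" "b \<in> idl (\<Union>C)"
      then obtain D Y where "D \<in> C" "Y \<in> C" "a \<in> rg D" "b \<in> idl Y" unfolding U by blast
      then obtain W where W: "W \<in> C" "a \<in> rg W" "b \<in> idl W" using two mono by (metis subsetD)
      then show "a * b \<in> idl (\<Union>C)"
        using ideal_setD(4)[OF Z(2)[OF W(1)]] unfolding U by blast
    qed
    show ?thesis
    proof -
      obtain Z0 where "Z0 \<in> C" using C(1) by blast
      then have "S \<subseteq> rg (\<Union>C)" "I \<subseteq> idl (\<Union>C)" using Z(3,4) unfolding U by blast+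
      moreover have "1 \<notin> idl (\<Union>C)" using Z(5) unfolding U by blast
      ultimately show ?thesis using 1 2 unfolding F_def by blast
    qed
  qed
  ultimately obtain M where M: "M \<in> F" "\<And>D. D \<in> F \<Longrightarrow> M \<subseteq> D \<Longrightarrow> D = M"
    using subset_Zorn_nonempty[of F] by metis
  define V where "V = rg M"
  define J where "J = idl M"
  have V: "subring_set V" "ideal_set J V" "S \<subseteq> V" "I \<subseteq> J" "1 \<notin> J"
    using M(1) unfolding F_def V_def J_def by auto
  note V' = subring_setD[OF V(1)] and J' = ideal_setD[OF V(2)]
  have Mpr: "M = pr V J"
  proof (rule Set.set_eqI)
    fix z :: "'a \<times> bool"
    show "z \<in> M \<longleftrightarrow> z \<in> pr V J"
      by (cases z; cases "snd z") (auto simp: V_def J_def pr_def rg_def idl_def)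
  qed
  \<comment> \<open>If \<open>1\<close> is no such polynomial in \<open>x\<close>, then
    \<open>V[x]\<close> with the ideal of polynomials over \<open>J\<close> is again an admissible
    pair, and maximality gives \<open>V[x] = V\<close>.\<close>
  have key: "x \<in> V" if "\<And>q. range (coeff q) \<subseteq> J \<Longrightarrow> poly q x \<noteq> 1" for x
  proof -
    let ?J = "{poly q x |q. range (coeff q) \<subseteq> J}"
    let ?V = "adjoin V V x"
    have sub: "subring_set ?V" by (rule subring_adjoin[OF V(1) ideal_set_self[OF V(1)]])
    have VV: "V \<subseteq> ?V" by (rule adjoin_base[OF ideal_set_self[OF V(1)]])
    have full: "\<exists>q. u = poly q x \<and> range (coeff q) \<subseteq> V" if u: "u \<in> ?V" for u
    proof -
      obtain a q where "u = poly (pCons a q) x" "range (coeff (pCons a q)) \<subseteq> V"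
        using u unfolding adjoin_def by (auto simp del: poly_pCons simp: range_coeff_pCons)
      then show ?thesis by blast
    qed
    have "ideal_set ?J ?V"
      unfolding ideal_set_def
    proof (intro conjI ballI)
      show "?J \<subseteq> ?V"
      proof
        fix u assume "u \<in> ?J"
        then obtain q where q: "u = poly q x" "range (coeff q) \<subseteq> J" by blast
        then have "u = poly q x" "range (coeff q) \<subseteq> V" using J'(1) by auto
        then show "u \<in> ?V"
        proof (cases q)
          case (pCons a r)
          then have "a \<in> V" "range (coeff r) \<subseteq> V"
            using \<open>range (coeff q) \<subseteq> V\<close> by (simp_all add: range_coeff_pCons)
          then show ?thesis unfolding adjoin_def using \<open>u = poly q x\<close> pCons by blast
        qed
      qed
      have "0 = poly 0 x \<and> range (coeff (0::'a poly)) \<subseteq> J" using J'(2) by auto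
      then show "0 \<in> ?J" by blast
    next
      fix a b assume "a \<in> ?J" "b \<in> ?J"
      then obtain q r where "a = poly q x" "range (coeff q) \<subseteq> J" "b = poly r x" "range (coeff r) \<subseteq> J"
        by blast
      then have "a + b = poly (q + r) x \<and> range (coeff (q + r)) \<subseteq> J" using J'(3) by auto
      then show "a + b \<in> ?J" by blast
    next
      fix a b assume "a \<in> ?V" "b \<in> ?J"
      then obtain q r where "a = poly q x" "range (coeff q) \<subseteq> V" "b = poly r x" "range (coeff r) \<subseteq> J"
        using full by blast
      then have "a * b = poly (q * r) x \<and> range (coeff (q * r)) \<subseteq> J"
        using coeffs_in_mult[OF V(2)] by auto
      then show "a * b \<in> ?J" by blast
    qed
    moreover have JJ: "J \<subseteq> ?J"
    proof
      fix j assume "j \<in> J"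
      then have "j = poly [:j:] x \<and> range (coeff [:j:]) \<subseteq> J"
        using J'(2) by (auto simp: range_coeff_pCons)
      then show "j \<in> ?J" by blast
    qed
    moreover have "1 \<notin> ?J" using that by force
    ultimately have "pr ?V ?J \<in> F" unfolding F_def using V VV sub by (auto simp: pr)
    moreover have "M \<subseteq> pr ?V ?J" unfolding Mpr pr_def using VV JJ by blast
    ultimately have "pr ?V ?J = M" by (rule M(2))
    then have "?V = V" using pr(1)[of ?V ?J] V_def by metis
    moreover have "1 * x ^ Suc 0 \<in> ?V" using adjoin_gen[of V V 1 x 0] V' by auto
    ultimately show ?thesis by simp
  qed
  \<comment> \<open>A power of \<open>v\<close> removes the denominators of a polynomial in
    \<open>inverse v\<close>; needed for \<open>v = 1 - j\<close>.\<close>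
  have clear: "\<exists>m. v ^ m * poly q (inverse v) \<in> J"
    if "v \<in> V" "v \<noteq> 0" "range (coeff q) \<subseteq> J" for v q
    using that(3)
  proof (induction q)
    case 0
    then show ?case using J'(2) by auto
  next
    case (pCons a q)
    have a: "a \<in> J" and "range (coeff q) \<subseteq> J" using pCons.prems by (simp_all add: range_coeff_pCons)
    then obtain m where m: "v ^ m * poly q (inverse v) \<in> J" using pCons.IH by blast
    have "v ^ Suc m * poly (pCons a q) (inverse v) = v ^ Suc m * a + v ^ m * poly q (inverse v)"
      using that(2) by (simp add: field_simps)
    also have "\<dots> \<in> J" by (rule J'(3)[OF J'(4)[OF V'(7)[OF that(1)] a] m])
    finally show ?case by blast
  qed
  \<comment> \<open>A relation \<open>q (1 / (1 - j)) = 1\<close> over \<open>J\<close> would put a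
    power of \<open>1 - j\<close> into \<open>J\<close>, although that power is congruent to
    \<open>1\<close> modulo \<open>J\<close>.\<close>
  have inv: "inverse (1 - j) \<in> V" if "j \<in> J" for j
  proof (rule key)
    fix q assume q: "range (coeff q) \<subseteq> J"
    have nz: "1 - j \<noteq> 0" using that V(5) by auto
    have v: "1 - j \<in> V" using that J'(1) V' by blast
    show "poly q (inverse (1 - j)) \<noteq> 1"
    proof
      assume "poly q (inverse (1 - j)) = 1"
      then obtain m where m: "(1 - j) ^ m \<in> J" using clear[OF v nz q] by auto
      have "1 - (1 - j) ^ m \<in> J"
      proof (induction m)
        case (Suc m)
        have "1 - (1 - j) ^ Suc m = (1 - (1 - j) ^ m) + (1 - j) ^ m * j" by (simp add: algebra_simps)
        also have "\<dots> \<in> J" using Suc that V'(7)[OF v] J' by blast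
        finally show ?case .
      qed (use J'(2) in simp)
      then have "1 - (1 - j) ^ m + (1 - j) ^ m \<in> J" using m J'(3) by blast
      then show False using V(5) by simp
    qed
  qed
  have "x \<in> V \<or> inverse x \<in> V" for x
  proof (rule ccontr)
    assume "\<not> (x \<in> V \<or> inverse x \<in> V)"
    then obtain q r where q: "range (coeff q) \<subseteq> J" "poly q x = 1"
      and r: "range (coeff r) \<subseteq> J" "poly r (inverse x) = 1"
      using key[of x] key[of "inverse x"] by blast
    show False
      by (rule unit_combination_absurd[OF V(1,2,5) inv, where f = "coeff q" and g = "coeff r" and n = "degree q" and x = x and m = "degree r"])
        (use q r in \<open>auto simp: poly_altdef\<close>)
  qed
  then have "valuation_ring V" unfolding valuation_ring_def using V(1) by blast
  moreover have "J \<subseteq> val_ideal V"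
  proof
    fix j assume j: "j \<in> J"
    show "j \<in> val_ideal V"
    proof (rule ccontr)
      assume "j \<notin> val_ideal V"
      then have "inverse j \<in> V" "j \<noteq> 0" unfolding val_ideal_def by auto
      then have "1 \<in> J" using J'(4)[of "inverse j" j] j by simp
      then show False using V(5) by blast
    qed
  qed
  ultimately show ?thesis using that V(3,4) by blast
qed

section \<open>Extending maximal subrings\<close>

lemma valuation_ringD: "valuation_ring V \<Longrightarrow> subring_set V"
  unfolding valuation_ring_def by blast

lemma inverse_in_val_ideal: "x \<notin> V \<Longrightarrow> inverse x \<in> val_ideal V"
  unfolding val_ideal_def by simp

lemma inverse_in_valuation_ring: "x \<in> V \<Longrightarrow> x \<notin> val_ideal V \<Longrightarrow> x \<noteq> 0 \<and> inverse x \<in> V"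
  unfolding val_ideal_def by simp

lemma subring_fractions:
  fixes R :: "'a::comm_ring_1 set"
  assumes R: "subring_set R" and S: "S \<subseteq> R" "1 \<in> S" "\<And>s t. s \<in> S \<Longrightarrow> t \<in> S \<Longrightarrow> s * t \<in> S"
  shows "subring_set {x. \<exists>s\<in>S. s * x \<in> R}"
  unfolding subring_set_def
proof (intro conjI ballI)
  note R' = subring_setD[OF R]
  show "1 \<in> {x. \<exists>s\<in>S. s * x \<in> R}" using R'(2) S(2) by auto
  fix a b assume "a \<in> {x. \<exists>s\<in>S. s * x \<in> R}" "b \<in> {x. \<exists>s\<in>S. s * x \<in> R}"
  then obtain s t where s: "s \<in> S" "s * a \<in> R" and t: "t \<in> S" "t * b \<in> R" by blast
  have sR: "s \<in> R" "t \<in> R" using s t S(1) by auto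
  have "s * t * (a - b) = t * (s * a) - s * (t * b)" "s * t * (a * b) = (s * a) * (t * b)"
    by (simp_all add: algebra_simps)
  then have "s * t * (a - b) \<in> R" "s * t * (a * b) \<in> R"
    using s(2) t(2) sR R'(4,5) by metis+
  then show "a - b \<in> {x. \<exists>s\<in>S. s * x \<in> R}" "a * b \<in> {x. \<exists>s\<in>S. s * x \<in> R}"
    using S(3)[OF s(1) t(1)] by blast+
qed

lemma fractions_base:
  fixes R :: "'a::comm_ring_1 set"
  assumes "1 \<in> S" "x \<in> R"
  shows "\<exists>s\<in>S. s * x \<in> R"
  using assms by (intro bexI[of _ 1]) auto

lemma prime_complement_mult:
  assumes "subring_set A" "prime_set p A" "s \<in> A - p" "t \<in> A - p"
  shows "s * t \<in> A - p"
  using assms prime_setD(3)[OF assms(2)] subring_setD(5)[OF assms(1)] by blast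

text \<open>Chevalley's theorem is applied to the localization of \<open>R\<close> at
  \<open>A - p\<close> and to the localized \<open>p\<close>, an ideal there by
  \<open>stable\<close>. Elements of \<open>A - p\<close> become invertible, so the valuation ideal
  cannot meet \<open>A\<close> outside \<open>p\<close>. The lemma serves for \<open>R = A\<close>,
  and for the larger ring when \<open>p\<close> happens to be an ideal of it.\<close>

lemma valuation_over_prime:
  fixes R :: "'a::field set"
  assumes R: "subring_set R" and A: "subring_set A" "A \<subseteq> R" and p: "prime_set p A"
    and stable: "\<And>q r. q \<in> p \<Longrightarrow> r \<in> R \<Longrightarrow> r * q \<in> p"
  obtains V where "valuation_ring V" "R \<subseteq> V" "val_ideal V \<inter> A = p"
proof -
  note R' = subring_setD[OF R] and A' = subring_setD[OF A(1)]
  note pI = ideal_setD[OF prime_setD(1)[OF p]] and pP = prime_setD(2,3)[OF p]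
  define S where "S = {x. \<exists>s\<in>A - p. s * x \<in> R}"
  define J where "J = {x. \<exists>s\<in>A - p. s * x \<in> p}"
  have mult: "s * t \<in> A - p" if "s \<in> A - p" "t \<in> A - p" for s t
    by (rule prime_complement_mult[OF A(1) p that])
  have S: "subring_set S"
    unfolding S_def using A' A(2) pP(1) mult by (intro subring_fractions[OF R]) auto
  have J: "ideal_set J S"
    unfolding ideal_set_def
  proof (intro conjI ballI)
    show "J \<subseteq> S" unfolding J_def S_def using pI(1) A(2) by blast
    show "0 \<in> J" unfolding J_def using pI(2) A'(2) pP(1) by auto
  next
    fix a b assume "a \<in> J" "b \<in> J"
    then obtain s t where s: "s \<in> A - p" "s * a \<in> p" and t: "t \<in> A - p" "t * b \<in> p"
      unfolding J_def by blast
    have "s * t * (a + b) = t * (s * a) + s * (t * b)" by (simp add: algebra_simps)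
    also have "\<dots> \<in> p" using s t pI(3,4) by blast
    finally show "a + b \<in> J" unfolding J_def using mult[OF s(1) t(1)] by blast
  next
    fix a b assume "a \<in> S" "b \<in> J"
    then obtain s t where s: "s \<in> A - p" "s * a \<in> R" and t: "t \<in> A - p" "t * b \<in> p"
      unfolding J_def S_def by blast
    have "s * t * (a * b) = (s * a) * (t * b)" by (simp add: algebra_simps)
    also have "\<dots> \<in> p" using stable s t by blast
    finally show "a * b \<in> J" unfolding J_def using mult[OF s(1) t(1)] by blast
  qed
  have "1 \<notin> J" unfolding J_def by simp
  then obtain V where V: "valuation_ring V" "S \<subseteq> V" "J \<subseteq> val_ideal V"
    using chevalley_extension[OF S J] by blast
  have "R \<subseteq> S"
    unfolding S_def using fractions_base[where S = "A - p"] A'(2) pP(1) by blast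
  moreover have "val_ideal V \<inter> A = p"
  proof
    show "p \<subseteq> val_ideal V \<inter> A"
    proof
      fix x assume "x \<in> p"
      then have "1 * x \<in> p" by simp
      then have "x \<in> J" unfolding J_def using A'(2) pP(1) by blast
      then show "x \<in> val_ideal V \<inter> A" using V(3) \<open>x \<in> p\<close> pI(1) by blast
    qed
    show "val_ideal V \<inter> A \<subseteq> p"
    proof
      fix x assume x: "x \<in> val_ideal V \<inter> A"
      show "x \<in> p"
      proof (rule ccontr)
        assume "x \<notin> p"
        moreover from this have "x \<noteq> 0" using pI(2) by auto
        ultimately have "x \<in> A - p" "x * inverse x \<in> R" using x R'(2) by auto
        then have "inverse x \<in> V" using V(2) unfolding S_def by blast
        then show False using x \<open>x \<noteq> 0\<close> unfolding val_ideal_def by blast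
      qed
    qed
  qed
  ultimately show ?thesis using that V(1,2) by blast
qed

text \<open>The linear coefficient of the relation is a unit of \<open>V\<close>, so some
  \<open>h * x\<close> differs from \<open>1\<close> by an element of the valuation ideal, and
  \<open>h\<close> is that unit times \<open>inverse x\<close>. The denominator \<open>h\<close>
  stays in \<open>R\<close>, which matters when \<open>R\<close> is the polynomial ring
  \<open>k[t, y]\<close>.\<close>

lemma valuation_denominator:
  fixes R :: "'a::field set"
  assumes R: "subring_set R" and V: "valuation_ring V" and x: "x \<in> R" "x \<notin> V"
    and eq: "x = poly (pCons a q) x" and a: "a \<in> V" and q: "range (coeff q) \<subseteq> val_ideal V \<inter> R"
  shows "\<exists>h\<in>val_ideal V \<inter> R. h * x \<in> V - val_ideal V"
proof -
  note Vv = ideal_setD[OF prime_setD(1)[OF val_ideal_prime[OF V]]]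
  note V_closed = subring_setD[OF valuation_ringD[OF V]]
  \<comment> \<open>Write \<open>x = a + x (p1 + x h)\<close> and divide by \<open>x\<close>, whose inverse lies in the valuation ideal.\<close>
  obtain p1 c where c: "q = pCons p1 c" by (cases q)
  define h where "h = poly c x"
  have p1: "p1 \<in> val_ideal V" and cp: "range (coeff c) \<subseteq> val_ideal V \<inter> R"
    using q unfolding c by (simp_all add: range_coeff_pCons)
  have hR: "h \<in> R" unfolding h_def
    using cp by (intro poly_in_subring[OF R x(1)]) blast
  have x0: "x \<noteq> 0" using x(2) V_closed(1) by auto
  have ix: "inverse x \<in> val_ideal V" by (rule inverse_in_val_ideal[OF x(2)])
  have "x = a + x * (p1 + x * h)" using eq unfolding c h_def by simp
  then have "inverse x * x = inverse x * (a + x * (p1 + x * h))" by metis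
  then have hx: "h * x = 1 - (p1 + a * inverse x)" using x0 by (simp add: field_simps)
  have w: "p1 + a * inverse x \<in> val_ideal V"
    using p1 ix a Vv(3,4) by blast
  then have hV: "h * x \<in> V" unfolding hx using Vv(1) V_closed(2,4) by blast
  have "h * x \<notin> val_ideal V"
  proof
    assume "h * x \<in> val_ideal V"
    then have "h * x + (p1 + a * inverse x) \<in> val_ideal V" using w Vv(3) by blast
    then show False unfolding hx using prime_setD(2)[OF val_ideal_prime[OF V]] by simp
  qed
  moreover have "h = (h * x) * inverse x" using x0 by simp
  then have "h \<in> val_ideal V" using Vv(4)[OF hV ix] by metis
  ultimately show ?thesis using hV hR by blast
qed

definition max_subring_set :: "'a::comm_ring_1 set \<Rightarrow> 'a set \<Rightarrow> bool" where
  "max_subring_set A R \<longleftrightarrow> subring_set A \<and> A \<subseteq> R \<and> A \<noteq> R \<and>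
     (\<forall>B. subring_set B \<and> A \<subseteq> B \<and> B \<subseteq> R \<longrightarrow> B = A \<or> B = R)"

text \<open>
  The last assumption excludes the maximal subrings over which \<open>R\<close> is integral: there \<open>p\<close> is the
  conductor.
\<close>

locale ext_max =
  fixes A R V p :: "'a::field set"
  assumes R: "subring_set R"
    and V: "valuation_ring V"
    and A_eq: "A = V \<inter> R"
    and p_eq: "p = val_ideal V \<inter> A"
    and max: "max_subring_set A R"
    and not_conductor: "\<exists>q\<in>p. \<exists>r\<in>R. q * r \<notin> A"

text \<open>A valuation ring \<open>V\<close> centred on \<open>p\<close> cannot contain
  \<open>R\<close>, since its maximal ideal would cut out a prime of \<open>R\<close> over
  \<open>p\<close>; maximality then gives \<open>A = V \<inter> R\<close>. If \<open>p R\<close>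
  were inside \<open>A\<close>, then \<open>p\<close> would be an ideal of \<open>R\<close>, and a
  valuation ring containing \<open>R\<close> and centred on \<open>p\<close> would exist after
  all.\<close>

theorem ext_maxI:
  fixes R :: "'a::field set"
  assumes R: "subring_set R" and max: "max_subring_set A R" and p: "prime_set p A"
    and not_image: "\<And>Q. prime_set Q R \<Longrightarrow> Q \<inter> A \<noteq> p"
  obtains V where "ext_max A R V p"
proof -
  have A: "subring_set A" "A \<subseteq> R" "A \<noteq> R"
    using max unfolding max_subring_set_def by auto
  note pI = ideal_setD[OF prime_setD(1)[OF p]]
  obtain V where V: "valuation_ring V" "A \<subseteq> V" "val_ideal V \<inter> A = p"
    using valuation_over_prime[OF A(1,1) subset_refl p] pI(4) by metis
  have VR: "subring_set (V \<inter> R)" by (rule subring_set_Int[OF valuation_ringD[OF V(1)] R])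
  have no: "W \<inter> R \<noteq> R" if "valuation_ring W" "val_ideal W \<inter> A = p" for W
  proof
    assume "W \<inter> R = R"
    then have "prime_set (val_ideal W \<inter> R) R"
      using prime_set_Int[OF val_ideal_prime[OF that(1)] _ R] by blast
    moreover have "val_ideal W \<inter> R \<inter> A = p" using that(2) A(2) by blast
    ultimately show False using not_image by blast
  qed
  have AV: "A = V \<inter> R"
    using max VR V(2) A(2) no[OF V(1,3)] unfolding max_subring_set_def
    by (metis Int_lower2 le_inf_iff)
  have "\<exists>q\<in>p. \<exists>r\<in>R. q * r \<notin> A"
  proof (rule ccontr)
    assume *: "\<not> (\<exists>q\<in>p. \<exists>r\<in>R. q * r \<notin> A)"
    have "r * q \<in> p" if q: "q \<in> p" and r: "r \<in> R" for q r
    proof -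
      have rq: "r * q \<in> A" "q * (r * r) \<in> A"
        using * q r subring_setD(5)[OF R] by (auto simp: mult.commute)
      \<comment> \<open>So far \<open>r * q\<close> is only known to be in \<open>A\<close>; its
        square is in \<open>p\<close>, and primality does the rest.\<close>
      have "(r * q) ^ 2 = q * (q * (r * r))" by (simp add: power2_eq_square)
      also have "\<dots> \<in> p" using rq q pI(5) by blast
      finally show ?thesis using prime_set_power[OF A(1) p rq(1)] by blast
    qed
    then obtain W where "valuation_ring W" "R \<subseteq> W" "val_ideal W \<inter> A = p"
      using valuation_over_prime[OF R A(1,2) p] by metis
    then show False using no[of W] by blast
  qed
  then have "ext_max A R V p"
    unfolding ext_max_def using R V AV max by auto
  then show ?thesis using that by blast
qed

section \<open>Denominators, nilpotence and maximality of \<open>p\<close>\<close>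

context ext_max
begin

lemma A: "subring_set A" "A \<subseteq> R" "A \<noteq> R"
  and maxD: "\<And>B. subring_set B \<Longrightarrow> A \<subseteq> B \<Longrightarrow> B \<subseteq> R \<Longrightarrow> B = A \<or> B = R"
  using max unfolding max_subring_set_def by auto

lemma V_subring: "subring_set V"
  using V by (rule valuation_ringD)

lemma p_prime: "prime_set p A"
  unfolding p_eq by (rule prime_set_Int[OF val_ideal_prime[OF V] _ A(1)]) (simp add: A_eq)

lemmas Vv = ideal_setD[OF prime_setD(1)[OF val_ideal_prime[OF V]]]
lemmas R_closed = subring_setD[OF R]
lemmas A_closed = subring_setD[OF A(1)]
lemmas V_closed = subring_setD[OF V_subring]
lemmas p_ideal = ideal_setD[OF prime_setD(1)[OF p_prime]]

lemma adjoin_eq_R: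
  assumes "x \<in> R" "x \<notin> A"
  shows "adjoin A A x = R"
proof -
  have "1 * x ^ Suc 0 \<in> adjoin A A x" using adjoin_gen[of A A 1 x 0] A_closed by auto
  then show ?thesis
    using maxD[of "adjoin A A x"] subring_adjoin[OF A(1) ideal_set_self[OF A(1)], of x]
      adjoin_base[OF ideal_set_self[OF A(1)], of x] adjoin_le[OF R A(2) ideal_set_self[OF A(1)] assms(1)]
      assms(2) by auto
qed

text \<open>As \<open>R = A[x]\<close>, every product of an element of \<open>p\<close> with one of
  \<open>R\<close> lies in \<open>adjoin A p x\<close>, so by \<open>not_conductor\<close> this ring
  is not \<open>A\<close>. By maximality it is \<open>R\<close>, hence contains \<open>x\<close>,
  and membership of \<open>x\<close> is exactly the relation that
  \<open>valuation_denominator\<close> needs.\<close>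

lemma denominator:
  assumes x: "x \<in> R" "x \<notin> A"
  shows "\<exists>a\<in>p. \<exists>b\<in>A - p. a * x = b"
proof -
  have pI: "ideal_set p A" by (rule prime_setD(1)[OF p_prime])
  have "adjoin A p x \<noteq> A"
  proof
    assume *: "adjoin A p x = A"
    obtain e r where e: "e \<in> p" "r \<in> R" "e * r \<notin> A" using not_conductor by blast
    then obtain a q where r: "r = poly (pCons a q) x" "a \<in> A" "range (coeff q) \<subseteq> A"
      using adjoin_eq_R[OF x] unfolding adjoin_def by blast
    have "e * r = poly (pCons (e * a) (smult e q)) x" using r(1) by (simp add: algebra_simps)
    moreover have "e * a \<in> A" using e(1) r(2) p_ideal(1) A_closed(5) by blast
    moreover have "range (coeff (smult e q)) \<subseteq> p"
      using r(3) p_ideal(5)[OF e(1)] by (auto simp: image_subset_iff)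
    ultimately have "e * r \<in> adjoin A p x" unfolding adjoin_def mem_Collect_eq by metis
    then show False using e(3) * by blast
  qed
  then have "adjoin A p x = R"
    using maxD[OF subring_adjoin[OF A(1) pI] adjoin_base[OF pI] adjoin_le[OF R A(2) pI x(1)]] by blast
  then obtain a q where q: "x = poly (pCons a q) x" "a \<in> A" "range (coeff q) \<subseteq> p"
    using x(1) unfolding adjoin_def by blast
  have "x \<notin> V" using x unfolding A_eq by blast
  moreover have "range (coeff q) \<subseteq> val_ideal V \<inter> R" using q(3) p_eq A(2) by blast
  ultimately obtain h where h: "h \<in> val_ideal V \<inter> R" "h * x \<in> V - val_ideal V"
    using valuation_denominator[OF R V x(1) _ q(1)] q(2) A_eq by blast
  then have "h \<in> p" "h * x \<in> A - p"
    using Vv(1) x(1) R_closed(5) unfolding p_eq A_eq by blast+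
  then show ?thesis by blast
qed

text \<open>Elements of \<open>A - p\<close> are units of \<open>V\<close>, and
  \<open>A = V \<inter> R\<close>: they act injectively on \<open>R / A\<close>.\<close>

lemma outside_p_cancel: "s \<in> A \<Longrightarrow> s \<notin> p \<Longrightarrow> x \<in> R \<Longrightarrow> s * x \<in> A \<Longrightarrow> x \<in> A"
proof -
  assume s: "s \<in> A" "s \<notin> p" and x: "x \<in> R" "s * x \<in> A"
  then have i: "s \<noteq> 0" "inverse s \<in> V"
    using inverse_in_valuation_ring[of s V] unfolding p_eq A_eq by auto
  have "x = inverse s * (s * x)" using i by simp
  also have "\<dots> \<in> V" using i x(2) V_closed(5) unfolding A_eq by blast
  finally show "x \<in> A" using x(1) unfolding A_eq by blast
qed

text \<open>The elements of \<open>R\<close> that some power of \<open>s\<close> carries into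
  \<open>A\<close> form a ring \<open>D\<close> above \<open>A\<close>. If \<open>D\<close> were
  \<open>A\<close>, then \<open>s\<close> would act injectively on \<open>R / A\<close>; a relation
  \<open>a * (s * y) = b\<close> from \<open>denominator\<close> would give \<open>a * y\<close> in
  \<open>A\<close>, and so \<open>b = s * (a * y)\<close> in \<open>p\<close>.\<close>

lemma p_nilpotent:
  assumes s: "s \<in> p" and x: "x \<in> R"
  shows "\<exists>n. s ^ n * x \<in> A"
proof -
  define D where "D = {r \<in> R. \<exists>n. s ^ n * r \<in> A}"
  have sA: "s \<in> A" using s p_ideal(1) by blast
  have up: "s ^ m * r \<in> A" if "s ^ n * r \<in> A" "n \<le> m" for n m r
  proof -
    have "s ^ m * r = s ^ (m - n) * (s ^ n * r)" using that(2) by (simp flip: power_add mult.assoc)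
    then show ?thesis using A_closed(5)[OF A_closed(7)[OF sA] that(1)] by metis
  qed
  have "subring_set D"
    unfolding subring_set_def
  proof (intro conjI ballI)
    have "s ^ 0 * 1 \<in> A" using A_closed by simp
    then show "1 \<in> D" unfolding D_def using R_closed by blast
    fix a b assume "a \<in> D" "b \<in> D"
    then obtain n m where *: "a \<in> R" "b \<in> R" "s ^ n * a \<in> A" "s ^ m * b \<in> A" unfolding D_def by blast
    have "s ^ max n m * (a - b) \<in> A"
      using up[OF *(3), of "max n m"] up[OF *(4), of "max n m"] A_closed(4) by (simp add: right_diff_distrib)
    then show "a - b \<in> D" unfolding D_def using * R_closed(4) by blast
    have "s ^ (n + m) * (a * b) \<in> A"
      using A_closed(5)[OF *(3,4)] by (simp add: power_add mult_ac)
    then show "a * b \<in> D" unfolding D_def using * R_closed(5) by blast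
  qed
  moreover have "A \<subseteq> D"
  proof
    fix a assume "a \<in> A"
    then have "a \<in> R" "s ^ 0 * a \<in> A" using A(2) by auto
    then show "a \<in> D" unfolding D_def by blast
  qed
  moreover have "D \<subseteq> R" unfolding D_def by blast
  moreover have "D \<noteq> A"
  proof
    assume DA: "D = A"
    have cancel: "r \<in> A" if "r \<in> R" "s * r \<in> A" for r
    proof -
      have "s ^ 1 * r \<in> A" using that by simp
      then have "r \<in> D" using that(1) unfolding D_def by blast
      then show ?thesis using DA by simp
    qed
    obtain y where y: "y \<in> R" "y \<notin> A" using A(2,3) by blast
    then have "s * y \<in> R" "s * y \<notin> A" using cancel R_closed(5) sA A(2) by blast+
    then obtain a b where ab: "a \<in> p" "b \<in> A - p" "a * (s * y) = b" using denominator by blast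
    have "s * (a * y) \<in> A" using ab by (metis DiffD1 mult.left_commute)
    then have "a * y \<in> A" using cancel y(1) ab(1) p_ideal(1) A(2) R_closed(5) by blast
    then have "s * (a * y) \<in> p" using p_ideal(5)[OF s] by blast
    then show False using ab by (metis DiffD2 mult.left_commute)
  qed
  ultimately have "D = R" using maxD[of D] by metis
  then have "x \<in> D" using x by simp
  then show ?thesis unfolding D_def by blast
qed

text \<open>For \<open>x\<close> outside \<open>A\<close> also \<open>s * x\<close> is outside
  \<open>A\<close>, so \<open>R = A[s x]\<close> contains \<open>x\<close>, say
  \<open>x = a0 + s x (a1 + w)\<close>. Division by \<open>x\<close> gives
  \<open>1 = a0 / x + s (a1 + w)\<close>, where \<open>a0 / x\<close> is in the valuation ideal; it
  remains to see that \<open>w\<close>, and with it \<open>a0 / x\<close>, lies in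
  \<open>A\<close>.\<close>

lemma p_maximal:
  assumes s: "s \<in> A" "s \<notin> p"
  shows "\<exists>c\<in>A. \<exists>q\<in>p. s * c + q = 1"
proof -
  obtain x where x: "x \<in> R" "x \<notin> A" using A(2,3) by blast
  have sx: "s * x \<in> R" "s * x \<notin> A" using x s outside_p_cancel R_closed(5) A(2) by blast+
  then obtain a0 q where q: "x = poly (pCons a0 q) (s * x)" "a0 \<in> A" "range (coeff q) \<subseteq> A"
    using adjoin_eq_R[OF sx] x(1) unfolding adjoin_def by blast
  obtain a1 c where c: "q = pCons a1 c" by (cases q)
  have a1: "a1 \<in> A" and cp: "range (coeff c) \<subseteq> A" using q(3) unfolding c by (simp_all add: range_coeff_pCons)
  define w where "w = s * x * poly c (s * x)"
  have wR: "w \<in> R" unfolding w_def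
    using R_closed(5)[OF sx(1) poly_in_subring[OF R sx(1)]] cp A(2) by blast
  have xV: "x \<notin> V" using x unfolding A_eq by blast
  then have x0: "x \<noteq> 0" using V_closed(1) by auto
  have ix: "inverse x \<in> val_ideal V" by (rule inverse_in_val_ideal[OF xV])
  have "x = a0 + s * x * (a1 + w)" using q(1) unfolding c w_def by simp
  then have "inverse x * x = inverse x * (a0 + s * x * (a1 + w))" by metis
  then have 1: "1 = a0 * inverse x + s * (a1 + w)" using x0 by (simp add: field_simps)
  have v: "a0 * inverse x \<in> val_ideal V" using Vv(4)[OF _ ix] q(2) A_eq by blast
  \<comment> \<open>The equation puts \<open>s * w\<close> into \<open>V\<close>; as
    \<open>w\<close> is in \<open>R\<close>, cancelling \<open>s\<close> puts \<open>w\<close> into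
    \<open>A\<close>.\<close>
  have "s * w = 1 - a0 * inverse x - s * a1" using 1 by (simp add: algebra_simps)
  also have "\<dots> \<in> V"
  proof -
    have "a0 * inverse x \<in> V" "s * a1 \<in> V" using v Vv(1) s(1) a1 V_closed(5) A_eq by blast+
    then show ?thesis using V_closed(2,4) by blast
  qed
  finally have "s * w \<in> A" using s(1) A(2) wR R_closed(5) unfolding A_eq by blast
  then have wA: "w \<in> A" using outside_p_cancel[OF s wR] by blast
  have "a0 * inverse x = 1 - s * (a1 + w)" using 1 by (simp add: algebra_simps)
  also have "\<dots> \<in> A" by (rule A_closed(4)[OF A_closed(2) A_closed(5)[OF s(1) A_closed(3)[OF a1 wA]]])
  finally have "a0 * inverse x \<in> p" using v unfolding p_eq by blast
  then show ?thesis using 1 wA a1 A_closed(3) by (metis add.commute)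
qed

text \<open>In a relation \<open>a * x = b\<close> from \<open>denominator\<close>, a prime of
  \<open>R\<close> over \<open>p\<close> would contain \<open>a\<close> and therefore
  \<open>b\<close>, which is not in \<open>p\<close>.\<close>

lemma p_not_image: "prime_set Q R \<Longrightarrow> Q \<inter> A \<noteq> p"
proof
  assume Q: "prime_set Q R" and *: "Q \<inter> A = p"
  obtain x where x: "x \<in> R" "x \<notin> A" using A(2,3) by blast
  obtain a b where ab: "a \<in> p" "b \<in> A - p" "a * x = b" using denominator[OF x] by blast
  then have "a * x \<in> Q" using * x(1) ideal_setD(5)[OF prime_setD(1)[OF Q]] by blast
  then show False using ab * by blast
qed

section \<open>Primes of \<open>A\<close> other than \<open>p\<close> and their unique extension to
  \<open>R\<close>\<close>

lemma p_not_le: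
  assumes q: "prime_set q A" "q \<noteq> p"
  shows "\<not> p \<subseteq> q"
proof
  assume "p \<subseteq> q"
  then obtain s where s: "s \<in> q" "s \<notin> p" using q(2) by blast
  note qI = ideal_setD[OF prime_setD(1)[OF q(1)]]
  obtain c e where "c \<in> A" "e \<in> p" "s * c + e = 1" using p_maximal[of s] s qI(1) by blast
  then have "1 \<in> q" using s(1) qI(3,5) \<open>p \<subseteq> q\<close> by (metis subsetD)
  then show False using prime_setD(2)[OF q(1)] by blast
qed

text \<open>Since \<open>p\<close> is maximal, some \<open>e\<close> in \<open>p\<close> avoids
  \<open>q\<close>, and a power of \<open>e\<close> carries \<open>x\<close> into \<open>A\<close>.
  Hence \<open>R\<close> lies in the localization of \<open>A\<close> at \<open>q\<close>.\<close>

lemma other_prime_denominator: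
  assumes q: "prime_set q A" "q \<noteq> p" and x: "x \<in> R"
  shows "\<exists>s\<in>A - q. s * x \<in> A"
proof -
  obtain e where e: "e \<in> p" "e \<notin> q" using p_not_le[OF q] by blast
  then have eA: "e \<in> A" using p_ideal(1) by blast
  obtain n where "e ^ n * x \<in> A" using p_nilpotent[OF e(1) x] by blast
  moreover have "e ^ n \<in> A - q" using A_closed(7)[OF eA] prime_set_power[OF A(1) q(1) eA] e(2) by blast
  ultimately show ?thesis by blast
qed

text \<open>The intersection of \<open>R\<close> with the maximal ideal of the localization of
  \<open>A\<close> at \<open>q\<close>; for \<open>q \<noteq> p\<close> that localization contains
  \<open>R\<close>.\<close>

definition lift_prime :: "'a set \<Rightarrow> 'a set" where
  "lift_prime q = {x \<in> R. \<exists>s\<in>A - q. s * x \<in> q}"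

lemma lift_prime:
  assumes q: "prime_set q A" "q \<noteq> p"
  shows "prime_set (lift_prime q) R" "lift_prime q \<inter> A = q"
proof -
  note qI = ideal_setD[OF prime_setD(1)[OF q(1)]] and qP = prime_setD(2,3)[OF q(1)]
  note mult = prime_complement_mult[OF A(1) q(1)]
  show cap: "lift_prime q \<inter> A = q"
  proof
    show "lift_prime q \<inter> A \<subseteq> q" unfolding lift_prime_def using qP(2) by blast
    show "q \<subseteq> lift_prime q \<inter> A"
    proof
      fix x assume x: "x \<in> q"
      then have "1 * x \<in> q" "1 \<in> A - q" using A_closed(2) qP(1) by auto
      then show "x \<in> lift_prime q \<inter> A" unfolding lift_prime_def using x qI(1) A(2) by blast
    qed
  qed
  show "prime_set (lift_prime q) R"
    unfolding prime_set_def ideal_set_def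
  proof (intro conjI ballI impI)
    show "lift_prime q \<subseteq> R" unfolding lift_prime_def by blast
    show "0 \<in> lift_prime q" using cap qI(2) by blast
    show "1 \<notin> lift_prime q" using cap qP(1) A_closed(2) by blast
  next
    fix a b assume "a \<in> lift_prime q" "b \<in> lift_prime q"
    then obtain s t where s: "s \<in> A - q" "s * a \<in> q" and t: "t \<in> A - q" "t * b \<in> q"
      and R: "a \<in> R" "b \<in> R" unfolding lift_prime_def by blast
    have "s * t * (a + b) = t * (s * a) + s * (t * b)" by (simp add: algebra_simps)
    also have "\<dots> \<in> q" using s t qI(3,4) by blast
    finally show "a + b \<in> lift_prime q"
      unfolding lift_prime_def using mult[OF s(1) t(1)] R R_closed(3) by blast
  next
    fix a b assume a: "a \<in> R" and "b \<in> lift_prime q"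
    then obtain t where t: "t \<in> A - q" "t * b \<in> q" "b \<in> R" unfolding lift_prime_def by blast
    obtain s where s: "s \<in> A - q" "s * a \<in> A" using other_prime_denominator[OF q a] by blast
    have "s * t * (a * b) = (s * a) * (t * b)" by (simp add: algebra_simps)
    also have "\<dots> \<in> q" using s t qI(4) by blast
    finally show "a * b \<in> lift_prime q"
      unfolding lift_prime_def using mult[OF s(1) t(1)] a t(3) R_closed(5) by blast
  next
    fix a b assume a: "a \<in> R" and b: "b \<in> R" and ab: "a * b \<in> lift_prime q"
    obtain s where s: "s \<in> A - q" "s * a \<in> A" using other_prime_denominator[OF q a] by blast
    obtain t where t: "t \<in> A - q" "t * b \<in> A" using other_prime_denominator[OF q b] by blast
    obtain u where u: "u \<in> A - q" "u * (a * b) \<in> q" using ab unfolding lift_prime_def by blast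
    have "u * ((s * a) * (t * b)) = (s * t) * (u * (a * b))" by (simp add: algebra_simps)
    also have "\<dots> \<in> q" using u(2) s(1) t(1) A_closed(5) qI(4) by blast
    finally have "(s * a) * (t * b) \<in> q" using qP(2)[of u "(s * a) * (t * b)"] u(1) s t A_closed(5) by blast
    then have "s * a \<in> q \<or> t * b \<in> q" using qP(2) s t by blast
    then show "a \<in> lift_prime q \<or> b \<in> lift_prime q"
      unfolding lift_prime_def using s t a b by blast
  qed
qed

lemma lift_prime_restrict:
  assumes Q: "prime_set Q R"
  shows "lift_prime (Q \<inter> A) = Q"
proof -
  have q: "prime_set (Q \<inter> A) A" "Q \<inter> A \<noteq> p"
    using prime_set_Int[OF Q A(2,1)] p_not_image[OF Q] by auto
  note QI = ideal_setD[OF prime_setD(1)[OF Q]] and QP = prime_setD(2,3)[OF Q]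
  show ?thesis
  proof
    show "lift_prime (Q \<inter> A) \<subseteq> Q" unfolding lift_prime_def using QP(2) A(2) by blast
    show "Q \<subseteq> lift_prime (Q \<inter> A)"
    proof
      fix x assume x: "x \<in> Q"
      then have xR: "x \<in> R" using QI(1) by blast
      obtain s where s: "s \<in> A - Q \<inter> A" "s * x \<in> A" using other_prime_denominator[OF q xR] by blast
      then have "s * x \<in> Q \<inter> A" using x QI(4) A(2) by blast
      then show "x \<in> lift_prime (Q \<inter> A)" unfolding lift_prime_def using s xR by blast
    qed
  qed
qed

end

section \<open>The crucial maximal ideal\<close>

text \<open>Has the shape of \<open>kalg\<close>, so that facts about it transfer through
  \<open>kalg_set_ring\<close>.\<close>

definition set_ring :: "'a::field set \<Rightarrow> 'a ring" where
  "set_ring R = ring_of_type_algebra\<lparr>carrier := R\<rparr>"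

lemma set_ring_simps [simp]:
  "carrier (set_ring R) = R"
  "x \<otimes>\<^bsub>set_ring R\<^esub> y = x * y"
  "x \<oplus>\<^bsub>set_ring R\<^esub> y = x + y"
  "\<one>\<^bsub>set_ring R\<^esub> = 1"
  "\<zero>\<^bsub>set_ring R\<^esub> = 0"
  "(set_ring R)\<lparr>carrier := A\<rparr> = set_ring A"
  by (simp_all add: set_ring_def ring_of_type_algebra_def)

lemma cring_set_ring:
  assumes "subring_set R"
  shows "cring (set_ring R)"
proof -
  note R = subring_setD[OF assms]
  show ?thesis
  proof (rule cringI)
    show "abelian_group (set_ring R)"
      by (rule abelian_groupI) (use R in \<open>auto simp: algebra_simps intro: bexI[of _ "- x" for x]\<close>)
    show "Group.comm_monoid (set_ring R)"
      by (rule comm_monoidI) (use R in \<open>auto simp: algebra_simps\<close>)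
  qed (simp add: algebra_simps)
qed

lemma a_inv_set_ring:
  assumes "subring_set R" "x \<in> R"
  shows "\<ominus>\<^bsub>set_ring R\<^esub> x = - x"
proof -
  interpret cring "set_ring R" by (rule cring_set_ring[OF assms(1)])
  show ?thesis using minus_equality[of "- x" x] subring_setD(6)[OF assms] assms(2) by simp
qed

lemma subring_set_ring:
  assumes "subring_set R"
  shows "subring A (set_ring R) \<longleftrightarrow> subring_set A \<and> A \<subseteq> R"
proof -
  interpret cring "set_ring R" by (rule cring_set_ring[OF assms])
  show ?thesis
  proof
    assume A: "subring A (set_ring R)"
    note A' = subringE[OF A]
    have "A \<subseteq> R" using A'(1) by simp
    moreover have "- a \<in> A" if "a \<in> A" for a
      using A'(5)[OF that] a_inv_set_ring[OF assms, of a] that \<open>A \<subseteq> R\<close> by auto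
    ultimately show "subring_set A \<and> A \<subseteq> R"
      unfolding subring_set_def using A'(3,6,7) by (auto simp flip: add_uminus_conv_diff)
  next
    assume A: "subring_set A \<and> A \<subseteq> R"
    then show "subring A (set_ring R)"
      using subring_setD[of A] by (intro subringI) (auto simp: a_inv_set_ring[OF assms] subset_iff)
  qed
qed

lemma ideal_set_ring:
  assumes "subring_set R"
  shows "ideal I (set_ring R) \<longleftrightarrow> ideal_set I R"
proof
  assume "ideal I (set_ring R)"
  then interpret ideal I "set_ring R" .
  show "ideal_set I R"
    unfolding ideal_set_def
    using a_subset I_l_closed additive_subgroup.zero_closed[OF is_additive_subgroup]
      additive_subgroup.a_closed[OF is_additive_subgroup] by auto
next
  assume I: "ideal_set I R"
  interpret cring "set_ring R" by (rule cring_set_ring[OF assms])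
  note I' = ideal_setD[OF I]
  show "ideal I (set_ring R)"
  proof (rule idealI)
    show "Ring.ring (set_ring R)" by (rule ring_axioms)
    show "subgroup I (add_monoid (set_ring R))"
    proof (rule add.subgroupI)
      show "I \<subseteq> carrier (set_ring R)" "I \<noteq> {}" using I'(1,2) by auto
      show "\<And>a. a \<in> I \<Longrightarrow> \<ominus>\<^bsub>set_ring R\<^esub> a \<in> I"
        using a_inv_set_ring[OF assms] I'(1) ideal_set_minus(1)[OF assms I] by auto
      show "\<And>a b. a \<in> I \<Longrightarrow> b \<in> I \<Longrightarrow> a \<oplus>\<^bsub>set_ring R\<^esub> b \<in> I" using I'(3) by simp
    qed
  qed (use I'(4,5) in auto)
qed

lemma primeideal_set_ring:
  assumes "subring_set R"
  shows "primeideal P (set_ring R) \<longleftrightarrow> prime_set P R"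
proof
  assume P: "primeideal P (set_ring R)"
  then interpret primeideal P "set_ring R" .
  have "1 \<notin> P" using one_imp_carrier I_notcarr by auto
  then show "prime_set P R"
    unfolding prime_set_def using I_prime is_ideal ideal_set_ring[OF assms] by auto
next
  assume P: "prime_set P R"
  show "primeideal P (set_ring R)"
  proof (rule primeidealI)
    show "ideal P (set_ring R)" using prime_setD(1)[OF P] ideal_set_ring[OF assms] by blast
    show "cring (set_ring R)" by (rule cring_set_ring[OF assms])
    show "carrier (set_ring R) \<noteq> P" using prime_setD(2)[OF P] subring_setD(2)[OF assms] by auto
  qed (use prime_setD(3)[OF P] in auto)
qed

lemma spectrum_set_ring: "subring_set R \<Longrightarrow> spectrum (set_ring R) = {P. prime_set P R}"
  unfolding spectrum_def using primeideal_set_ring by blast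

lemma maximal_subring_set_ring:
  "subring_set R \<Longrightarrow> maximal_subring A (set_ring R) \<longleftrightarrow> max_subring_set A R"
  unfolding maximal_subring_def max_subring_set_def by (auto simp: subring_set_ring)

text \<open>In a domain the auxiliary factor \<open>h\<close> of a localization can be cancelled,
  because \<open>0\<close> lies in \<open>P\<close>.\<close>

lemma loc_frac_set_ring:
  fixes R :: "'a::field set"
  assumes "subring_set R" "prime_set P R"
  shows "loc_frac (set_ring R) P a f = {(b, g). b \<in> R \<and> g \<in> R - P \<and> a * g = b * f}"
proof -
  have "0 \<in> P" "1 \<in> R - P"
    using prime_setD(1,2)[OF assms(2)] ideal_setD(2) subring_setD(2)[OF assms(1)] by auto
  then show ?thesis
    unfolding loc_frac_def by (auto 0 3)
qed

lemma extending_set_ring: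
  assumes "subring_set R" "subring_set A" "A \<subseteq> R"
  shows "extending A (set_ring R) \<longleftrightarrow> (\<exists>p. prime_set p A \<and> (\<forall>Q. prime_set Q R \<longrightarrow> Q \<inter> A \<noteq> p))"
proof -
  have sub: "spec_map A ` {P. prime_set P R} \<subseteq> {P. prime_set P A}"
    unfolding spec_map_def using prime_set_Int[OF _ assms(3,2)] by blast
  have "extending A (set_ring R) \<longleftrightarrow> spec_map A ` {P. prime_set P R} \<noteq> {P. prime_set P A}"
    unfolding extending_def set_ring_simps spectrum_set_ring[OF assms(1)] spectrum_set_ring[OF assms(2)] ..
  also have "\<dots> \<longleftrightarrow> (\<exists>p. prime_set p A \<and> p \<notin> spec_map A ` {P. prime_set P R})"
    using sub by auto
  also have "\<dots> \<longleftrightarrow> (\<exists>p. prime_set p A \<and> (\<forall>Q. prime_set Q R \<longrightarrow> Q \<inter> A \<noteq> p))"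
    unfolding spec_map_def image_iff by auto
  finally show ?thesis .
qed

section \<open>The homeomorphism of spectra away from \<open>p\<close>\<close>

context ext_max
begin

lemma spec_R: "spectrum (set_ring R) = {P. prime_set P R}"
  and spec_A: "spectrum (set_ring A) = {P. prime_set P A}"
  using spectrum_set_ring R A(1) by auto

lemma openin_preimage:
  assumes "openin (zariski (set_ring A)) U"
  shows "openin (zariski (set_ring R)) (spec_preimage A (set_ring R) U)"
proof -
  obtain S where S: "S \<subseteq> A" "U = {P. prime_set P A \<and> \<not> S \<subseteq> P}"
    using assms unfolding openin_zariski spec_A by auto
  have "spec_preimage A (set_ring R) U = {P. prime_set P R \<and> \<not> S \<subseteq> P}"
    unfolding spec_preimage_def spec_map_def spec_R S(2)
    using prime_set_Int[OF _ A(2,1)] S(1) by blast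
  then show ?thesis unfolding openin_zariski spec_R using S(1) A(2) by (intro exI[of _ S]) auto
qed

lemma spec_map_lift: "prime_set q A \<Longrightarrow> q \<noteq> p \<Longrightarrow> spec_map A (lift_prime q) = q"
  unfolding spec_map_def by (rule lift_prime)

lemma spec_map_prime: "prime_set Q R \<Longrightarrow> prime_set (spec_map A Q) A \<and> spec_map A Q \<noteq> p"
  unfolding spec_map_def using prime_set_Int[OF _ A(2,1)] p_not_image by blast

text \<open>The image of the open set given by \<open>S\<close> is given by the products
  \<open>e * (s * x)\<close>: the factor \<open>s\<close> clears the denominator of
  \<open>x\<close>, and \<open>e\<close> in \<open>p\<close> keeps the point \<open>p\<close>
  out.\<close>

lemma openin_image:
  assumes "openin (zariski (set_ring R)) U"
  shows "openin (zariski (set_ring A)) (spec_map A ` U)"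
proof -
  obtain S where S: "S \<subseteq> R" "U = {P. prime_set P R \<and> \<not> S \<subseteq> P}"
    using assms unfolding openin_zariski spec_R by auto
  define T where "T = {e * (s * x) |e s x. e \<in> p \<and> s \<in> A \<and> x \<in> S \<and> s * x \<in> A}"
  have TA: "T \<subseteq> A" unfolding T_def using p_ideal(1,5) by blast
  have "spec_map A ` U = {q. prime_set q A \<and> \<not> T \<subseteq> q}"
  proof
    show "spec_map A ` U \<subseteq> {q. prime_set q A \<and> \<not> T \<subseteq> q}"
    proof
      fix q assume "q \<in> spec_map A ` U"
      then obtain Q x where Q: "prime_set Q R" "x \<in> S" "x \<notin> Q" "q = Q \<inter> A"
        unfolding S(2) spec_map_def by blast
      have q: "prime_set q A" "q \<noteq> p" using spec_map_prime[OF Q(1)] unfolding Q(4) spec_map_def by auto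
      have xR: "x \<in> R" using Q(2) S(1) by blast
      obtain s where s: "s \<in> A - q" "s * x \<in> A" using other_prime_denominator[OF q xR] by blast
      obtain e where e: "e \<in> p" "e \<notin> q" using p_not_le[OF q] by blast
      have "s \<in> R" "s \<notin> Q" using s Q(4) A(2) by auto
      then have "s * x \<notin> Q" using prime_setD(3)[OF Q(1)] xR Q(3) by blast
      then have "s * x \<notin> q" using Q(4) by blast
      then have "e * (s * x) \<notin> q" using prime_setD(3)[OF q(1)] e s(2) p_ideal(1) by blast
      moreover have "e * (s * x) \<in> T" unfolding T_def using e s Q(2) by blast
      ultimately show "q \<in> {q. prime_set q A \<and> \<not> T \<subseteq> q}" using q by blast
    qed
    show "{q. prime_set q A \<and> \<not> T \<subseteq> q} \<subseteq> spec_map A ` U"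
    proof
      fix q assume "q \<in> {q. prime_set q A \<and> \<not> T \<subseteq> q}"
      then obtain e s x where q: "prime_set q A"
        and e: "e \<in> p" "s \<in> A" "x \<in> S" "s * x \<in> A" "e * (s * x) \<notin> q"
        unfolding T_def by blast
      note qI = ideal_setD[OF prime_setD(1)[OF q]]
      have "q \<noteq> p" using e(1,4,5) p_ideal(5) by blast
      note lift = lift_prime[OF q this]
      have "x \<notin> lift_prime q"
      proof
        assume "x \<in> lift_prime q"
        then have "s * x \<in> lift_prime q \<inter> A"
          using ideal_setD(4)[OF prime_setD(1)[OF lift(1)]] e(2,4) A(2) by blast
        then have "s * x \<in> q" using lift(2) by blast
        then show False using e(1,5) qI(4) p_ideal(1) by blast
      qed
      then have "lift_prime q \<in> U" unfolding S(2) using lift(1) e(3) by blast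
      then show "q \<in> spec_map A ` U" using lift(2) unfolding spec_map_def by blast
    qed
  qed
  then show ?thesis unfolding openin_zariski spec_A using TA by (intro exI[of _ T]) auto
qed

lemma preimage_p: "spec_preimage A (set_ring R) {p} = {}"
  unfolding spec_preimage_def spec_R using spec_map_prime by blast

text \<open>Nothing lies over \<open>p\<close>, so the source is the whole spectrum of
  \<open>R\<close>. The inverse map is \<open>lift_prime\<close>, and \<open>openin_image\<close>
  makes it continuous.\<close>

lemma homeomorphic_spec_map:
  "homeomorphic_map
     (subtopology (zariski (set_ring R)) (spectrum (set_ring R) - spec_preimage A (set_ring R) {p}))
     (subtopology (zariski (set_ring A)) (spectrum (set_ring A) - {p})) (spec_map A)"
proof -
  have X: "subtopology (zariski (set_ring R)) (spectrum (set_ring R) - spec_preimage A (set_ring R) {p})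
      = zariski (set_ring R)"
    using subtopology_topspace[of "zariski (set_ring R)"] unfolding preimage_p topspace_zariski by simp
  have Y: "topspace (subtopology (zariski (set_ring A)) (spectrum (set_ring A) - {p})) = {q. prime_set q A \<and> q \<noteq> p}"
    unfolding topspace_subtopology topspace_zariski spec_A by blast
  show ?thesis
    unfolding X
  proof (rule bijective_open_imp_homeomorphic_map)
    have "spec_map A \<in> topspace (zariski (set_ring R)) \<rightarrow> spectrum (set_ring A) - {p}"
      unfolding topspace_zariski spec_R spec_A using spec_map_prime by blast
    moreover have "continuous_map (zariski (set_ring R)) (zariski (set_ring A)) (spec_map A)"
      unfolding continuous_map_def topspace_zariski
    proof (intro conjI allI impI)
      show "spec_map A \<in> spectrum (set_ring R) \<rightarrow> spectrum (set_ring A)"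
        unfolding spec_R spec_A using spec_map_prime by blast
      show "openin (zariski (set_ring R)) {x \<in> spectrum (set_ring R). spec_map A x \<in> U}"
        if "openin (zariski (set_ring A)) U" for U
        using openin_preimage[OF that] unfolding spec_preimage_def .
    qed
    ultimately show "continuous_map (zariski (set_ring R))
        (subtopology (zariski (set_ring A)) (spectrum (set_ring A) - {p})) (spec_map A)"
      unfolding continuous_map_in_subtopology by blast
    show "open_map (zariski (set_ring R))
        (subtopology (zariski (set_ring A)) (spectrum (set_ring A) - {p})) (spec_map A)"
      unfolding open_map_def
    proof (intro allI impI)
      fix U assume U: "openin (zariski (set_ring R)) U"
      then have "U \<subseteq> {Q. prime_set Q R}" using openin_subset topspace_zariski spec_R by metis
      then have "spec_map A ` U = spec_map A ` U \<inter> (spectrum (set_ring A) - {p})"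
        unfolding spec_A using spec_map_prime by blast
      then show "openin (subtopology (zariski (set_ring A)) (spectrum (set_ring A) - {p})) (spec_map A ` U)"
        using openin_image[OF U] unfolding openin_subtopology by blast
    qed
    show "spec_map A ` topspace (zariski (set_ring R)) =
        topspace (subtopology (zariski (set_ring A)) (spectrum (set_ring A) - {p}))"
      unfolding Y topspace_zariski spec_R
    proof
      show "spec_map A ` {P. prime_set P R} \<subseteq> {q. prime_set q A \<and> q \<noteq> p}"
        using spec_map_prime by blast
      show "{q. prime_set q A \<and> q \<noteq> p} \<subseteq> spec_map A ` {P. prime_set P R}"
      proof
        fix q assume "q \<in> {q. prime_set q A \<and> q \<noteq> p}"
        then have "q = spec_map A (lift_prime q)" "lift_prime q \<in> {P. prime_set P R}"
          using lift_prime(1) spec_map_lift by auto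
        then show "q \<in> spec_map A ` {P. prime_set P R}" by (rule image_eqI)
      qed
    qed
    show "inj_on (spec_map A) (topspace (zariski (set_ring R)))"
      unfolding topspace_zariski spec_R inj_on_def spec_map_def
      using lift_prime_restrict by (metis mem_Collect_eq)
  qed
qed

section \<open>Comparison of the structure sheaves away from \<open>p\<close>\<close>

lemma loc_frac_restrict:
  assumes Q: "prime_set Q R"
  shows "loc_frac (set_ring R) Q a f \<inter> A \<times> A = loc_frac (set_ring A) (spec_map A Q) a f"
  using loc_frac_set_ring[OF R Q, of a f] loc_frac_set_ring[OF A(1), of "spec_map A Q" a f]
    spec_map_prime[OF Q] A(2) by (auto simp: spec_map_def)

lemma loc_map_fraction:
  assumes Q: "prime_set Q R" and af: "a \<in> A" "f \<in> A" "f \<notin> Q"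
  shows "loc_map (set_ring R) Q (loc_frac (set_ring A) (spec_map A Q) a f) = loc_frac (set_ring R) Q a f"
  using loc_map_loc_frac[of A "set_ring R" Q a f] Q af subring_set_ring[OF R] A spec_R by auto

lemma sectionsD:
  assumes "s \<in> sections (set_ring S) U" "P \<in> U"
  obtains W a f where "openin (zariski (set_ring S)) W" "P \<in> W" "W \<subseteq> U" "a \<in> S" "f \<in> S"
    "\<And>Q. Q \<in> W \<Longrightarrow> f \<notin> Q" "\<And>Q. Q \<in> W \<Longrightarrow> s Q = loc_frac (set_ring S) Q a f"
proof -
  have "\<exists>W a f. openin (zariski (set_ring S)) W \<and> P \<in> W \<and> W \<subseteq> U \<and> a \<in> S \<and> f \<in> S \<and>
      (\<forall>Q\<in>W. f \<notin> Q \<and> s Q = loc_frac (set_ring S) Q a f)"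
    using assms unfolding sections_def set_ring_simps by blast
  then show ?thesis using that by blast
qed

text \<open>Over a domain, fraction classes are given by cross multiplication, so cutting a class
  over \<open>R\<close> down to \<open>A \<times> A\<close> undoes \<open>loc_map\<close>. The
  inverse of the pullback therefore takes at \<open>q\<close> the value at
  \<open>lift_prime q\<close> and cuts it down; what has to be checked is that the result is again
  locally a fraction over \<open>A\<close>.\<close>

lemma pullback_bij:
  assumes V: "openin (zariski (set_ring A)) U" "p \<notin> U"
  shows "bij_betw (pullback A (set_ring R) U) (sections (set_ring A) U)
    (sections (set_ring R) (spec_preimage A (set_ring R) U))"
proof -
  let ?\<phi>U = "spec_preimage A (set_ring R) U"
  have U: "prime_set q A \<and> q \<noteq> p" if "q \<in> U" for q
    using that V openin_subset[OF V(1)] unfolding topspace_zariski spec_A by blast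
  have pre: "Q \<in> spec_preimage A (set_ring R) W \<longleftrightarrow> prime_set Q R \<and> spec_map A Q \<in> W" for W Q
    unfolding spec_preimage_def spec_R by blast
  have lift: "lift_prime q \<in> ?\<phi>U" if "q \<in> U" for q
    unfolding pre using lift_prime(1) spec_map_lift U[OF that] that by auto
  have into: "pullback A (set_ring R) U s \<in> sections (set_ring R) ?\<phi>U" if s: "s \<in> sections (set_ring A) U" for s
    unfolding sections_def
  proof (intro CollectI conjI ballI)
    show "pullback A (set_ring R) U s \<in> extensional ?\<phi>U" unfolding pullback_def by simp
    fix Q assume Q: "Q \<in> ?\<phi>U"
    then have "spec_map A Q \<in> U" unfolding pre by blast
    then obtain W a f where W: "openin (zariski (set_ring A)) W" "spec_map A Q \<in> W" "W \<subseteq> U" "a \<in> A" "f \<in> A"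
      and f: "\<And>q. q \<in> W \<Longrightarrow> f \<notin> q" "\<And>q. q \<in> W \<Longrightarrow> s q = loc_frac (set_ring A) q a f"
      using sectionsD[OF s] by blast
    have "f \<notin> Q' \<and> pullback A (set_ring R) U s Q' = loc_frac (set_ring R) Q' a f"
      if Q': "Q' \<in> spec_preimage A (set_ring R) W" for Q'
    proof -
      have *: "prime_set Q' R" "spec_map A Q' \<in> W" "Q' \<in> ?\<phi>U" using Q' W(3) unfolding pre by auto
      then have nf: "f \<notin> Q'" using f(1)[OF *(2)] W(5) unfolding spec_map_def by blast
      then show ?thesis
        unfolding pullback_def using *(3) f(2)[OF *(2)] loc_map_fraction[OF *(1) W(4,5) nf] by simp
    qed
    moreover have "spec_preimage A (set_ring R) W \<subseteq> ?\<phi>U" using W(3) unfolding spec_preimage_def by blast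
    moreover have "Q \<in> spec_preimage A (set_ring R) W" using Q W(2) unfolding pre by blast
    ultimately show "\<exists>V a f. openin (zariski (set_ring R)) V \<and> Q \<in> V \<and> V \<subseteq> ?\<phi>U \<and>
        a \<in> carrier (set_ring R) \<and> f \<in> carrier (set_ring R) \<and>
        (\<forall>Q\<in>V. f \<notin> Q \<and> pullback A (set_ring R) U s Q = loc_frac (set_ring R) Q a f)"
      using openin_preimage[OF W(1)] W(4,5) A(2)
      by (intro exI[of _ "spec_preimage A (set_ring R) W"] exI[of _ a] exI[of _ f]) auto
  qed
  have inj: "s = s'" if s: "s \<in> sections (set_ring A) U" and s': "s' \<in> sections (set_ring A) U"
    and eq: "pullback A (set_ring R) U s = pullback A (set_ring R) U s'" for s s'
  proof (rule extensionalityI[of _ U])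
    show "s \<in> extensional U" "s' \<in> extensional U" using s s' unfolding sections_def by auto
    have val: "t q = pullback A (set_ring R) U t (lift_prime q) \<inter> A \<times> A"
      if q: "q \<in> U" and t: "t \<in> sections (set_ring A) U" for q t
    proof -
      obtain a f where f: "a \<in> A" "f \<in> A" "f \<notin> q" "t q = loc_frac (set_ring A) q a f"
        using sectionsD[OF t q] by metis
      have sm: "spec_map A (lift_prime q) = q" and pr: "prime_set (lift_prime q) R"
        using spec_map_lift lift_prime(1) U[OF q] by auto
      have nf: "f \<notin> lift_prime q" using f(2,3) sm unfolding spec_map_def by blast
      have "pullback A (set_ring R) U t (lift_prime q) = loc_frac (set_ring R) (lift_prime q) a f"
        unfolding pullback_def using lift[OF q] loc_map_fraction[OF pr f(1,2) nf] f(4) sm by simp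
      then show ?thesis using loc_frac_restrict[OF pr] f(4) sm by simp
    qed
    fix q assume "q \<in> U"
    then show "s q = s' q" using val[OF _ s, of q] val[OF _ s', of q] eq by metis
  qed
  have onto: "\<exists>s\<in>sections (set_ring A) U. pullback A (set_ring R) U s = \<sigma>"
    if \<sigma>: "\<sigma> \<in> sections (set_ring R) ?\<phi>U" for \<sigma>
  proof -
    define s where "s = restrict (\<lambda>q. \<sigma> (lift_prime q) \<inter> A \<times> A) U"
    have loc: "\<exists>W a f. openin (zariski (set_ring A)) W \<and> q \<in> W \<and> W \<subseteq> U \<and> a \<in> A \<and> f \<in> A \<and>
        (\<forall>q'\<in>W. f \<notin> q' \<and> s q' = loc_frac (set_ring A) q' a f \<and>
          \<sigma> (lift_prime q') = loc_frac (set_ring R) (lift_prime q') a f)" if q: "q \<in> U" for q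
    proof -
      obtain W a f where W: "openin (zariski (set_ring R)) W" "lift_prime q \<in> W" "W \<subseteq> ?\<phi>U" "a \<in> R" "f \<in> R"
        and f: "\<And>Q. Q \<in> W \<Longrightarrow> f \<notin> Q" "\<And>Q. Q \<in> W \<Longrightarrow> \<sigma> Q = loc_frac (set_ring R) Q a f"
        using sectionsD[OF \<sigma> lift[OF q]] by blast
      have q': "prime_set q A" "q \<noteq> p" using U[OF q] by auto
      obtain h1 where h1: "h1 \<in> A - q" "h1 * a \<in> A" using other_prime_denominator[OF q' W(4)] by blast
      obtain h2 where h2: "h2 \<in> A - q" "h2 * f \<in> A" using other_prime_denominator[OF q' W(5)] by blast
      \<comment> \<open>A common denominator outside \<open>q\<close> for \<open>a\<close> and
        \<open>f\<close>. On the smaller open set where \<open>h\<close> is invertible,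
        \<open>a / f\<close> equals \<open>(h * a) / (h * f)\<close>, a fraction over
        \<open>A\<close>.\<close>
      define h where "h = h1 * h2"
      have h: "h \<in> A" "h \<notin> q" "h * a \<in> A" "h * f \<in> A"
      proof -
        show "h \<in> A" "h \<notin> q"
          using h1 h2 A_closed(5) prime_setD(3)[OF q'(1)] unfolding h_def by blast+
        have "h * a = h2 * (h1 * a)" "h * f = h1 * (h2 * f)" unfolding h_def by (simp_all add: mult_ac)
        then show "h * a \<in> A" "h * f \<in> A" using h1 h2 A_closed(5) by (metis DiffD1)+
      qed
      have h0: "h \<noteq> 0" using h(2) ideal_setD(2)[OF prime_setD(1)[OF q'(1)]] by auto
      define W' where "W' = W \<inter> {Q \<in> spectrum (set_ring R). \<not> {h} \<subseteq> Q}"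
      have hR: "{h} \<subseteq> carrier (set_ring R)" using h(1) A(2) by auto
      have "openin (zariski (set_ring R)) {Q \<in> spectrum (set_ring R). \<not> {h} \<subseteq> Q}"
        unfolding openin_zariski using hR by blast
      then have W': "openin (zariski (set_ring R)) W'" unfolding W'_def using W(1) by blast
      have "q \<in> spec_map A ` W'"
      proof
        show "q = spec_map A (lift_prime q)" using spec_map_lift[OF q'] by simp
        have "h \<notin> lift_prime q" using lift_prime(2)[OF q'] h(1,2) by blast
        then show "lift_prime q \<in> W'" unfolding W'_def spec_R using W(2) lift_prime(1)[OF q'] by blast
      qed
      moreover have "spec_map A ` W' \<subseteq> U" unfolding W'_def using W(3) pre by blast
      moreover have "h * f \<notin> q1 \<and> s q1 = loc_frac (set_ring A) q1 (h * a) (h * f) \<and>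
          \<sigma> (lift_prime q1) = loc_frac (set_ring R) (lift_prime q1) (h * a) (h * f)"
        if q1: "q1 \<in> spec_map A ` W'" for q1
      proof -
        obtain Q where Q: "Q \<in> W" "prime_set Q R" "h \<notin> Q" "q1 = spec_map A Q"
          using q1 unfolding W'_def spec_R by blast
        have lQ: "lift_prime q1 = Q" unfolding Q(4) spec_map_def by (rule lift_prime_restrict[OF Q(2)])
        have "h * f \<notin> Q" using prime_setD(3)[OF Q(2)] hR W(5) f(1)[OF Q(1)] Q(3) by auto
        moreover have "loc_frac (set_ring R) Q a f = loc_frac (set_ring R) Q (h * a) (h * f)"
          unfolding loc_frac_set_ring[OF R Q(2)] using h0 by (auto simp: mult.left_commute[of _ h] mult.assoc)
        moreover have "q1 \<in> U" using q1 \<open>spec_map A ` W' \<subseteq> U\<close> by blast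
        ultimately show ?thesis
          using lQ f(2)[OF Q(1)] loc_frac_restrict[OF Q(2)] Q(4) unfolding s_def spec_map_def by simp
      qed
      ultimately show ?thesis using openin_image[OF W'] h(3,4)
        by (intro exI[of _ "spec_map A ` W'"] exI[of _ "h * a"] exI[of _ "h * f"]) auto
    qed
    have "s \<in> sections (set_ring A) U"
      unfolding sections_def
    proof (intro CollectI conjI ballI)
      show "s \<in> extensional U" unfolding s_def by simp
      fix q assume "q \<in> U"
      show "\<exists>V a f. openin (zariski (set_ring A)) V \<and> q \<in> V \<and> V \<subseteq> U \<and>
          a \<in> carrier (set_ring A) \<and> f \<in> carrier (set_ring A) \<and>
          (\<forall>Q\<in>V. f \<notin> Q \<and> s Q = loc_frac (set_ring A) Q a f)"
        using loc[OF \<open>q \<in> U\<close>] unfolding set_ring_simps by metis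
    qed
    moreover have "pullback A (set_ring R) U s = \<sigma>"
    proof (rule extensionalityI[of _ ?\<phi>U])
      show "pullback A (set_ring R) U s \<in> extensional ?\<phi>U" unfolding pullback_def by simp
      show "\<sigma> \<in> extensional ?\<phi>U" using \<sigma> unfolding sections_def by blast
      fix Q assume Q: "Q \<in> ?\<phi>U"
      then have Q': "prime_set Q R" "spec_map A Q \<in> U" unfolding pre by auto
      have lQ: "lift_prime (spec_map A Q) = Q" unfolding spec_map_def by (rule lift_prime_restrict[OF Q'(1)])
      obtain a f where f: "a \<in> A" "f \<in> A" "f \<notin> spec_map A Q"
        "s (spec_map A Q) = loc_frac (set_ring A) (spec_map A Q) a f"
        "\<sigma> Q = loc_frac (set_ring R) Q a f"
        using loc[OF Q'(2)] lQ by metis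
      have "f \<notin> Q" using f(2,3) unfolding spec_map_def by blast
      then show "pullback A (set_ring R) U s Q = \<sigma> Q"
        unfolding pullback_def using Q f loc_map_fraction[OF Q'(1) f(1,2)] by simp
    qed
    ultimately show ?thesis by blast
  qed
  show ?thesis
    unfolding bij_betw_def
  proof
    show "inj_on (pullback A (set_ring R) U) (sections (set_ring A) U)"
      using inj by (auto intro: inj_onI)
    show "pullback A (set_ring R) U ` sections (set_ring A) U = sections (set_ring R) ?\<phi>U"
      using into onto by blast
  qed
qed

lemma iso_away_from_p: "iso_away_from p A (set_ring R)"
  unfolding iso_away_from_def set_ring_simps using homeomorphic_spec_map pullback_bij by blast

lemma maximalideal_p: "maximalideal p (set_ring A)"
proof (rule maximalidealI)
  show "ideal p (set_ring A)" using ideal_set_ring[OF A(1)] prime_setD(1)[OF p_prime] by blast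
  show "carrier (set_ring A) \<noteq> p" using prime_setD(2)[OF p_prime] A_closed(2) by auto
  fix J assume J: "ideal J (set_ring A)" "p \<subseteq> J" "J \<subseteq> carrier (set_ring A)"
  then have JI: "ideal_set J A" using ideal_set_ring[OF A(1)] by blast
  show "J = p \<or> J = carrier (set_ring A)"
  proof (rule disjCI)
    assume "J \<noteq> carrier (set_ring A)"
    then have "1 \<notin> J" using ideal_set_one[OF JI] by auto
    show "J = p"
    proof (rule ccontr)
      assume "J \<noteq> p"
      then obtain s where s: "s \<in> J" "s \<notin> p" using J(2) by blast
      then obtain c e where "c \<in> A" "e \<in> p" "s * c + e = 1" using p_maximal[of s] J(3) by auto
      then have "1 \<in> J" using s(1) ideal_setD(3,5)[OF JI] J(2) by (metis subsetD)
      then show False using \<open>1 \<notin> J\<close> by blast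
    qed
  qed
qed

text \<open>Existence is the comparison above. For another candidate \<open>m\<close>, the
  homeomorphism would be onto all primes except \<open>m\<close>, while \<open>p\<close> is never in
  the image; hence \<open>m = p\<close>.\<close>

theorem crucial_ideal_eq: "crucial_ideal A (set_ring R) = p"
  unfolding crucial_ideal_def
proof (rule the_equality)
  show "maximalideal p ((set_ring R)\<lparr>carrier := A\<rparr>) \<and> iso_away_from p A (set_ring R)"
    using maximalideal_p iso_away_from_p by simp
  fix m assume "maximalideal m ((set_ring R)\<lparr>carrier := A\<rparr>) \<and> iso_away_from m A (set_ring R)"
  then have "homeomorphic_map
     (subtopology (zariski (set_ring R)) (spectrum (set_ring R) - spec_preimage A (set_ring R) {m}))
     (subtopology (zariski (set_ring A)) (spectrum (set_ring A) - {m})) (spec_map A)"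
    unfolding iso_away_from_def set_ring_simps by blast
  from homeomorphic_imp_surjective_map[OF this]
  have "spec_map A ` (spectrum (set_ring R) - spec_preimage A (set_ring R) {m}) = spectrum (set_ring A) - {m}"
    by (simp add: topspace_subtopology topspace_zariski Int_absorb1)
  moreover have "p \<notin> spec_map A ` (spectrum (set_ring R) - spec_preimage A (set_ring R) {m})"
    using spec_map_prime unfolding spec_R by blast
  moreover have "p \<in> spectrum (set_ring A)" using p_prime unfolding spec_A by blast
  ultimately show "m = p" by blast
qed

lemma extending_A: "extending A (set_ring R)"
  using extending_set_ring[OF R A(1,2)] p_prime p_not_image by blast

end

text \<open>Entry to the locale: \<open>ext_maxI\<close> is applied to any prime that the spectrum
  of \<open>R\<close> misses, and \<open>crucial_ideal_eq\<close> then identifies this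
  prime.\<close>

theorem extending_maximal_ext_max:
  assumes "subring_set R" "maximal_subring A (set_ring R)" "extending A (set_ring R)"
  obtains V where "ext_max A R V (crucial_ideal A (set_ring R))"
proof -
  have max: "max_subring_set A R" using assms(1,2) maximal_subring_set_ring by blast
  then have A: "subring_set A" "A \<subseteq> R" unfolding max_subring_set_def by auto
  obtain p where "prime_set p A" "\<And>Q. prime_set Q R \<Longrightarrow> Q \<inter> A \<noteq> p"
    using assms(3) extending_set_ring[OF assms(1) A] by blast
  then obtain V where "ext_max A R V p" using ext_maxI[OF assms(1) max] by blast
  then show ?thesis using that ext_max.crucial_ideal_eq by metis
qed

section \<open>Descent to a smaller ring\<close>

lemma subring_add_ideal:
  assumes A: "subring_set A" and R: "subring_set R" "A \<subseteq> R" and s: "s \<in> A"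
  shows "subring_set {a + s * r |a r. a \<in> A \<and> r \<in> R}" (is "subring_set ?S")
  unfolding subring_set_def
proof (intro conjI ballI)
  note A' = subring_setD[OF A] and R' = subring_setD[OF R(1)]
  have "1 = 1 + s * 0" by simp
  then show "1 \<in> ?S" using A'(2) R'(1) by blast
  fix u v assume "u \<in> ?S" "v \<in> ?S"
  then obtain a r b q where u: "u = a + s * r" "a \<in> A" "r \<in> R" and v: "v = b + s * q" "b \<in> A" "q \<in> R"
    by blast
  have "u - v = (a - b) + s * (r - q)" using u v by (simp add: algebra_simps)
  then show "u - v \<in> ?S" using A'(4)[OF u(2) v(2)] R'(4)[OF u(3) v(3)] by blast
  have "u * v = a * b + s * (a * q + r * b + s * (r * q))" using u v by (simp add: algebra_simps)
  moreover have "a \<in> R" "b \<in> R" "s \<in> R" using u v s R(2) by auto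
  then have "a * q + r * b + s * (r * q) \<in> R" using u v R'(3,5) by metis
  ultimately show "u * v \<in> ?S" using A'(5)[OF u(2) v(2)] by blast
qed

text \<open>Because these elements form a ring, the residue hypothesis of \<open>descend\<close>
  needs to be tested only on generators of \<open>A\<close>.\<close>

lemma subring_congruent:
  assumes A: "subring_set A" and B: "subring_set B" "B \<subseteq> A" and p: "ideal_set p A"
  shows "subring_set {x \<in> A. \<exists>b\<in>B. x - b \<in> p}" (is "subring_set ?S")
  unfolding subring_set_def
proof (intro conjI ballI)
  note A' = subring_setD[OF A] and B' = subring_setD[OF B(1)] and p' = ideal_setD[OF p]
  have "1 - 1 \<in> p" using p'(2) by simp
  then show "1 \<in> ?S" using A'(2) B'(2) by blast
  fix u v assume "u \<in> ?S" "v \<in> ?S"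
  then obtain a b where u: "u \<in> A" "a \<in> B" "u - a \<in> p" and v: "v \<in> A" "b \<in> B" "v - b \<in> p" by blast
  have "(u - v) - (a - b) = (u - a) - (v - b)" by simp
  then have "(u - v) - (a - b) \<in> p" using ideal_set_minus(2)[OF A p u(3) v(3)] by metis
  then show "u - v \<in> ?S" using A'(4)[OF u(1) v(1)] B'(4)[OF u(2) v(2)] by blast
  have "u * v - a * b = u * (v - b) + b * (u - a)" by (simp add: algebra_simps)
  moreover have "u * (v - b) + b * (u - a) \<in> p"
    using p'(3)[OF p'(4)[OF u(1) v(3)] p'(4)[of b, OF _ u(3)]] v(2) B(2) by blast
  ultimately have "u * v - a * b \<in> p" by simp
  then show "u * v \<in> ?S" using A'(5)[OF u(1) v(1)] B'(5)[OF u(2) v(2)] by blast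
qed

context ext_max
begin

text \<open>The ring \<open>A + s R\<close> contains \<open>s * r0\<close> and is thus not
  \<open>A\<close>; by maximality it is \<open>R\<close>. In other words, \<open>A\<close> maps onto
  \<open>R / s R\<close>.\<close>

lemma decompose_mod:
  assumes s: "s \<in> A" and r0: "r0 \<in> R" "s * r0 \<notin> A" and x: "x \<in> R"
  shows "\<exists>a\<in>A. \<exists>r\<in>R. x = a + s * r"
proof -
  let ?S = "{a + s * r |a r. a \<in> A \<and> r \<in> R}"
  have "A \<subseteq> ?S"
  proof
    fix a assume "a \<in> A"
    then have "a = a + s * 0 \<and> a \<in> A \<and> 0 \<in> R" using R_closed(1) by simp
    then show "a \<in> ?S" by blast
  qed
  moreover have "?S \<subseteq> R" using s A(2) R_closed(3,5) by blast
  moreover have "s * r0 \<in> ?S"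
  proof -
    have "s * r0 = 0 + s * r0" by simp
    then show ?thesis using A_closed(1) r0(1) by blast
  qed
  ultimately have "?S = R" using maxD[OF subring_add_ideal[OF A(1) R A(2) s]] r0(2) by blast
  then have "x \<in> ?S" using x by simp
  then show ?thesis by blast
qed

text \<open>A ring \<open>T\<close> strictly above \<open>B = A \<inter> P\<close> is localized at
  \<open>B - p\<close> and cut with \<open>R\<close>; by \<open>fractions\<close> the result
  contains \<open>A\<close>, so it is \<open>R\<close> and yields \<open>s * y\<close> in
  \<open>T\<close> for some \<open>s\<close> in \<open>B - p\<close>. By \<open>residue\<close>,
  \<open>s\<close> is invertible in \<open>B\<close> modulo powers of an element \<open>q\<close> of
  \<open>p\<close>, and such a power carries \<open>y\<close> into \<open>B\<close>. Together these
  give \<open>y\<close> in \<open>T\<close>, and \<open>gen\<close> concludes.\<close>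

theorem descend:
  assumes P: "subring_set P" "P \<subseteq> R"
    and residue: "\<And>a. a \<in> A \<Longrightarrow> \<exists>b\<in>A \<inter> P. a - b \<in> p"
    and fractions: "\<And>a. a \<in> A \<Longrightarrow> \<exists>s\<in>A \<inter> P - p. s * a \<in> A \<inter> P"
    and y: "y \<in> P" "y \<notin> A"
    and gen: "\<And>T. subring_set T \<Longrightarrow> A \<inter> P \<subseteq> T \<Longrightarrow> T \<subseteq> P \<Longrightarrow> y \<in> T \<Longrightarrow> T = P"
  shows "ext_max (A \<inter> P) P V (p \<inter> P)"
proof -
  let ?B = "A \<inter> P"
  have B: "subring_set ?B" by (rule subring_set_Int[OF A(1) P(1)])
  note B' = subring_setD[OF B] and P' = subring_setD[OF P(1)]
  have yR: "y \<in> R" using y(1) P(2) by blast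
  \<comment> \<open>The relation \<open>a * y = b\<close> from \<open>denominator\<close> is
    multiplied by a common denominator \<open>s * t\<close>, which moves both sides into
    \<open>P\<close> without moving \<open>b\<close> into \<open>p\<close>.\<close>
  obtain a b where ab: "a \<in> p \<inter> P" "b \<in> ?B - p" "a * y = b"
  proof -
    obtain a b where ab: "a \<in> p" "b \<in> A - p" "a * y = b" using denominator[OF yR y(2)] by blast
    obtain s where s: "s \<in> ?B - p" "s * a \<in> ?B" using fractions[of a] ab(1) p_ideal(1) by blast
    obtain t where t: "t \<in> ?B - p" "t * b \<in> ?B" using fractions[of b] ab(2) by blast
    have e: "(s * t) * a = t * (s * a)" "(s * t) * b = s * (t * b)" by (simp_all add: mult_ac)
    have "t * (s * a) \<in> p" using p_ideal(4)[OF _ p_ideal(4)[OF _ ab(1)]] s(1) t(1) by blast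
    moreover have "t * (s * a) \<in> P" using P'(5) s(2) t(1) by blast
    ultimately have "(s * t) * a \<in> p \<inter> P" unfolding e by blast
    moreover have "t * b \<in> A - p" using prime_complement_mult[OF A(1) p_prime _ ab(2)] t(1) by blast
    then have "s * (t * b) \<in> A - p" using prime_complement_mult[OF A(1) p_prime] s(1) by blast
    then have "(s * t) * b \<in> ?B - p" unfolding e using B'(5) s(1) t(2) by blast
    moreover have "((s * t) * a) * y = (s * t) * b" using ab(3) by (simp add: mult.assoc)
    ultimately show ?thesis using that by blast
  qed
  have "max_subring_set ?B P"
    unfolding max_subring_set_def
  proof (intro conjI allI impI)
    show "subring_set ?B" "?B \<subseteq> P" "?B \<noteq> P" using B y by auto
    fix T assume T: "subring_set T \<and> ?B \<subseteq> T \<and> T \<subseteq> P"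
    note T' = subring_setD[OF conjunct1[OF T]]
    show "T = ?B \<or> T = P"
    proof (rule disjCI)
      assume "T \<noteq> P"
      show "T = ?B"
      proof (rule ccontr)
        assume "T \<noteq> ?B"
        then obtain f where f: "f \<in> T" "f \<notin> ?B" using T by blast
        let ?D = "{x. \<exists>s\<in>?B - p. s * x \<in> T}"
        have "subring_set (?D \<inter> R)"
        proof (rule subring_set_Int[OF subring_fractions R])
          show "subring_set T" "?B - p \<subseteq> T" "1 \<in> ?B - p"
            using T B'(2) prime_setD(2)[OF p_prime] by auto
          show "\<And>s t. s \<in> ?B - p \<Longrightarrow> t \<in> ?B - p \<Longrightarrow> s * t \<in> ?B - p"
            using prime_complement_mult[OF A(1) p_prime] B'(5) by blast
        qed
        moreover have "A \<subseteq> ?D \<inter> R" using fractions T A(2) by blast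
        moreover have "f \<in> ?D \<inter> R"
        proof -
          have "1 \<in> ?B - p" using B'(2) prime_setD(2)[OF p_prime] by blast
          then show ?thesis using fractions_base[of "?B - p" f T] f(1) T P(2) by blast
        qed
        moreover have "f \<notin> A" using f T by blast
        ultimately have "?D \<inter> R = R" using maxD[of "?D \<inter> R"] by blast
        then obtain s where s: "s \<in> ?B - p" "s * y \<in> T" using yR by blast
        obtain c e where c: "c \<in> A" "e \<in> p" "s * c + e = 1" using p_maximal[of s] s(1) by blast
        obtain c0 where c0: "c0 \<in> ?B" "c - c0 \<in> p" using residue[OF c(1)] by blast
        \<comment> \<open>An inverse of \<open>s\<close> modulo \<open>p\<close> is replaced by
          \<open>c0\<close> in \<open>B\<close>, so the error term \<open>q\<close> lies in
          \<open>B\<close> as well as in \<open>p\<close>.\<close>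
        define q where "q = 1 - s * c0"
        have "q = e + s * (c - c0)" unfolding q_def using c(3) by (simp add: algebra_simps)
        also have "\<dots> \<in> p" using c(2) c0(2) s(1) p_ideal(3,4) by blast
        finally have qp: "q \<in> p" .
        have "s * c0 \<in> ?B" using s(1) c0(1) B'(5) by blast
        then have qB: "q \<in> ?B" unfolding q_def using B'(2,4) by blast
        obtain n where n: "q ^ n * y \<in> A" using p_nilpotent[OF qp yR] by blast
        \<comment> \<open>Obtained by expanding \<open>(s * c0 + q) ^ n = 1\<close>.\<close>
        have "\<exists>d\<in>?B. s * d + q ^ n = 1"
        proof (induction n)
          case 0
          then show ?case using B'(1) by (intro bexI[of _ 0]) auto
        next
          case (Suc n)
          then obtain d where d: "d \<in> ?B" "s * d + q ^ n = 1" by blast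
          have "d + q ^ n * c0 \<in> ?B" by (rule B'(3)[OF d(1) B'(5)[OF B'(7)[OF qB] c0(1)]])
          moreover have "s * (d + q ^ n * c0) + q ^ Suc n = s * d + q ^ n * (s * c0 + q)"
            by (simp add: algebra_simps)
          then have "s * (d + q ^ n * c0) + q ^ Suc n = 1" using d(2) unfolding q_def by simp
          ultimately show ?case by blast
        qed
        then obtain d where d: "d \<in> ?B" "s * d + q ^ n = 1" by blast
        have "q ^ n * y \<in> ?B" using n qB B'(7) P'(5) y(1) by blast
        moreover have "y = d * (s * y) + q ^ n * y"
          using d(2) by (metis distrib_right mult.assoc mult.commute mult.left_neutral)
        ultimately have "y \<in> T" using d(1) s(2) T T'(3,5) by (metis subsetD)
        then show False using gen[of T] T \<open>T \<noteq> P\<close> by blast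
      qed
    qed
  qed
  \<comment> \<open>The product \<open>a * y = b\<close> is in \<open>B\<close>, so \<open>y\<close>
    is no witness; but \<open>a * (y * y) = b * y\<close> with \<open>b\<close> outside
    \<open>p\<close> and \<open>y\<close> outside \<open>A\<close>.\<close>
  moreover have "\<exists>q\<in>p \<inter> P. \<exists>r\<in>P. q * r \<notin> ?B"
  proof (intro bexI)
    show "a \<in> p \<inter> P" by (rule ab)
    show "y * y \<in> P" using y(1) P'(5) by blast
    show "a * (y * y) \<notin> ?B"
    proof
      assume "a * (y * y) \<in> ?B"
      moreover have "a * (y * y) = b * y" using ab(3) by (simp add: mult.assoc[symmetric])
      ultimately have "b * y \<in> A" by simp
      then show False using outside_p_cancel[of b y] ab(2) yR y(2) by blast
    qed
  qed
  ultimately show ?thesis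
    unfolding ext_max_def using P V A_eq p_eq by auto
qed

end

section \<open>Subalgebras of the rational function field\<close>

lemma ratfun_eq: "ring_of_type_algebra = set_ring (UNIV :: 'a::field set)"
  unfolding set_ring_def ring_of_type_algebra_def by simp

lemma kalg_set_ring: "kalg S = set_ring (carrier (kalg S))"
  unfolding kalg_def set_ring_def by simp

lemma subring_set_UNIV: "subring_set (UNIV :: 'a::comm_ring_1 set)"
  unfolding subring_set_def by simp

lemma subring_kalg: "subring_set (carrier (kalg S))"
  unfolding subring_set_def
proof (intro conjI ballI)
  let ?H = "range const \<union> S"
  have C: "carrier (kalg S) = generate_ring (set_ring UNIV) ?H"
    unfolding kalg_def ratfun_eq by simp
  show "1 \<in> carrier (kalg S)" unfolding C using generate_ring.one[of "set_ring UNIV" ?H] by simp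
  fix a b assume ab: "a \<in> carrier (kalg S)" "b \<in> carrier (kalg S)"
  then show "a * b \<in> carrier (kalg S)"
    unfolding C using generate_ring.eng_mult[of a "set_ring UNIV" ?H b] by simp
  have "- b \<in> carrier (kalg S)"
    using generate_ring.a_inv[of b "set_ring UNIV" ?H] ab(2) unfolding C
    by (simp add: a_inv_set_ring[OF subring_set_UNIV])
  then show "a - b \<in> carrier (kalg S)"
    unfolding C using generate_ring.eng_add[of a "set_ring UNIV" ?H "- b"] ab(1) C by simp
qed

lemma kalg_gen: "const c \<in> carrier (kalg S)" "x \<in> S \<Longrightarrow> x \<in> carrier (kalg S)"
  unfolding kalg_def by (auto intro: generate_ring.incl)

lemma kalg_least:
  assumes T: "subring_set T" "range const \<subseteq> T" "S \<subseteq> T"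
  shows "carrier (kalg S) \<subseteq> T"
proof
  note T' = subring_setD[OF T(1)]
  fix x assume "x \<in> carrier (kalg S)"
  then have "x \<in> generate_ring (set_ring UNIV) (range const \<union> S)" unfolding kalg_def ratfun_eq by simp
  then show "x \<in> T"
    by induction (use T T' in \<open>auto simp: a_inv_set_ring[OF subring_set_UNIV]\<close>)
qed

lemma kalg_mono: "S \<subseteq> S' \<Longrightarrow> carrier (kalg S) \<subseteq> carrier (kalg S')"
  by (rule kalg_least[OF subring_kalg]) (auto simp: kalg_gen)

text \<open>A subring containing the constants is closed under scalars, so only the locale predicate
  remains, with the crucial ideal in the role of \<open>p\<close>.\<close>

lemma ext_max_subalgebras_iff:
  assumes "range const \<subseteq> A"
  shows "A \<in> ext_max_subalgebras (kalg S) \<longleftrightarrow>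
    (\<exists>V. ext_max A (carrier (kalg S)) V (crucial_ideal A (kalg S)))"
proof
  let ?R = "carrier (kalg S)"
  assume "A \<in> ext_max_subalgebras (kalg S)"
  then have "maximal_subring A (set_ring ?R)" "extending A (set_ring ?R)"
    unfolding ext_max_subalgebras_def kalg_set_ring[symmetric] by auto
  then show "\<exists>V. ext_max A ?R V (crucial_ideal A (kalg S))"
    using extending_maximal_ext_max[OF subring_kalg] kalg_set_ring by metis
next
  let ?R = "carrier (kalg S)"
  assume "\<exists>V. ext_max A ?R V (crucial_ideal A (kalg S))"
  then obtain V where "ext_max A ?R V (crucial_ideal A (kalg S))" by blast
  then interpret ext_max A ?R V "crucial_ideal A (kalg S)" .
  have max: "maximal_subring A (kalg S)"
    using maximal_subring_set_ring[OF R] max kalg_set_ring by metis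
  then have "subring A (kalg S)" unfolding maximal_subring_def by blast
  then have "subgroup A (add_monoid (kalg S))" "\<And>a b. a \<in> A \<Longrightarrow> b \<in> A \<Longrightarrow> a \<otimes>\<^bsub>kalg S\<^esub> b \<in> A"
    by (rule subring.axioms(1), rule subringE(6))
  then have "subalgebra (range const) A (kalg S)"
    unfolding subalgebra_def subalgebra_axioms_def using assms by blast
  moreover have "extending A (kalg S)" using extending_A kalg_set_ring by metis
  ultimately show "A \<in> ext_max_subalgebras (kalg S)"
    unfolding ext_max_subalgebras_def using max by blast
qed

lemma crucial_ideal_kalg:
  "ext_max A (carrier (kalg S)) V p \<Longrightarrow> crucial_ideal A (kalg S) = p"
  using ext_max.crucial_ideal_eq kalg_set_ring by metis

section \<open>Polynomials in \<open>y\<close> over \<open>k[t]\<close> and valuations with a pole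
  at \<open>y\<close>\<close>

abbreviation emb :: "'k::field poly \<Rightarrow> 'k poly poly fract" where
  "emb c \<equiv> to_fract [:c:]"

lemma emb_arith:
  "emb (c + d) = emb c + emb d" "emb (c - d) = emb c - emb d" "emb (c * d) = emb c * emb d" "emb 1 = 1"
  unfolding to_fract_add[symmetric] to_fract_diff[symmetric] to_fract_mult[symmetric] to_fract_1[symmetric]
  by (simp_all add: one_pCons)

lemma emb_linear: "emb [:- c, 1:] = var_t - const c"
  unfolding var_t_def const_def to_fract_diff[symmetric] by simp

lemma to_fract_pCons: "to_fract (pCons c F) = emb c + var_y * to_fract F"
  unfolding var_y_def to_fract_add[symmetric] to_fract_mult[symmetric] by simp

lemma emb_pCons: "emb (pCons a c) = const a + var_t * emb c"
  unfolding var_t_def const_def to_fract_add[symmetric] to_fract_mult[symmetric] by simp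

lemma to_fract_sum_powers: "to_fract F = (\<Sum>i\<le>degree F. emb (coeff F i) * var_y ^ i)"
proof -
  have m: "to_fract (monom c i) = emb c * var_y ^ i" for c :: "'a poly" and i
  proof (induction i)
    case (Suc i)
    then show ?case using to_fract_pCons[of 0 "monom c i"] by (simp add: monom_Suc mult_ac)
  qed (simp add: monom_0)
  have "to_fract F = to_fract (\<Sum>i\<le>degree F. monom (coeff F i) i)"
    by (simp add: poly_as_sum_of_monoms)
  then show ?thesis by (simp add: m)
qed

lemma to_fract_eq_poly: "to_fract F = poly (map_poly emb F) var_y"
proof (induction F)
  case (pCons c F)
  then show ?case using to_fract_pCons[of c F] by (simp add: map_poly_pCons)
qed simp

lemma emb_in_kalg: "var_t \<in> S \<Longrightarrow> emb c \<in> carrier (kalg S)"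
proof (induction c)
  case 0
  then show ?case using subring_setD(1)[OF subring_kalg] by simp
next
  case (pCons a c)
  then show ?case
    unfolding emb_pCons using kalg_gen subring_setD(3,5)[OF subring_kalg] by metis
qed

lemma carrier_kalg_poly:
  "carrier (kalg {var_t, var_y}) = (range to_fract :: 'k::field poly poly fract set)"
proof
  show "carrier (kalg {var_t, var_y}) \<subseteq> range to_fract"
  proof (rule kalg_least)
    show "subring_set (range to_fract)"
      unfolding subring_set_def
      by (auto simp flip: to_fract_diff to_fract_mult to_fract_1)
  qed (auto simp: const_def var_t_def var_y_def)
  have "to_fract F \<in> carrier (kalg {var_t, var_y})" for F :: "'k poly poly"
  proof (induction F)
    case 0
    then show ?case using subring_setD(1)[OF subring_kalg] by simp
  next
    case (pCons c F)
    have "emb c \<in> carrier (kalg {var_t, var_y})" "var_y \<in> carrier (kalg {var_t, var_y})"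
      using emb_in_kalg kalg_gen(2) by blast+
    then show ?case
      using to_fract_pCons[of c F] pCons.IH subring_setD(3,5)[OF subring_kalg] by metis
  qed
  then show "range to_fract \<subseteq> carrier (kalg {var_t, var_y :: 'k poly poly fract})"
    by (intro image_subsetI)
qed

text \<open>Formulated over the Laurent ring in both variables, which contains both rings of the
  theorem, so that the value of \<open>t\<close> at the crucial ideal is found for both at
  once.\<close>

lemma clear_denominators:
  assumes "x \<in> carrier (kalg {var_t, inverse var_t, var_y, inverse var_y})"
  shows "\<exists>n F. (var_t * var_y) ^ n * x = to_fract F"
proof -
  let ?S = "range (\<lambda>n. (var_t * var_y) ^ n)" and ?P = "carrier (kalg {var_t, var_y})"
  have nz: "var_t \<noteq> 0" "var_y \<noteq> 0" unfolding var_t_def var_y_def by auto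
  have ty: "var_t \<in> ?P" "var_y \<in> ?P" using kalg_gen(2) by blast+
  have S1: "1 \<in> ?S" using rangeI[of "\<lambda>n. (var_t * var_y) ^ n" 0] by simp
  have "carrier (kalg {var_t, inverse var_t, var_y, inverse var_y}) \<subseteq> {x. \<exists>s\<in>?S. s * x \<in> ?P}"
  proof (rule kalg_least)
    show "subring_set {x. \<exists>s\<in>?S. s * x \<in> ?P}"
    proof (rule subring_fractions[OF subring_kalg _ S1])
      show "?S \<subseteq> ?P" using ty subring_setD(5,7)[OF subring_kalg] by blast
      show "s * t \<in> ?S" if "s \<in> ?S" "t \<in> ?S" for s t
        using that by (auto simp flip: power_add)
    qed
    show "range const \<subseteq> {x. \<exists>s\<in>?S. s * x \<in> ?P}"
      using fractions_base[OF S1 kalg_gen(1)] by blast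
    have "(var_t * var_y) ^ 1 * inverse var_t \<in> ?P" "(var_t * var_y) ^ 1 * inverse var_y \<in> ?P"
    proof -
      have "(var_t * var_y) ^ 1 * inverse var_t = var_y" "(var_t * var_y) ^ 1 * inverse var_y = var_t"
        using nz by (metis mult.assoc mult.commute mult.right_neutral power_one_right right_inverse)+
      then show "(var_t * var_y) ^ 1 * inverse var_t \<in> ?P" "(var_t * var_y) ^ 1 * inverse var_y \<in> ?P"
        using ty by metis+
    qed
    then show "{var_t, inverse var_t, var_y, inverse var_y} \<subseteq> {x. \<exists>s\<in>?S. s * x \<in> ?P}"
      using fractions_base[OF S1 ty(1)] fractions_base[OF S1 ty(2)] by blast
  qed
  then show ?thesis using assms unfolding carrier_kalg_poly by blast
qed

text \<open>Since \<open>1 / y\<close> is in the valuation ideal, dividing \<open>F\<close> by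
  \<open>y\<close> to its degree leaves the leading coefficient plus an element of that ideal. If
  the degree exceeded \<open>n\<close>, the quotient itself would be in the ideal, and so would the
  leading coefficient.\<close>

lemma degree_bound:
  assumes V: "valuation_ring V" and y: "var_y \<notin> V"
    and c: "\<And>i. emb (coeff F i) \<in> V" and l: "F \<noteq> 0 \<Longrightarrow> emb (lead_coeff F) \<notin> val_ideal V"
    and bound: "to_fract F * inverse var_y ^ n \<in> V"
  shows "degree F \<le> n"
proof (rule ccontr)
  assume "\<not> degree F \<le> n"
  then have d: "n < degree F" "F \<noteq> 0" by auto
  note Vv = ideal_setD[OF prime_setD(1)[OF val_ideal_prime[OF V]]]
  note V' = subring_setD[OF valuation_ringD[OF V]]
  have iy: "inverse var_y \<in> val_ideal V" by (rule inverse_in_val_ideal[OF y])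
  have y0: "var_y \<noteq> 0" unfolding var_y_def by simp
  have pw: "inverse var_y ^ k \<in> val_ideal V" if "k > 0" for k
    using iy Vv(1) V'(7) Vv(5)[of "inverse var_y" "inverse var_y ^ (k - 1)"] that
    by (cases k) auto
  define d where "d = degree F"
  have cancel: "var_y ^ i * inverse var_y ^ d = inverse var_y ^ (d - i)" if "i \<le> d" for i
  proof -
    have "inverse var_y ^ d = inverse var_y ^ (d - i) * inverse var_y ^ i"
      using that by (simp flip: power_add)
    then have "var_y ^ i * inverse var_y ^ d = inverse var_y ^ (d - i) * (var_y ^ i * inverse var_y ^ i)"
      by (metis mult.left_commute)
    moreover have "var_y ^ i * inverse var_y ^ i = 1"
      using y0 by (metis power_mult_distrib power_one right_inverse)
    ultimately show ?thesis by (metis mult.right_neutral)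
  qed
  have "to_fract F * inverse var_y ^ d = (\<Sum>i\<le>d. emb (coeff F i) * inverse var_y ^ (d - i))"
    unfolding to_fract_sum_powers[of F] d_def[symmetric] sum_distrib_right
    by (rule sum.cong) (simp_all add: cancel mult.assoc)
  also have "\<dots> = emb (lead_coeff F) + (\<Sum>i<d. emb (coeff F i) * inverse var_y ^ (d - i))"
    by (simp add: d_def lessThan_Suc_atMost[symmetric])
  finally have "emb (lead_coeff F) =
      to_fract F * inverse var_y ^ d - (\<Sum>i<d. emb (coeff F i) * inverse var_y ^ (d - i))"
    by simp
  moreover have "to_fract F * inverse var_y ^ d \<in> val_ideal V"
  proof -
    have "to_fract F * inverse var_y ^ d = (to_fract F * inverse var_y ^ n) * inverse var_y ^ (d - n)"
      using d(1) unfolding d_def by (simp add: mult.assoc flip: power_add)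
    moreover have "d - n > 0" using d(1) unfolding d_def by simp
    ultimately show ?thesis using Vv(4)[OF bound pw] by metis
  qed
  moreover have "(\<Sum>i<d. emb (coeff F i) * inverse var_y ^ (d - i)) \<in> val_ideal V"
    by (rule ideal_set_sum[OF prime_setD(1)[OF val_ideal_prime[OF V]]]) (use Vv(4) c pw in auto)
  ultimately have "emb (lead_coeff F) \<in> val_ideal V"
    using ideal_set_minus(2)[OF valuation_ringD[OF V] prime_setD(1)[OF val_ideal_prime[OF V]]]
    by (simp only:)
  then show False using l d(2) by blast
qed

lemma const_not_in_val_ideal:
  assumes "valuation_ring V" "range const \<subseteq> V" "c \<noteq> 0"
  shows "const c \<notin> val_ideal V"
proof
  assume "const c \<in> val_ideal V"
  then have "const (inverse c) * const c \<in> val_ideal V"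
    using assms(2) ideal_setD(4)[OF prime_setD(1)[OF val_ideal_prime[OF assms(1)]]] by blast
  moreover have "const (inverse c) * const c = 1"
    unfolding const_def to_fract_mult[symmetric] to_fract_1[symmetric] using assms(3)
    by (simp add: one_pCons)
  ultimately show False using prime_setD(2)[OF val_ideal_prime[OF assms(1)]] by simp
qed

text \<open>
  If no \<open>t - c\<close> lies in \<open>p\<close>, all nonzero elements of \<open>k[t]\<close> are units of the valuation ring. As \<open>t - 1\<close> acts
  bijectively on \<open>R/A\<close>, we may write \<open>y = a + (t - 1) r\<close>; clearing denominators and comparing
  coefficients contradicts the bound on the degree in \<open>y\<close> of the numerator of \<open>a\<close>.
\<close>

lemma crucial_value_exists:
  fixes A R V p :: "'k::alg_closed_field poly poly fract set"
  assumes em: "ext_max A R V p" and RL: "R \<subseteq> carrier (kalg {var_t, inverse var_t, var_y, inverse var_y})"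
    and t: "carrier (kalg {var_t}) \<subseteq> A" and y: "var_y \<in> R" "var_y \<notin> A"
  shows "\<exists>!c. var_t - const c \<in> p"
proof -
  interpret ext_max A R V p by (rule em)
  have yV: "var_y \<notin> V" using y unfolding A_eq by blast
  have embA: "emb c \<in> A" for c using emb_in_kalg t by blast
  have constA: "const c \<in> A" for c using kalg_gen(1) t by blast
  have "\<exists>c. var_t - const c \<in> p"
  proof (rule ccontr)
    assume no: "\<nexists>c. var_t - const c \<in> p"
    \<comment> \<open>Over an algebraically closed field a nonconstant \<open>c\<close> has a linear
      factor \<open>t - z\<close>, which is outside the prime \<open>p\<close> by
      assumption.\<close>
    have unit: "emb c \<notin> p" if "c \<noteq> 0" for c :: "'k poly"
      using that
    proof (induction "degree c" arbitrary: c rule: less_induct)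
      case less
      show ?case
      proof (cases "degree c = 0")
        case True
        then obtain a where "c = [:a:]" by (rule degree_eq_zeroE)
        then have "emb c = const a" "a \<noteq> 0" using less.prems unfolding const_def by auto
        then show ?thesis using const_not_in_val_ideal[OF V, of a] constA unfolding p_eq A_eq by auto
      next
        case False
        then obtain z where "poly c z = 0" using alg_closed_imp_poly_has_root[of c] by auto
        then obtain d where d: "c = [:- z, 1:] * d" unfolding poly_eq_0_iff_dvd by (elim dvdE)
        then have "d \<noteq> 0" using less.prems by auto
        moreover from this have "degree d < degree c" unfolding d by (subst degree_mult_eq) auto
        ultimately have "emb d \<notin> p" using less.hyps by blast
        then show ?thesis
          using no prime_setD(3)[OF p_prime embA embA, of "[:- z, 1:]" d] d emb_arith(3) emb_linear by metis
      qed
    qed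
    \<comment> \<open>The value \<open>1\<close> is taken because \<open>t ^ n\<close> does not
      vanish there.\<close>
    have s: "var_t - const 1 \<in> A" "var_t - const 1 \<notin> p"
      using no embA[of "[:- 1, 1:]"] unfolding emb_linear by auto
    obtain a r where ar: "a \<in> A" "r \<in> R" "var_y = a + (var_t - const 1) * r"
      using decompose_mod[OF s(1) y(1) _ y(1)] outside_p_cancel[OF s y(1)] y(2) by blast
    obtain n G where G: "(var_t * var_y) ^ n * r = to_fract G" using clear_denominators ar(2) RL by blast
    \<comment> \<open>With \<open>G\<close> the numerator of \<open>r\<close>, this is the numerator
      of \<open>a = y - (t - 1) r\<close> over the denominator \<open>(t y) ^ n\<close>.\<close>
    define F where "F = (monom [:0, 1:] 1) ^ n * monom 1 1 - smult [:- 1, 1:] G"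
    have ty: "to_fract (monom [:0, 1:] 1) = var_t * var_y" "to_fract (monom 1 1) = var_y"
      unfolding var_t_def var_y_def to_fract_mult[symmetric] by (simp_all add: monom_altdef)
    have pw: "to_fract (H ^ k) = to_fract H ^ k" for H :: "'k poly poly" and k
      by (induction k) auto
    have "to_fract F = (var_t * var_y) ^ n * var_y - (var_t - const 1) * to_fract G"
      unfolding F_def to_fract_diff to_fract_mult pw ty emb_linear[symmetric]
      by (simp flip: to_fract_mult)
    also have "\<dots> = (var_t * var_y) ^ n * a"
      unfolding G[symmetric] by (subst (2) ar(3)) (simp add: algebra_simps)
    finally have F: "to_fract F = (var_t * var_y) ^ n * a" .
    have "to_fract F * inverse var_y ^ n = var_t ^ n * a"
      unfolding F using yV V_closed(1) by (auto simp: power_mult_distrib field_simps)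
    moreover have "var_t ^ n * a \<in> A"
      using A_closed(5,7) ar(1) embA[of "[:0, 1:]"] unfolding var_t_def by blast
    ultimately have "to_fract F * inverse var_y ^ n \<in> V" unfolding A_eq by simp
    then have "degree F \<le> n"
    proof (rule degree_bound[OF V yV, rotated 2])
      show "emb (coeff F i) \<in> V" for i using embA A_eq by blast
      show "emb (lead_coeff F) \<notin> val_ideal V" if "F \<noteq> 0"
        using unit[of "lead_coeff F"] that embA unfolding p_eq by auto
    qed
    \<comment> \<open>The coefficient of \<open>y ^ Suc n\<close> reads
      \<open>t ^ n - (t - 1) * coeff G (Suc n)\<close>; its vanishing is contradicted by the value
      at \<open>t = 1\<close>.\<close>
    then have "coeff F (Suc n) = 0" by (simp add: coeff_eq_0)
    moreover have "monom [:0, 1::'k:] 1 ^ n * monom 1 1 = monom ([:0, 1:] ^ n) (Suc n)"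
      by (simp add: monom_power mult_monom)
    ultimately have "[:0, 1:] ^ n - [:- 1, 1:] * coeff G (Suc n) = 0" unfolding F_def by simp
    then have "poly ([:0, 1:] ^ n - [:- 1, 1:] * coeff G (Suc n)) 1 = 0" by simp
    then show False by simp
  qed
  moreover have "c = d" if "var_t - const c \<in> p" "var_t - const d \<in> p" for c d
  proof (rule ccontr)
    assume "c \<noteq> d"
    have "(var_t - const c) - (var_t - const d) \<in> p"
      using ideal_set_minus(2)[OF A(1) prime_setD(1)[OF p_prime]] that by blast
    moreover have "(var_t - const c) - (var_t - const d) = const (d - c)"
      unfolding const_def by (simp flip: to_fract_diff)
    ultimately show False
      using const_not_in_val_ideal[OF V, of "d - c"] \<open>c \<noteq> d\<close> constA unfolding p_eq A_eq by auto
  qed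
  ultimately show ?thesis by blast
qed

section \<open>The two bijections\<close>

text \<open>Cosets of the principal ideal agree exactly when the difference is a multiple of
  \<open>d\<close>; this turns the surjectivity clause of \<open>\<N>\<close> into decompositions of
  elements.\<close>

lemma quotient_surjective_iff:
  assumes R: "subring_set R" and A: "A \<subseteq> R" and d: "d \<in> R"
  shows "(\<lambda>a. (PIdl\<^bsub>set_ring R\<^esub> d) +>\<^bsub>set_ring R\<^esub> a) ` A = carrier (set_ring R Quot (PIdl\<^bsub>set_ring R\<^esub> d))
    \<longleftrightarrow> (\<forall>x\<in>R. \<exists>a\<in>A. \<exists>r\<in>R. x = a + d * r)"
proof -
  note R' = subring_setD[OF R]
  have I: "(PIdl\<^bsub>set_ring R\<^esub> d) +>\<^bsub>set_ring R\<^esub> a = {d * r + a |r. r \<in> R}" for a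
    unfolding a_r_coset_def' cgenideal_def by (auto simp: mult.commute)
  have Q: "carrier (set_ring R Quot (PIdl\<^bsub>set_ring R\<^esub> d)) = (\<lambda>a. {d * r + a |r. r \<in> R}) ` R"
    unfolding FactRing_def A_RCOSETS_def' I by auto
  have eq: "{d * r + x |r. r \<in> R} = {d * r + a |r. r \<in> R} \<longleftrightarrow> (\<exists>r\<in>R. x = a + d * r)"
    (is "?X = ?A \<longleftrightarrow> _") for x a
  proof
    assume "?X = ?A"
    moreover have "x = d * 0 + x" by simp
    then have "x \<in> ?X" using R'(1) by blast
    ultimately show "\<exists>r\<in>R. x = a + d * r" by (auto simp: add.commute)
  next
    assume "\<exists>r\<in>R. x = a + d * r"
    then obtain r where r: "r \<in> R" "x = a + d * r" by blast
    show "?X = ?A"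
    proof
      show "?X \<subseteq> ?A"
      proof
        fix z assume "z \<in> ?X"
        then obtain s where s: "s \<in> R" "z = d * s + x" by blast
        then have "z = d * (s + r) + a" using r(2) by (simp add: algebra_simps)
        then show "z \<in> ?A" using R'(3)[OF s(1) r(1)] by blast
      qed
      show "?A \<subseteq> ?X"
      proof
        fix z assume "z \<in> ?A"
        then obtain s where s: "s \<in> R" "z = d * s + a" by blast
        then have "z = d * (s - r) + x" using r(2) by (simp add: algebra_simps)
        then show "z \<in> ?X" using R'(4)[OF s(1) r(1)] by blast
      qed
    qed
  qed
  have "(\<lambda>a. {d * r + a |r. r \<in> R}) ` A = (\<lambda>a. {d * r + a |r. r \<in> R}) ` R \<longleftrightarrow>
      (\<forall>x\<in>R. \<exists>a\<in>A. {d * r + x |r. r \<in> R} = {d * r + a |r. r \<in> R})"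
    using A by (auto 0 3 simp: image_iff set_eq_iff subset_iff simp del: mem_Collect_eq)
  then show ?thesis unfolding I Q eq .
qed

abbreviation poly_ty :: "'k::field poly poly fract set" where
  "poly_ty \<equiv> carrier (kalg {var_t, var_y})"

lemma M_iff:
  "B \<in> \<M> \<longleftrightarrow> carrier (kalg {var_t}) \<subseteq> B \<and>
    (\<exists>V. ext_max B poly_ty V (crucial_ideal B (kalg {var_t, var_y})))"
proof -
  have "range const \<subseteq> B" if "carrier (kalg {var_t}) \<subseteq> B" using that kalg_gen(1) by blast
  then show ?thesis unfolding \<M>_def using ext_max_subalgebras_iff by blast
qed

lemma N_iff:
  "A \<in> \<N> \<longleftrightarrow> carrier (kalg {var_t, inverse var_y}) \<subseteq> A \<and>
    (\<exists>V. ext_max A (carrier laurent_y) V (crucial_ideal A laurent_y)) \<and>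
    (\<forall>x\<in>carrier laurent_y. \<exists>a\<in>A. \<exists>r\<in>carrier laurent_y. x = a + (var_t - const (crucial_value A)) * r)"
proof -
  let ?L = "carrier laurent_y"
  have ext: "A \<in> ext_max_subalgebras laurent_y \<longleftrightarrow> (\<exists>V. ext_max A ?L V (crucial_ideal A laurent_y))"
    if "carrier (kalg {var_t, inverse var_y}) \<subseteq> A"
  proof (rule ext_max_subalgebras_iff)
    show "range const \<subseteq> A" using that kalg_gen(1) by blast
  qed
  let ?d = "var_t - const (crucial_value A)"
  have d: "?d \<in> ?L"
    by (rule subring_setD(4)[OF subring_kalg kalg_gen(2) kalg_gen(1)]) simp
  show ?thesis
  proof (cases "carrier (kalg {var_t, inverse var_y}) \<subseteq> A \<and> A \<in> ext_max_subalgebras laurent_y")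
    case True
    then obtain V where "ext_max A ?L V (crucial_ideal A laurent_y)" using ext by blast
    then have "A \<subseteq> ?L" by (rule ext_max.A)
    from quotient_surjective_iff[OF subring_kalg this d]
    have "(\<lambda>a. (PIdl\<^bsub>laurent_y\<^esub> ?d) +>\<^bsub>laurent_y\<^esub> a) ` A = carrier (laurent_y Quot (PIdl\<^bsub>laurent_y\<^esub> ?d))
      \<longleftrightarrow> (\<forall>x\<in>?L. \<exists>a\<in>A. \<exists>r\<in>?L. x = a + ?d * r)"
      unfolding kalg_set_ring[symmetric] .
    then show ?thesis unfolding \<N>_def Let_def mem_Collect_eq using True ext by blast
  next
    case False
    then show ?thesis unfolding \<N>_def mem_Collect_eq using ext by blast
  qed
qed

section \<open>Generators, denominators and principal parts; passage to a larger ring\<close>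

lemma poly_ty_least:
  assumes "subring_set T" "carrier (kalg {var_t}) \<subseteq> T" "var_y \<in> T"
  shows "poly_ty \<subseteq> T"
proof (rule kalg_least[OF assms(1)])
  show "range const \<subseteq> T" "{var_t, var_y} \<subseteq> T"
    using assms(2,3) kalg_gen by blast+
qed

lemma var_nonzero: "var_t \<noteq> 0" "var_y \<noteq> 0"
  unfolding var_t_def var_y_def by auto

lemma powers_mult: "s \<in> range ((^) z) \<Longrightarrow> t \<in> range ((^) z) \<Longrightarrow> s * t \<in> range ((^) (z :: 'a::comm_ring_1))"
  by (auto simp flip: power_add)

lemma clear_powers:
  fixes z :: "'k::field poly poly fract"
  assumes z: "z \<in> poly_ty" "z \<noteq> 0" and x: "x \<in> carrier (kalg {var_t, var_y, inverse z})"
  shows "\<exists>n. z ^ n * x \<in> poly_ty"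
proof -
  have 1: "1 \<in> range ((^) z)" using rangeI[of "(^) z" 0] by simp
  have "carrier (kalg {var_t, var_y, inverse z}) \<subseteq> {x. \<exists>s\<in>range ((^) z). s * x \<in> poly_ty}"
  proof (rule kalg_least)
    show "subring_set {x. \<exists>s\<in>range ((^) z). s * x \<in> poly_ty}"
      by (rule subring_fractions[OF subring_kalg _ 1 powers_mult]) (use subring_setD(7)[OF subring_kalg z(1)] in auto)
    show "range const \<subseteq> {x. \<exists>s\<in>range ((^) z). s * x \<in> poly_ty}"
      using fractions_base[OF 1 kalg_gen(1)] by blast
    have "z ^ 1 * inverse z = 1" using right_inverse[OF z(2)] by simp
    then have "z ^ 1 * inverse z \<in> poly_ty" using subring_setD(2)[OF subring_kalg] by metis
    moreover have "var_t \<in> poly_ty" "var_y \<in> poly_ty" using kalg_gen(2) by blast+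
    ultimately show "{var_t, var_y, inverse z} \<subseteq> {x. \<exists>s\<in>range ((^) z). s * x \<in> poly_ty}"
      using fractions_base[OF 1, of _ poly_ty] by blast
  qed
  then show ?thesis using x by blast
qed

text \<open>Separation of the principal part at \<open>y = 0\<close>, by induction on the pole
  order: if \<open>c\<close> is the constant coefficient in \<open>y\<close> of the numerator,
  subtracting \<open>c / y ^ Suc n\<close> lowers the order by one.\<close>

lemma laurent_decomposition:
  assumes "x \<in> carrier laurent_y"
  shows "\<exists>f\<in>poly_ty. x - f \<in> carrier (kalg {var_t, inverse var_y})"
proof -
  let ?N = "carrier (kalg {var_t, inverse var_y})"
  have N: "emb c * inverse var_y ^ k \<in> ?N" for c k
    using subring_setD(5,7)[OF subring_kalg] emb_in_kalg kalg_gen(2) by (metis insertI1 insertI2)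
  have "\<exists>f\<in>poly_ty. x - f \<in> ?N" if "var_y ^ n * x = to_fract F" for n F x
    using that
  proof (induction n arbitrary: x F)
    case 0
    then have "x \<in> poly_ty" unfolding carrier_kalg_poly by simp
    moreover have "x - x \<in> ?N" using subring_setD(1)[OF subring_kalg] by simp
    ultimately show ?case by blast
  next
    case (Suc n)
    obtain c G where F: "F = pCons c G" by (cases F)
    let ?e = "emb c * inverse var_y ^ Suc n"
    have inv: "var_y * inverse var_y = 1" by (rule right_inverse[OF var_nonzero(2)])
    have pinv: "var_y ^ Suc n * inverse var_y ^ Suc n = 1"
      by (metis power_mult_distrib power_one inv)
    have "var_y ^ Suc n * (x - ?e) = var_y ^ Suc n * x - emb c * (var_y ^ Suc n * inverse var_y ^ Suc n)"
      by (simp only: right_diff_distrib mult.left_commute)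
    also have "\<dots> = var_y * to_fract G"
      unfolding Suc.prems F to_fract_pCons[of c G] pinv by simp
    finally have "var_y * (var_y ^ n * (x - ?e)) = var_y * to_fract G" by (simp only: power_Suc mult.assoc)
    then have "var_y ^ n * (x - ?e) = to_fract G" using var_nonzero(2) by (metis mult_left_cancel)
    then obtain f where f: "f \<in> poly_ty" "x - ?e - f \<in> ?N" using Suc.IH by blast
    have "x - f = (x - ?e - f) + ?e" by simp
    then have "x - f \<in> ?N" using subring_setD(3)[OF subring_kalg f(2) N] by metis
    then show ?case using f(1) by blast
  qed
  moreover have "\<exists>n. var_y ^ n * x \<in> poly_ty"
    using clear_powers[of var_y x] assms kalg_gen(2) var_nonzero(2) by blast
  ultimately show ?thesis unfolding carrier_kalg_poly by blast
qed

text \<open>A ring \<open>T\<close> strictly above \<open>V \<inter> R\<close> contains some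
  \<open>f\<close> outside \<open>V\<close>, and \<open>pole\<close> turns it into an element of
  \<open>T \<inter> P\<close> outside \<open>V\<close>. Maximality of \<open>B\<close> then forces
  \<open>P\<close> into \<open>T\<close>, and \<open>gen\<close> gives \<open>T = R\<close>. The
  hypotheses \<open>gen\<close> and \<open>pole\<close> isolate what depends on the particular
  Laurent ring.\<close>

lemma ascend:
  assumes B: "ext_max B P V p" and R: "subring_set R" "P \<subseteq> R"
    and gen: "\<And>T. subring_set T \<Longrightarrow> V \<inter> R \<subseteq> T \<Longrightarrow> T \<subseteq> R \<Longrightarrow> P \<subseteq> T \<Longrightarrow> T = R"
    and pole: "\<And>T f. subring_set T \<Longrightarrow> V \<inter> R \<subseteq> T \<Longrightarrow> T \<subseteq> R \<Longrightarrow> f \<in> T \<Longrightarrow> f \<notin> V \<Longrightarrow> \<exists>g\<in>T \<inter> P. g \<notin> V"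
  shows "ext_max (V \<inter> R) R V (val_ideal V \<inter> (V \<inter> R))" "V \<inter> R \<inter> P = B"
proof -
  interpret B: ext_max B P V p by (rule B)
  show BP: "V \<inter> R \<inter> P = B" unfolding B.A_eq using R(2) by blast
  have VR: "subring_set (V \<inter> R)" by (rule subring_set_Int[OF B.V_subring R(1)])
  obtain q r where q: "q \<in> p" "r \<in> P" "q * r \<notin> B" using B.not_conductor by blast
  have qr: "q * r \<in> P" using q B.p_ideal(1) B.A(2) B.R_closed(5) by blast
  then have "q * r \<notin> V \<inter> R" using q(3) unfolding B.A_eq by blast
  moreover have "q \<in> val_ideal V \<inter> (V \<inter> R)" using q(1) R(2) unfolding B.p_eq B.A_eq by blast
  moreover have "max_subring_set (V \<inter> R) R"
    unfolding max_subring_set_def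
  proof (intro conjI allI impI)
    show "subring_set (V \<inter> R)" "V \<inter> R \<subseteq> R" using VR by auto
    show "V \<inter> R \<noteq> R" using qr \<open>q * r \<notin> V \<inter> R\<close> R(2) by blast
    fix T assume T: "subring_set T \<and> V \<inter> R \<subseteq> T \<and> T \<subseteq> R"
    show "T = V \<inter> R \<or> T = R"
    proof (rule disjCI)
      assume "T \<noteq> R"
      show "T = V \<inter> R"
      proof (rule ccontr)
        assume "T \<noteq> V \<inter> R"
        then obtain f where "f \<in> T" "f \<notin> V" using T by blast
        then obtain g where g: "g \<in> T" "g \<in> P" "g \<notin> V" using pole[of T f] T by blast
        have "subring_set (T \<inter> P)" using subring_set_Int T B.R by blast
        moreover have "B \<subseteq> T \<inter> P" using T BP by blast
        moreover have "T \<inter> P \<noteq> B" using g B.A_eq by blast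
        ultimately have "T \<inter> P = P" using B.maxD[of "T \<inter> P"] by blast
        then show False using gen[of T] T \<open>T \<noteq> R\<close> by blast
      qed
    qed
  qed
  ultimately show "ext_max (V \<inter> R) R V (val_ideal V \<inter> (V \<inter> R))"
    unfolding ext_max_def using R B.V q(2) by blast
qed

section \<open>The map \<open>Theta\<close> on subalgebras of \<open>k[t, y, 1/y]\<close>\<close>

lemma y_not_in_proper:
  assumes "ext_max A (carrier (kalg (insert var_y S))) V p" "carrier (kalg S) \<subseteq> A"
  shows "var_y \<notin> A"
proof
  interpret ext_max A "carrier (kalg (insert var_y S))" V p by (rule assms)
  assume "var_y \<in> A"
  then have "carrier (kalg (insert var_y S)) \<subseteq> A"
    using assms(2) kalg_gen by (intro kalg_least[OF A(1)]) blast+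
  then show False using A(2,3) by blast
qed

lemma inverse_y_in_crucial:
  assumes "ext_max A R V p" "var_y \<in> R" "var_y \<notin> A" "inverse var_y \<in> A"
  shows "inverse var_y \<in> p"
  using assms inverse_in_val_ideal[of var_y V] unfolding ext_max_def by blast

text \<open>The principal part of an element lies in \<open>k[t, 1/y]\<close>, hence in
  \<open>A\<close>, so membership in \<open>A\<close> is decided by the polynomial part. This makes
  \<open>Theta\<close> injective.\<close>

lemma Theta_decomposition:
  assumes "A \<subseteq> carrier laurent_y" "subring_set A" "carrier (kalg {var_t, inverse var_y}) \<subseteq> A"
  shows "A = {x \<in> carrier laurent_y. \<exists>f\<in>A \<inter> poly_ty. x - f \<in> carrier (kalg {var_t, inverse var_y})}"
proof
  note A' = subring_setD[OF assms(2)]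
  show "A \<subseteq> {x \<in> carrier laurent_y. \<exists>f\<in>A \<inter> poly_ty. x - f \<in> carrier (kalg {var_t, inverse var_y})}"
  proof
    fix x assume x: "x \<in> A"
    then obtain f where f: "f \<in> poly_ty" "x - f \<in> carrier (kalg {var_t, inverse var_y})"
      using laurent_decomposition assms(1) by blast
    have "f = x - (x - f)" by simp
    then have "f \<in> A" using A'(4)[OF x, of "x - f"] f(2) assms(3) by auto
    then show "x \<in> {x \<in> carrier laurent_y. \<exists>f\<in>A \<inter> poly_ty. x - f \<in> carrier (kalg {var_t, inverse var_y})}"
      using f x assms(1) by blast
  qed
  show "{x \<in> carrier laurent_y. \<exists>f\<in>A \<inter> poly_ty. x - f \<in> carrier (kalg {var_t, inverse var_y})} \<subseteq> A"
  proof
    fix x assume "x \<in> {x \<in> carrier laurent_y. \<exists>f\<in>A \<inter> poly_ty. x - f \<in> carrier (kalg {var_t, inverse var_y})}"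
    then obtain f where "f \<in> A" "x - f \<in> A" using assms(3) by blast
    then have "(x - f) + f \<in> A" using A'(3) by blast
    then show "x \<in> A" by simp
  qed
qed

text \<open>Both hypotheses of \<open>descend\<close> reduce to the single element
  \<open>1 / y\<close>. Its residue is \<open>0\<close> because \<open>y\<close> has a pole; its
  denominator is extracted from the decomposition of \<open>y\<close> modulo
  \<open>t - c\<close>.\<close>

lemma Theta_well_defined:
  fixes A V p :: "'k::alg_closed_field poly poly fract set"
  assumes em: "ext_max A (carrier laurent_y) V p"
    and N: "carrier (kalg {var_t, inverse var_y}) \<subseteq> A"
    and c: "var_t - const c \<in> p"
    and surj: "\<exists>a\<in>A. \<exists>r\<in>carrier laurent_y. var_y = a + (var_t - const c) * r"
  shows "ext_max (A \<inter> poly_ty) poly_ty V (p \<inter> poly_ty)"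
proof -
  interpret ext_max A "carrier laurent_y" V p by (rule em)
  have PL: "poly_ty \<subseteq> carrier laurent_y" by (rule kalg_mono) auto
  note P' = subring_setD[OF subring_kalg]
  have yP: "var_y \<in> poly_ty" using kalg_gen(2) by blast
  have yA: "var_y \<notin> A"
    by (rule y_not_in_proper[OF _ N]) (use em in \<open>simp add: insert_commute\<close>)
  have yV: "var_y \<notin> V" using yA yP PL unfolding A_eq by blast
  have iyA: "inverse var_y \<in> A" using N kalg_gen(2) by blast
  have iyp: "inverse var_y \<in> p" using inverse_y_in_crucial[OF em _ yA iyA] yP PL by blast
  have tA: "var_t \<in> A" and cA: "const d \<in> A" for d using N kalg_gen by blast+
  have tP: "var_t \<in> poly_ty" using kalg_gen(2) by blast
  have B: "subring_set (A \<inter> poly_ty)" by (rule subring_set_Int[OF A(1) subring_kalg])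
  have constB: "range const \<subseteq> A \<inter> poly_ty" using cA kalg_gen(1) by blast
  \<comment> \<open>By the splitting off of principal parts, \<open>A\<close> is generated by its
    polynomial part and \<open>1 / y\<close>.\<close>
  have A_least: "A \<subseteq> T" if T: "subring_set T" "A \<inter> poly_ty \<subseteq> T" "inverse var_y \<in> T" for T
  proof -
    have "carrier (kalg {var_t, inverse var_y}) \<subseteq> T"
      using T constB tA tP by (intro kalg_least) auto
    then have "x \<in> T" if x: "x \<in> A" for x
    proof -
      obtain f where "f \<in> T" "x - f \<in> T"
        using x Theta_decomposition[OF A(2,1) N] T(2) \<open>carrier (kalg {var_t, inverse var_y}) \<subseteq> T\<close> by blast
      then have "(x - f) + f \<in> T" using subring_setD(3)[OF T(1)] by blast
      then show ?thesis by simp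
    qed
    then show ?thesis by blast
  qed
  show ?thesis
  proof (rule descend[OF subring_kalg PL _ _ yP yA])
    let ?T = "{x \<in> A. \<exists>b\<in>A \<inter> poly_ty. x - b \<in> p}"
    have "A \<subseteq> ?T"
    proof (rule A_least)
      show "subring_set ?T" using subring_congruent[OF A(1) B _ prime_setD(1)[OF p_prime]] by blast
      show "A \<inter> poly_ty \<subseteq> ?T"
      proof
        fix x assume "x \<in> A \<inter> poly_ty"
        moreover have "x - x \<in> p" using p_ideal(2) by simp
        ultimately show "x \<in> ?T" by blast
      qed
      have "inverse var_y - 0 \<in> p" using iyp by simp
      then show "inverse var_y \<in> ?T" using iyA subring_setD(1)[OF B] by blast
    qed
    then show "\<exists>b\<in>A \<inter> poly_ty. a - b \<in> p" if "a \<in> A" for a using that by blast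
  next
    obtain a0 r where ar: "a0 \<in> A" "r \<in> carrier laurent_y" "var_y = a0 + (var_t - const c) * r"
      using surj by blast
    obtain f where f: "f \<in> poly_ty" "r - f \<in> carrier (kalg {var_t, inverse var_y})"
      using laurent_decomposition[OF ar(2)] by blast
    define s where "s = var_t - const c"
    have sp: "s \<in> p" using c unfolding s_def .
    \<comment> \<open>The principal part of \<open>r\<close> lies in \<open>A\<close> and is
      absorbed here, so that \<open>y = b + s * f\<close> with a polynomial
      \<open>f\<close>.\<close>
    define b where "b = a0 + s * (r - f)"
    have bA: "b \<in> A" unfolding b_def using A_closed(3,5) ar(1) f(2) N sp p_ideal(1) by (meson subsetD)
    obtain G where G: "f = to_fract G" using f(1) unfolding carrier_kalg_poly by blast
    obtain g q where gq: "map_poly emb G = pCons g q" by (cases "map_poly emb G")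
    have "emb d \<in> A \<inter> poly_ty" for d
      using emb_in_kalg N by blast
    then have "range (coeff (map_poly emb G)) \<subseteq> A \<inter> poly_ty" by (auto simp: coeff_map_poly)
    then have g: "g \<in> A \<inter> poly_ty" "range (coeff q) \<subseteq> A \<inter> poly_ty"
      unfolding gq by (simp_all add: range_coeff_pCons)
    have "var_y = b + s * f" unfolding b_def using ar(3) unfolding s_def by (simp add: algebra_simps)
    also have "f = poly (pCons g q) var_y" using to_fract_eq_poly[of G] G gq by simp
    \<comment> \<open>Reading \<open>f\<close> as a polynomial in \<open>y\<close> over
      \<open>k[t]\<close> gives a relation for \<open>y\<close> whose nonconstant coefficients are
      multiples of \<open>s\<close> in \<open>k[t, y]\<close>, as
      \<open>valuation_denominator\<close> requires.\<close>
    finally have "var_y = poly (pCons (b + s * g) (smult s q)) var_y" by (simp add: algebra_simps)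
    moreover have "b + s * g \<in> V"
      using A_closed(3)[OF bA A_closed(5)] sp p_ideal(1) g(1) A_eq by blast
    moreover have "range (coeff (smult s q)) \<subseteq> val_ideal V \<inter> poly_ty"
    proof -
      have "s \<in> poly_ty" unfolding s_def by (rule P'(4)[OF tP kalg_gen(1)])
      then have "s * coeff q i \<in> val_ideal V \<inter> poly_ty" for i
        using g(2) sp Vv(5) P'(5) A_eq p_eq by blast
      then show ?thesis by auto
    qed
    ultimately obtain h where h: "h \<in> val_ideal V \<inter> poly_ty" "h * var_y \<in> V - val_ideal V"
      using valuation_denominator[OF subring_kalg V yP yV] by blast
    have hyP: "h * var_y \<in> poly_ty" using h(1) yP P'(5) by blast
    let ?S = "A \<inter> poly_ty - p"
    let ?T = "{x. \<exists>s\<in>?S. s * x \<in> A \<inter> poly_ty}"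
    have one: "1 \<in> ?S" using subring_setD(2)[OF B] prime_setD(2)[OF p_prime] by blast
    have "A \<subseteq> ?T"
    proof (rule A_least)
      show "subring_set ?T"
      proof (rule subring_fractions[OF B _ one])
        show "s * t \<in> ?S" if "s \<in> ?S" "t \<in> ?S" for s t
          using that prime_complement_mult[OF A(1) p_prime] subring_setD(5)[OF B] by blast
      qed blast
      show "A \<inter> poly_ty \<subseteq> ?T" using fractions_base[OF one] by blast
      \<comment> \<open>This is the fraction \<open>1 / y = h / (h * y)\<close> over
        \<open>A \<inter> k[t, y]\<close>, with denominator outside \<open>p\<close>.\<close>
      have "h * var_y \<in> ?S" using h(2) hyP PL unfolding A_eq p_eq by blast
      moreover have "(h * var_y) * inverse var_y = h"
        using var_nonzero(2) by (metis mult.assoc mult.right_neutral right_inverse)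
      moreover have "h \<in> A \<inter> poly_ty" using h(1) Vv(1) PL unfolding A_eq by blast
      ultimately show "inverse var_y \<in> ?T" by (metis (mono_tags, lifting) mem_Collect_eq)
    qed
    then show "\<exists>s\<in>?S. s * a \<in> A \<inter> poly_ty" if "a \<in> A" for a using that by blast
  next
    fix T assume T: "subring_set T" "A \<inter> poly_ty \<subseteq> T" "T \<subseteq> poly_ty" "var_y \<in> T"
    have "carrier (kalg {var_t}) \<subseteq> A \<inter> poly_ty" using constB tA tP by (intro kalg_least[OF B]) auto
    then show "T = poly_ty" using poly_ty_least[OF T(1) _ T(4)] T(2,3) by blast
  qed
qed

text \<open>The factor theorem applied to each coefficient: \<open>F0\<close> arises from
  \<open>F\<close> by setting \<open>t = c\<close>, and degree \<open>0\<close> says that its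
  coefficients are constants.\<close>

lemma reduce_coefficients:
  fixes F :: "'k::field poly poly"
  shows "\<exists>F0 G. F = F0 + smult [:- c, 1:] G \<and> (\<forall>i. degree (coeff F0 i) = 0)"
proof (induction F)
  case 0
  then show ?case by (intro exI[of _ 0]) simp
next
  case (pCons d F)
  then obtain F0 G where F: "F = F0 + smult [:- c, 1:] G" "\<And>i. degree (coeff F0 i) = 0" by blast
  have "poly (d - [:poly d c:]) c = 0" by simp
  then obtain e where "d - [:poly d c:] = [:- c, 1:] * e" unfolding poly_eq_0_iff_dvd by (elim dvdE)
  then have "d = [:poly d c:] + [:- c, 1:] * e" by (simp add: algebra_simps)
  then have "pCons d F = pCons [:poly d c:] F0 + smult [:- c, 1:] (pCons e G)" using F(1) by simp
  moreover have "degree (coeff (pCons [:poly d c:] F0) i) = 0" for i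
    using F(2) by (cases i) auto
  ultimately show ?case by blast
qed

text \<open>The valuation ring of \<open>B\<close> also defines the preimage,
  \<open>V \<inter> k[t, y, 1/y]\<close>. Beyond \<open>ascend\<close>, the surjectivity clause of
  \<open>\<N>\<close> has to be verified, and this uses that \<open>B\<close> is extending.\<close>

lemma Theta_onto:
  fixes B V p :: "'k::alg_closed_field poly poly fract set"
  assumes em: "ext_max B poly_ty V p" and K: "carrier (kalg {var_t}) \<subseteq> B"
  shows "V \<inter> carrier laurent_y \<in> \<N>" "V \<inter> carrier laurent_y \<inter> poly_ty = B"
proof -
  interpret B: ext_max B poly_ty V p by (rule em)
  let ?L = "carrier laurent_y"
  let ?A = "V \<inter> ?L"
  have PL: "poly_ty \<subseteq> ?L" by (rule kalg_mono) auto
  have yP: "var_y \<in> poly_ty" using kalg_gen(2) by blast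
  have yB: "var_y \<notin> B"
    by (rule y_not_in_proper[OF _ K]) (use em in \<open>simp add: insert_commute\<close>)
  have yV: "var_y \<notin> V" using yB yP unfolding B.A_eq by blast
  have constV: "range const \<subseteq> V" and tB: "var_t \<in> B" and tV: "var_t \<in> V"
    using K kalg_gen B.A_eq by blast+
  have iyV: "inverse var_y \<in> V" using inverse_in_val_ideal[OF yV] B.Vv(1) by blast
  have N: "carrier (kalg {var_t, inverse var_y}) \<subseteq> ?A"
  proof -
    have "carrier (kalg {var_t, inverse var_y}) \<subseteq> V"
      using constV tV iyV by (intro kalg_least[OF B.V_subring]) auto
    moreover have "carrier (kalg {var_t, inverse var_y}) \<subseteq> ?L" by (rule kalg_mono) auto
    ultimately show ?thesis by blast
  qed
  have gen: "T = ?L" if T: "subring_set T" "?A \<subseteq> T" "T \<subseteq> ?L" "poly_ty \<subseteq> T" for T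
  proof -
    have "?L \<subseteq> T"
      using T(4) yP kalg_gen N T(2) by (intro kalg_least[OF T(1)]) blast+
    then show "T = ?L" using T(3) by blast
  qed
  \<comment> \<open>The principal part of \<open>f\<close> belongs to \<open>V\<close> and to
    \<open>T\<close>; removing it leaves a polynomial that is still outside
    \<open>V\<close>.\<close>
  have pole: "\<exists>g\<in>T \<inter> poly_ty. g \<notin> V"
    if T: "subring_set T" "?A \<subseteq> T" "T \<subseteq> ?L" and f: "f \<in> T" "f \<notin> V" for T f
  proof -
    obtain g where g: "g \<in> poly_ty" "f - g \<in> carrier (kalg {var_t, inverse var_y})"
      using laurent_decomposition f(1) T(3) by blast
    have fg: "f - g \<in> ?A" using g(2) N by blast
    have "f - (f - g) \<in> T" using subring_setD(4)[OF T(1) f(1)] fg T(2) by blast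
    then have "g \<in> T" by simp
    moreover have "g \<notin> V"
    proof
      assume "g \<in> V"
      then have "(f - g) + g \<in> V" using fg B.V_closed(3) by blast
      then show False using f(2) by simp
    qed
    ultimately show "\<exists>g\<in>T \<inter> poly_ty. g \<notin> V" using g(1) by blast
  qed
  note asc = ascend[OF em subring_kalg PL gen pole]
  have emA: "ext_max ?A ?L V (val_ideal V \<inter> ?A)" by (rule asc(1))
  show AB: "?A \<inter> poly_ty = B" by (rule asc(2))
  interpret A: ext_max ?A ?L V "val_ideal V \<inter> ?A" by (rule emA)
  have crucial: "crucial_ideal ?A laurent_y = val_ideal V \<inter> ?A" by (rule crucial_ideal_kalg[OF emA])
  have yL: "var_y \<in> ?L" using yP PL by blast
  have yA: "var_y \<notin> ?A" using yV by blast
  have KA: "carrier (kalg {var_t}) \<subseteq> ?A" using K AB by blast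
  have "?L \<subseteq> carrier (kalg {var_t, inverse var_t, var_y, inverse var_y})" by (rule kalg_mono) auto
  then have ex1: "\<exists>!c. var_t - const c \<in> val_ideal V \<inter> ?A"
    using crucial_value_exists[OF emA _ KA yL yA] by blast
  define c where "c = crucial_value ?A"
  have c: "var_t - const c \<in> val_ideal V \<inter> ?A"
    unfolding c_def crucial_value_def crucial by (rule theI'[OF ex1])
  define s where "s = var_t - const c"
  have sB: "s \<in> B" unfolding s_def by (rule B.A_closed(4)[OF tB]) (use K kalg_gen(1) in blast)
  have sp: "s \<in> p" using c sB unfolding s_def B.p_eq by blast
  \<comment> \<open>One such \<open>r\<close> suffices for \<open>decompose_mod\<close>. If there
    were none, \<open>s * k[t, y]\<close> would lie in \<open>B\<close>; every element of
    \<open>p\<close> would then be a multiple of \<open>s\<close> in \<open>k[t, y]\<close>, and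
    \<open>p * k[t, y]\<close> would lie in \<open>B\<close>, against
    \<open>not_conductor\<close>.\<close>
  have "\<exists>r\<in>?L. s * r \<notin> ?A"
  proof (rule ccontr)
    assume "\<not> (\<exists>r\<in>?L. s * r \<notin> ?A)"
    then have sP: "s * r \<in> B" if "r \<in> poly_ty" for r
      using that PL AB B.A(2) sB B.R_closed(5) by blast
    have p_sub: "\<exists>g\<in>poly_ty. f = s * g" if f: "f \<in> p" for f
    proof -
      obtain F where F: "f = to_fract F" using f B.p_ideal(1) B.A(2) unfolding carrier_kalg_poly by blast
      obtain F0 G where G: "F = F0 + smult [:- c, 1:] G" "\<And>i. degree (coeff F0 i) = 0"
        using reduce_coefficients by blast
      define g where "g = to_fract G"
      have gP: "g \<in> poly_ty" unfolding g_def carrier_kalg_poly by blast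
      have "to_fract (smult [:- c, 1:] G) = emb [:- c, 1:] * g"
        unfolding g_def to_fract_mult[symmetric] by simp
      then have fF: "f = to_fract F0 + s * g" unfolding F G(1) s_def by (simp only: to_fract_add emb_linear)
      \<comment> \<open>The element \<open>s * g\<close> is only known to be in \<open>B\<close>;
        its square is \<open>s\<close> times an element of \<open>B\<close> and therefore in
        \<open>p\<close>.\<close>
      have "(s * g) ^ 2 = s * (s * (g * g))" by (simp only: power2_eq_square mult_ac)
      moreover have "s * (s * (g * g)) \<in> p"
        using B.p_ideal(5)[OF sp sP] gP B.R_closed(5) by blast
      ultimately have sgp: "s * g \<in> p"
        using prime_set_power[OF B.A(1) B.p_prime sP[OF gP]] by metis
      have F0p: "to_fract F0 \<in> p"
        using ideal_set_minus(2)[OF B.A(1) prime_setD(1)[OF B.p_prime] f sgp] fF by simp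
      have cf: "emb (coeff F0 i) = const (coeff (coeff F0 i) 0)" for i
        using degree_eq_zeroE[OF G(2)[of i]] unfolding const_def by (metis coeff_pCons_0)
      \<comment> \<open>A polynomial in \<open>y\<close> with constant coefficients that lies in
        \<open>V\<close> is constant, because \<open>y\<close> is not in \<open>V\<close>; lying in
        \<open>p\<close>, it is then zero.\<close>
      have "degree F0 \<le> 0"
      proof (rule degree_bound[OF B.V yV])
        show "emb (coeff F0 i) \<in> V" for i unfolding cf using constV by blast
        show "emb (lead_coeff F0) \<notin> val_ideal V" if "F0 \<noteq> 0"
        proof -
          have "coeff (lead_coeff F0) 0 \<noteq> 0"
            using that degree_eq_zeroE[OF G(2)[of "degree F0"]] by (metis coeff_pCons_0 leading_coeff_0_iff pCons_0_0)
          then show ?thesis unfolding cf by (rule const_not_in_val_ideal[OF B.V constV])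
        qed
        show "to_fract F0 * inverse var_y ^ 0 \<in> V" using F0p unfolding B.p_eq B.A_eq by simp
      qed
      then obtain d where d: "F0 = [:d:]" using degree_eq_zeroE by auto
      have "emb d = const (coeff d 0)" using cf[of 0] unfolding d by simp
      then have "coeff d 0 = 0"
        using const_not_in_val_ideal[OF B.V constV] F0p unfolding d B.p_eq by auto
      then have "to_fract F0 = 0" using \<open>emb d = const (coeff d 0)\<close> unfolding d const_def by simp
      then show ?thesis using fF gP by auto
    qed
    obtain q r where qr: "q \<in> p" "r \<in> poly_ty" "q * r \<notin> B" using B.not_conductor by blast
    then obtain g where g: "g \<in> poly_ty" "q = s * g" using p_sub by blast
    then have "q * r = s * (g * r)" by (simp add: mult.assoc)
    then show False using qr(3) sP[of "g * r"] B.R_closed(5) g(1) qr(2) by metis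
  qed
  then obtain r0 where r0: "r0 \<in> ?L" "s * r0 \<notin> ?A" by blast
  have "s \<in> ?A" using c unfolding s_def by blast
  then have "\<exists>a\<in>?A. \<exists>r\<in>?L. x = a + s * r" if "x \<in> ?L" for x
    using A.decompose_mod[OF _ r0 that] by blast
  then show "?A \<in> \<N>"
    unfolding N_iff using N emA crucial unfolding s_def c_def by auto
qed

lemma N_ext_max:
  fixes A :: "'k::alg_closed_field poly poly fract set"
  assumes "A \<in> \<N>"
  obtains V where "ext_max A (carrier laurent_y) V (crucial_ideal A laurent_y)"
    "carrier (kalg {var_t, inverse var_y}) \<subseteq> A"
    "ext_max (A \<inter> poly_ty) poly_ty V (crucial_ideal A laurent_y \<inter> poly_ty)"
proof -
  let ?L = "carrier laurent_y"
  let ?p = "crucial_ideal A laurent_y"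
  note N = conjunct1[OF assms[unfolded N_iff]] and rest = conjunct2[OF assms[unfolded N_iff]]
  obtain V where em: "ext_max A ?L V ?p" using conjunct1[OF rest] by blast
  note surj = bspec[OF conjunct2[OF rest]]
  have yL: "var_y \<in> ?L" by (rule kalg_gen(2)) simp
  have yA: "var_y \<notin> A"
    by (rule y_not_in_proper[OF _ N]) (use em in \<open>simp add: insert_commute\<close>)
  have K: "carrier (kalg {var_t}) \<subseteq> A"
    using N kalg_mono[of "{var_t}" "{var_t, inverse var_y}"] by blast
  have "?L \<subseteq> carrier (kalg {var_t, inverse var_t, var_y, inverse var_y})" by (rule kalg_mono) auto
  then have "\<exists>!c. var_t - const c \<in> ?p"
    by (rule crucial_value_exists[OF em _ K yL yA])
  then have "var_t - const (crucial_value A) \<in> ?p" unfolding crucial_value_def by (rule theI')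
  then show ?thesis using that em N Theta_well_defined[OF em N _ surj[OF yL]] by blast
qed

theorem Theta_bij:
  "bij_betw (\<lambda>A. A \<inter> poly_ty) \<N> (\<M> :: 'k::alg_closed_field poly poly fract set set)"
  unfolding bij_betw_def
proof
  show "inj_on (\<lambda>A. A \<inter> poly_ty) (\<N> :: 'k poly poly fract set set)"
  proof (rule inj_onI)
    fix A A' :: "'k poly poly fract set" assume A: "A \<in> \<N>" "A' \<in> \<N>" "A \<inter> poly_ty = A' \<inter> poly_ty"
    have dec: "D = {x \<in> carrier laurent_y. \<exists>f\<in>D \<inter> poly_ty. x - f \<in> carrier (kalg {var_t, inverse var_y})}"
      if D: "D \<in> \<N>" for D :: "'k poly poly fract set"
    proof -
      obtain V where V: "ext_max D (carrier laurent_y) V (crucial_ideal D laurent_y)"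
        "carrier (kalg {var_t, inverse var_y}) \<subseteq> D" using N_ext_max[OF D] by blast
      show ?thesis by (rule Theta_decomposition[OF ext_max.A(2,1)[OF V(1)] V(2)])
    qed
    show "A = A'" using dec[OF A(1)] dec[OF A(2)] A(3) by simp
  qed
  show "(\<lambda>A. A \<inter> poly_ty) ` \<N> = (\<M> :: 'k poly poly fract set set)"
  proof
    show "(\<lambda>A. A \<inter> poly_ty) ` \<N> \<subseteq> (\<M> :: 'k poly poly fract set set)"
    proof
      fix B :: "'k poly poly fract set" assume "B \<in> (\<lambda>A. A \<inter> poly_ty) ` \<N>"
      then obtain A where A: "A \<in> \<N>" "B = A \<inter> poly_ty" by blast
      obtain V where V: "carrier (kalg {var_t, inverse var_y}) \<subseteq> A"
        "ext_max B poly_ty V (crucial_ideal A laurent_y \<inter> poly_ty)"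
        using N_ext_max[OF A(1)] unfolding A(2) by blast
      have "carrier (kalg {var_t}) \<subseteq> carrier (kalg {var_t, inverse var_y})"
        "carrier (kalg {var_t}) \<subseteq> poly_ty" by (rule kalg_mono, blast)+
      then have "carrier (kalg {var_t}) \<subseteq> B" using V(1) A(2) by blast
      then show "B \<in> \<M>" unfolding M_iff using V(2) crucial_ideal_kalg[OF V(2)] by auto
    qed
    show "(\<M> :: 'k poly poly fract set set) \<subseteq> (\<lambda>A. A \<inter> poly_ty) ` \<N>"
    proof
      fix B :: "'k poly poly fract set" assume "B \<in> \<M>"
      then obtain V where "ext_max B poly_ty V (crucial_ideal B (kalg {var_t, var_y}))"
        "carrier (kalg {var_t}) \<subseteq> B" unfolding M_iff by blast
      note W = Theta_onto[OF this]
      show "B \<in> (\<lambda>A. A \<inter> poly_ty) ` \<N>" by (rule rev_image_eqI[OF W(1)]) (simp add: W(2))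
    qed
  qed
qed

section \<open>The map \<open>Phi\<close> on subalgebras of \<open>k[t, 1/t, y]\<close>\<close>

abbreviation laurent_t :: "'k::field poly poly fract ring" where
  "laurent_t \<equiv> kalg {var_t, inverse var_t, var_y}"

lemma laurent_t_clear: "x \<in> carrier laurent_t \<Longrightarrow> \<exists>n. var_t ^ n * x \<in> poly_ty"
  using clear_powers[of var_t x] kalg_gen(2) var_nonzero(1) by (simp add: insert_commute) blast

lemma inverse_power_cancel: "inverse var_t ^ n * (var_t ^ n * x) = x"
proof -
  have "inverse var_t ^ n * var_t ^ n = 1"
    unfolding power_mult_distrib[symmetric] left_inverse[OF var_nonzero(1)] by simp
  then show ?thesis by (metis mult.assoc mult.left_neutral)
qed

text \<open>Being a unit of \<open>A\<close>, \<open>t\<close> is outside \<open>p\<close>, and its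
  powers are the denominators for \<open>descend\<close> and recover \<open>A\<close> from its
  polynomial part. For the residues, \<open>t\<close> is congruent to a nonzero constant
  \<open>c\<close> modulo \<open>p\<close>, hence \<open>1 / t\<close> to
  \<open>1 / c\<close>.\<close>

lemma Phi_well_defined:
  fixes A V p :: "'k::alg_closed_field poly poly fract set"
  assumes em: "ext_max A (carrier laurent_t) V p"
    and K: "carrier (kalg {var_t, inverse var_t}) \<subseteq> A"
  shows "ext_max (A \<inter> poly_ty) poly_ty V (p \<inter> poly_ty)" "var_t \<notin> p"
    "A = {x \<in> carrier laurent_t. \<exists>n. var_t ^ n * x \<in> A \<inter> poly_ty}"
proof -
  interpret ext_max A "carrier laurent_t" V p by (rule em)
  have PL: "poly_ty \<subseteq> carrier laurent_t" by (rule kalg_mono) auto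
  have yP: "var_y \<in> poly_ty" using kalg_gen(2) by blast
  have yA: "var_y \<notin> A"
    by (rule y_not_in_proper[OF _ K]) (use em in \<open>simp add: insert_commute\<close>)
  have tA: "var_t \<in> A" and itA: "inverse var_t \<in> A" and cA: "const d \<in> A" for d
    using K kalg_gen by blast+
  have tP: "var_t \<in> poly_ty" using kalg_gen(2) by blast
  have B: "subring_set (A \<inter> poly_ty)" by (rule subring_set_Int[OF A(1) subring_kalg])
  show tp: "var_t \<notin> p"
  proof
    assume "var_t \<in> p"
    then have "var_t * inverse var_t \<in> p" using p_ideal(5) itA by blast
    then show False unfolding right_inverse[OF var_nonzero(1)] using prime_setD(2)[OF p_prime] by blast
  qed
  have clear: "\<exists>n. var_t ^ n * a \<in> A \<inter> poly_ty" if a: "a \<in> A" for a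
  proof -
    obtain n where "var_t ^ n * a \<in> poly_ty" using laurent_t_clear a A(2) by blast
    moreover have "var_t ^ n * a \<in> A" using A_closed(5)[OF A_closed(7)[OF tA] a] .
    ultimately show ?thesis by blast
  qed
  have uncleared: "a \<in> A" if "var_t ^ n * a \<in> A" for n a
    using A_closed(5)[OF A_closed(7)[OF itA, of n] that] unfolding inverse_power_cancel .
  show "A = {x \<in> carrier laurent_t. \<exists>n. var_t ^ n * x \<in> A \<inter> poly_ty}"
    using clear uncleared A(2) by blast
  have K1: "carrier (kalg {var_t}) \<subseteq> A"
    using K kalg_mono[of "{var_t}" "{var_t, inverse var_t}"] by blast
  have "carrier laurent_t \<subseteq> carrier (kalg {var_t, inverse var_t, var_y, inverse var_y})"
    by (rule kalg_mono) auto
  then obtain c where c: "var_t - const c \<in> p"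
    using crucial_value_exists[OF em _ K1 _ yA] yP PL by blast
  show "ext_max (A \<inter> poly_ty) poly_ty V (p \<inter> poly_ty)"
  proof (rule descend[OF subring_kalg PL _ _ yP yA])
    let ?T = "{x \<in> A. \<exists>b\<in>A \<inter> poly_ty. x - b \<in> p}"
    have T: "subring_set ?T" using subring_congruent[OF A(1) B _ prime_setD(1)[OF p_prime]] by blast
    have BT: "A \<inter> poly_ty \<subseteq> ?T"
      proof
        fix x assume "x \<in> A \<inter> poly_ty"
        moreover have "x - x \<in> p" using p_ideal(2) by simp
        ultimately show "x \<in> ?T" by blast
      qed
    have c0: "c \<noteq> 0"
    proof
      assume "c = 0"
      then show False using c tp unfolding const_def by simp
    qed
    have "const (inverse c) * const c = 1"
      unfolding const_def to_fract_mult[symmetric] to_fract_1[symmetric] using c0 by (simp add: one_pCons)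
    moreover have "inverse var_t * var_t = 1" by (rule left_inverse[OF var_nonzero(1)])
    \<comment> \<open>The identity \<open>1/t - 1/c = - (t - c) / (t c)\<close>.\<close>
    moreover have "(- (inverse var_t * const (inverse c))) * (var_t - const c)
        = inverse var_t * (const (inverse c) * const c) - (inverse var_t * var_t) * const (inverse c)"
      by (simp add: algebra_simps)
    ultimately have "inverse var_t - const (inverse c)
        = (- (inverse var_t * const (inverse c))) * (var_t - const c)"
      by (metis mult.left_neutral mult.right_neutral)
    also have "\<dots> \<in> p"
      by (rule p_ideal(4)[OF A_closed(6)[OF A_closed(5)[OF itA cA]] c])
    finally have itT: "inverse var_t \<in> ?T" using itA cA kalg_gen(1) by blast
    show "\<exists>b\<in>A \<inter> poly_ty. a - b \<in> p" if aA: "a \<in> A" for a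
    proof -
      obtain n where "var_t ^ n * a \<in> ?T" using clear[OF aA] BT by blast
      then have "inverse var_t ^ n * (var_t ^ n * a) \<in> ?T"
        using subring_setD(5,7)[OF T] itT by blast
      then show ?thesis unfolding inverse_power_cancel by blast
    qed
    show "\<exists>s\<in>A \<inter> poly_ty - p. s * a \<in> A \<inter> poly_ty" if aA: "a \<in> A" for a
    proof -
      obtain n where "var_t ^ n * a \<in> A \<inter> poly_ty" using clear[OF aA] by blast
      moreover have "var_t ^ n \<notin> p" using prime_set_power[OF A(1) p_prime tA] tp by blast
      moreover have "var_t ^ n \<in> A \<inter> poly_ty" using subring_setD(7)[OF B] tA tP by blast
      ultimately show ?thesis by blast
    qed
  next
    fix T assume T: "subring_set T" "A \<inter> poly_ty \<subseteq> T" "T \<subseteq> poly_ty" "var_y \<in> T"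
    have "carrier (kalg {var_t}) \<subseteq> A \<inter> poly_ty"
      using cA tA tP kalg_gen(1) by (intro kalg_least[OF B]) auto
    then show "T = poly_ty" using poly_ty_least[OF T(1) _ T(4)] T(2,3) by blast
  qed
qed

text \<open>As \<open>t\<close> is in \<open>B\<close> but not in \<open>p\<close>, it is a unit of
  \<open>V\<close>. Hence \<open>1 / t\<close> lies in \<open>V\<close>, and multiplying by powers
  of \<open>t\<close> turns an element outside \<open>V\<close> into a polynomial outside
  \<open>V\<close>.\<close>

lemma Phi_onto:
  fixes B V p :: "'k::field poly poly fract set"
  assumes em: "ext_max B poly_ty V p" and K: "carrier (kalg {var_t}) \<subseteq> B" and t: "var_t \<notin> p"
  shows "ext_max (V \<inter> carrier laurent_t) (carrier laurent_t) V (val_ideal V \<inter> (V \<inter> carrier laurent_t))"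
    "V \<inter> carrier laurent_t \<inter> poly_ty = B"
    "carrier (kalg {var_t, inverse var_t}) \<subseteq> V \<inter> carrier laurent_t"
proof -
  interpret B: ext_max B poly_ty V p by (rule em)
  let ?L = "carrier laurent_t"
  let ?A = "V \<inter> ?L"
  have PL: "poly_ty \<subseteq> ?L" by (rule kalg_mono) auto
  have constV: "range const \<subseteq> V" and tB: "var_t \<in> B" and tV: "var_t \<in> V"
    using K kalg_gen B.A_eq by blast+
  have itV: "inverse var_t \<in> V"
    using inverse_in_valuation_ring[OF tV] t tB unfolding B.p_eq by blast
  show N: "carrier (kalg {var_t, inverse var_t}) \<subseteq> ?A"
  proof -
    have "carrier (kalg {var_t, inverse var_t}) \<subseteq> V"
      using constV tV itV by (intro kalg_least[OF B.V_subring]) auto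
    moreover have "carrier (kalg {var_t, inverse var_t}) \<subseteq> ?L" by (rule kalg_mono) auto
    ultimately show ?thesis by blast
  qed
  have gen: "T = ?L" if T: "subring_set T" "?A \<subseteq> T" "T \<subseteq> ?L" "poly_ty \<subseteq> T" for T
  proof -
    have "?L \<subseteq> T"
      using T(4) kalg_gen N T(2) by (intro kalg_least[OF T(1)]) blast+
    then show "T = ?L" using T(3) by blast
  qed
  have pole: "\<exists>g\<in>T \<inter> poly_ty. g \<notin> V"
    if T: "subring_set T" "?A \<subseteq> T" "T \<subseteq> ?L" and f: "f \<in> T" "f \<notin> V" for T f
  proof -
    obtain n where n: "var_t ^ n * f \<in> poly_ty" using laurent_t_clear f(1) T(3) by blast
    have "var_t \<in> T" using N kalg_gen(2) T(2) by blast
    then have "var_t ^ n * f \<in> T" using subring_setD(5,7)[OF T(1)] f(1) by blast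
    moreover have "var_t ^ n * f \<notin> V"
    proof
      assume "var_t ^ n * f \<in> V"
      from B.V_closed(5)[OF B.V_closed(7)[OF itV, of n] this]
      show False using f(2) unfolding inverse_power_cancel by blast
    qed
    ultimately show "\<exists>g\<in>T \<inter> poly_ty. g \<notin> V" using n by blast
  qed
  note asc = ascend[OF em subring_kalg PL gen pole]
  show "ext_max ?A ?L V (val_ideal V \<inter> ?A)" by (rule asc(1))
  show "?A \<inter> poly_ty = B" by (rule asc(2))
qed

theorem Phi_bij:
  "bij_betw (\<lambda>A'. A' \<inter> poly_ty)
     {A' \<in> ext_max_subalgebras laurent_t. carrier (kalg {var_t, inverse var_t}) \<subseteq> A'}
     {B \<in> (\<M> :: 'k::alg_closed_field poly poly fract set set). var_t \<notin> crucial_ideal B (kalg {var_t, var_y})}"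
  (is "bij_betw _ ?S ?T")
proof -
  have S: "A \<in> ?S \<longleftrightarrow> carrier (kalg {var_t, inverse var_t}) \<subseteq> A \<and>
      (\<exists>V. ext_max A (carrier laurent_t) V (crucial_ideal A laurent_t))" for A :: "'k poly poly fract set"
  proof -
    have "range const \<subseteq> A" if "carrier (kalg {var_t, inverse var_t}) \<subseteq> A" using that kalg_gen(1) by blast
    then show ?thesis using ext_max_subalgebras_iff by blast
  qed
  show ?thesis
    unfolding bij_betw_def
  proof
    show "inj_on (\<lambda>A'. A' \<inter> poly_ty) ?S"
    proof (rule inj_onI)
      fix A A' assume A: "A \<in> ?S" "A' \<in> ?S" "A \<inter> poly_ty = A' \<inter> poly_ty"
      have dec: "D = {x \<in> carrier laurent_t. \<exists>n. var_t ^ n * x \<in> D \<inter> poly_ty}" if D: "D \<in> ?S" for D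
      proof -
        obtain V where "ext_max D (carrier laurent_t) V (crucial_ideal D laurent_t)"
          "carrier (kalg {var_t, inverse var_t}) \<subseteq> D" using D unfolding S by blast
        then show ?thesis by (rule Phi_well_defined(3))
      qed
      show "A = A'" using dec[OF A(1)] dec[OF A(2)] A(3) by simp
    qed
    show "(\<lambda>A'. A' \<inter> poly_ty) ` ?S = ?T"
    proof
      show "(\<lambda>A'. A' \<inter> poly_ty) ` ?S \<subseteq> ?T"
      proof
        fix B assume "B \<in> (\<lambda>A'. A' \<inter> poly_ty) ` ?S"
        then obtain A where A: "A \<in> ?S" "B = A \<inter> poly_ty" by blast
        then obtain V where K: "carrier (kalg {var_t, inverse var_t}) \<subseteq> A"
          and V: "ext_max A (carrier laurent_t) V (crucial_ideal A laurent_t)" unfolding S by blast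
        note W = Phi_well_defined(1,2)[OF V K, folded A(2)]
        have "carrier (kalg {var_t}) \<subseteq> carrier (kalg {var_t, inverse var_t})"
          "carrier (kalg {var_t}) \<subseteq> poly_ty" by (rule kalg_mono, blast)+
        then have "carrier (kalg {var_t}) \<subseteq> B" using K A(2) by blast
        then show "B \<in> ?T" using W crucial_ideal_kalg[OF W(1)] unfolding M_iff by auto
      qed
      show "?T \<subseteq> (\<lambda>A'. A' \<inter> poly_ty) ` ?S"
      proof
        fix B assume B: "B \<in> ?T"
        then obtain V where V: "ext_max B poly_ty V (crucial_ideal B (kalg {var_t, var_y}))"
          "carrier (kalg {var_t}) \<subseteq> B" unfolding M_iff by blast
        have "var_t \<notin> crucial_ideal B (kalg {var_t, var_y})" using B by blast
        note W = Phi_onto[OF V this]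
        have "V \<inter> carrier laurent_t \<in> ?S"
          unfolding S using W(1,3) crucial_ideal_kalg[OF W(1)] by auto
        then show "B \<in> (\<lambda>A'. A' \<inter> poly_ty) ` ?S" by (rule rev_image_eqI) (simp add: W(2))
      qed
    qed
  qed
qed

theorem theorem1p0p6:
  shows "bij_betw (\<lambda>A. A \<inter> carrier (kalg {var_t, var_y}))
           \<N> (\<M> :: 'k::alg_closed_field poly poly fract set set) \<and>
         bij_betw (\<lambda>A'. A' \<inter> carrier (kalg {var_t, var_y}))
           {A' \<in> ext_max_subalgebras (kalg {var_t, inverse var_t, var_y}).
              carrier (kalg {var_t, inverse var_t}) \<subseteq> A'}
           {B \<in> (\<M> :: 'k poly poly fract set set).
              var_t \<notin> crucial_ideal B (kalg {var_t, var_y})}"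
  using Theta_bij Phi_bij by blast

end
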